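(* Let $k>0$. Suppose that $\phi\in C(\mathbb{R})$ satisfies $$\phi(t)=\begin{cases}c_+\,\mathrm{e}^{\mathrm{i}k|t|}|t|^{-1/2}+O(|t|^{-p}),& t\to+\infty,\\ c_-\,\mathrm{e}^{\mathrm{i}k|t|}|t|^{-1/2}+O(|t|^{-p}),& t\to-\infty,\end{cases}$$ for some constants $c_+,c_-\in\mathbb{C}$ and $p>1$. Define, for $\boldsymbol{x}=(x_1,x_2)\in\mathbb{R}^2_+:=(0,\infty)\times\mathbb{R}$, $$u(\boldsymbol{x}):=\int_{\mathbb{R}}\mathcal{H}(k;x_1,x_2-t)\,\phi(t)\,\mathrm{d}t .$$ Then: (i) there exists a constant $C>0$ such that $|u(\boldsymbol{x})|\le C(1+|\boldsymbol{x}|)^{-1/2}$ for all $\boldsymbol{x}\in\mathbb{R}^2_+$; (ii) for all $\varepsilon>0$, $$\lim_{R\to+\infty}R^{1/2}\sup\left\{\left|\frac{\partial u(\boldsymbol{x})}{\partial r}-\mathrm{i}ku(\boldsymbol{x})\right|:\ x_1>\varepsilon\text{ and }|\boldsymbol{x}|=R\right\}=0,$$ where $r=|\boldsymbol{x}|$.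
   Context: The kernel is $\mathcal{H}(k;x_1,x_2):=\dfrac{\mathrm{i}kx_1}{2}\dfrac{H^{(1)}_1(k|\boldsymbol{x}|)}{|\boldsymbol{x}|}$ for $\boldsymbol{x}=(x_1,x_2)$ with $x_1>0$, where $H^{(1)}_1$ is the Hankel function of the first kind of order 1. $\partial/\partial r$ denotes the radial derivative. *)

theory Defs
  imports "HOL-Analysis.Analysis" "HOL-Library.Landau_Symbols"
begin

text \<open>
  Bessel and Hankel functions of integer order \<open>n\<close>, for a positive real argument,
  given by their standard series (DLMF 10.2.2, 10.8.1 and 10.4.3).
  \<^const>\<open>Digamma\<close> is the logarithmic derivative of the Gamma function.
\<close>

definition bessel_J :: "nat \<Rightarrow> real \<Rightarrow> real" where
  "bessel_J n z = (z / 2) ^ n * (\<Sum>m. (- (z\<^sup>2 / 4)) ^ m / (fact m * fact (n + m)))"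

definition bessel_Y :: "nat \<Rightarrow> real \<Rightarrow> real" where
  "bessel_Y n z =
     - (1 / (pi * (z / 2) ^ n)) * (\<Sum>m<n. fact (n - m - 1) / fact m * (z\<^sup>2 / 4) ^ m)
     + 2 / pi * ln (z / 2) * bessel_J n z
     - (z / 2) ^ n / pi *
         (\<Sum>m. (Digamma (real m + 1) + Digamma (real (n + m) + 1))
                 * (- (z\<^sup>2 / 4)) ^ m / (fact m * fact (n + m)))"

definition hankel1 :: "nat \<Rightarrow> real \<Rightarrow> complex" where
  "hankel1 n z = Complex (bessel_J n z) (bessel_Y n z)"

definition half_plane :: "(real \<times> real) set" where
  "half_plane = {x. fst x > 0}"

definition hp_kernel :: "real \<Rightarrow> real \<Rightarrow> real \<Rightarrow> complex" where
  "hp_kernel k x1 x2 =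
     \<i> * of_real (k * x1) / 2 * (hankel1 1 (k * norm (x1, x2)) / of_real (norm (x1, x2)))"

definition hp_potential :: "real \<Rightarrow> (real \<Rightarrow> complex) \<Rightarrow> real \<times> real \<Rightarrow> complex" where
  "hp_potential k \<phi> x = (LINT t|lborel. hp_kernel k (fst x) (snd x - t) * \<phi> t)"

text \<open>
  The restriction of \<open>u\<close> to the ray from the origin through \<open>x\<close>, as a function of the radius;
  the radial derivative at \<open>x\<close> is its derivative at \<open>r = norm x\<close>.
\<close>

definition along_ray :: "(real \<times> real \<Rightarrow> complex) \<Rightarrow> real \<times> real \<Rightarrow> real \<Rightarrow> complex" where
  "along_ray u x r = u (r *\<^sub>R (x /\<^sub>R norm x))"

definition radial_deriv :: "(real \<times> real \<Rightarrow> complex) \<Rightarrow> real \<times> real \<Rightarrow> complex" where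
  "radial_deriv u x = vector_derivative (along_ray u x) (at (norm x))"

end

(* Writing the kernel as x1 * h(|x|), the profile h is up to scaling H_1(z) / z. Both
  the defining series and the Laplace integral
    e^(iz) * integral over s > 0 of e^(-zs) * sqrt(s^2 - 2is)
  solve f'' + 3 f' / z + f = 0; as their difference tends to 0 at 0, an energy argument
  shows that they agree, and the integral yields the behaviour of h and h' - ikh at infinity.

  The function w(a,t) = e^(ik rho) / sqrt(1 + a + it), where rho is the distance to (-1,0), solves
  the Helmholtz equation in the half plane. Green's identity on long rectangles, in
  which the radiation condition removes the contribution from infinity, shows that w is the
  potential of its own boundary values, and so is its reflection in t. A combination of these
  two boundary values has the same leading terms as phi at both ends, so phi differs from it by
  some psi = O(|t|^(-q)) with q > 1. The decay and the radiation condition are explicit for w;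
  for the potential of psi they follow from kernel estimates on |t| <= R/2 and |t| > R/2. *)

theory Submission
  imports Defs "HOL-Real_Asymp.Real_Asymp" "HOL-Probability.Sinc_Integral"
begin

text \<open>Absolute values are too coarse for \<open>phi\<close> itself: the L1 norm of the kernel
  is only bounded by a multiple of \<open>R^(1/2)\<close>, so a density of size
  \<open>|t|^(-1/2)\<close> would give a bounded potential at distance \<open>R\<close>, without
  decay. The oscillating tails are therefore matched by an exact solution instead of being
  estimated. In polar coordinates \<open>(rho, theta)\<close> about (-1,0) it is
  \<open>e^(ik rho) rho^(-1/2) e^(-i theta / 2)\<close>, the separated outgoing solution of angular
  order 1/2: its radial factor is elementary and has exactly the tail of \<open>phi\<close>, and the
  centre (-1,0) keeps the boundary values continuous. They match the leading terms up to
  \<open>|t|^(-3/2)\<close>, hence \<open>q = min p (3/2)\<close>.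

  The series and the integral are both singular at 0, while the ODE has a solution bounded there, a
  multiple of \<open>J_1(z) / z\<close>. So the comparison requires the expansion of the integral
  through its constant term, after \<open>1 / z^2\<close> and \<open>- ln z / 2\<close>. Much of the
  work on the Laplace integral serves this constant, in which Euler's constant appears.\<close>

section \<open>Difference quotients, the mean value inequality and differentiation under the
  integral sign\<close>

lemma has_vector_derivative_at_iff_tendsto:
  fixes f :: "real \<Rightarrow> 'a::real_normed_vector"
  shows "(f has_vector_derivative D) (at x within S) \<longleftrightarrow>
    ((\<lambda>y. (f y - f x) /\<^sub>R (y - x)) \<longlongrightarrow> D) (at x within S)"
proof -
  have "norm ((f y - f x - (y - x) *\<^sub>R D) /\<^sub>R norm (y - x)) =
     norm ((f y - f x) /\<^sub>R (y - x) - D)" if "y \<noteq> x" for y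
  proof -
    have "(f y - f x) /\<^sub>R (y - x) - D = (f y - f x - (y - x) *\<^sub>R D) /\<^sub>R (y - x)"
      using that by (simp add: scaleR_right_diff_distrib)
    then show ?thesis by simp
  qed
  then have "((\<lambda>y. norm ((f y - f x - (y - x) *\<^sub>R D) /\<^sub>R norm (y - x))) \<longlongrightarrow> 0) (at x within S) \<longleftrightarrow>
     ((\<lambda>y. norm ((f y - f x) /\<^sub>R (y - x) - D)) \<longlongrightarrow> 0) (at x within S)"
    by (intro filterlim_cong) (auto simp: eventually_at_filter)
  then show ?thesis
    unfolding has_vector_derivative_def has_derivative_within tendsto_norm_zero_iff
    by (simp add: bounded_linear_scaleR_left LIM_zero_iff diff_diff_eq divide_inverse)
qed

lemma vector_derivative_bound:
  fixes f :: "real \<Rightarrow> 'a::real_normed_vector"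
  assumes "convex S" "\<And>x. x \<in> S \<Longrightarrow> (f has_vector_derivative f' x) (at x within S)"
    and "\<And>x. x \<in> S \<Longrightarrow> norm (f' x) \<le> B" "x \<in> S" "y \<in> S"
  shows "norm (f x - f y) \<le> B * \<bar>x - y\<bar>"
proof -
  have "norm (f x - f y) \<le> B * norm (x - y)"
  proof (rule differentiable_bound[OF assms(1)])
    fix z assume z: "z \<in> S"
    show "(f has_derivative (\<lambda>h. h *\<^sub>R f' z)) (at z within S)"
      using assms(2)[OF z] by (simp add: has_vector_derivative_def)
    show "onorm (\<lambda>h. h *\<^sub>R f' z) \<le> B"
    proof (rule onorm_bound)
      show "0 \<le> B" using assms(3)[OF z] norm_ge_zero order_trans by blast
      show "norm (h *\<^sub>R f' z) \<le> B * norm h" for h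
        using assms(3)[OF z] by (simp add: mult.commute[of B] mult_left_mono)
    qed
  qed (use assms in auto)
  then show ?thesis by simp
qed

text \<open>The mean value inequality bounds the difference quotients by \<open>g\<close>, so
  dominated convergence applies along every sequence tending to \<open>x\<close>. Measurability of
  \<open>f' x\<close> follows because it is a pointwise limit of quotients.\<close>

lemma has_vector_derivative_integral_dominated:
  fixes f f' :: "real \<Rightarrow> 'a \<Rightarrow> complex"
  assumes d: "d > 0"
    and int: "\<And>y. \<bar>y - x\<bar> < d \<Longrightarrow> integrable M (f y)"
    and deriv: "\<And>y t. \<bar>y - x\<bar> < d \<Longrightarrow> t \<in> space M \<Longrightarrow> ((\<lambda>y. f y t) has_vector_derivative f' y t) (at y)"
    and bound: "\<And>y t. \<bar>y - x\<bar> < d \<Longrightarrow> t \<in> space M \<Longrightarrow> norm (f' y t) \<le> g t"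
    and g: "integrable M g"
  shows "integrable M (f' x)"
    and "((\<lambda>y. \<integral>t. f y t \<partial>M) has_vector_derivative (\<integral>t. f' x t \<partial>M)) (at x)"
proof -
  define Q where "Q y t = (f y t - f x t) /\<^sub>R (y - x)" for y t
  have Qlim: "((\<lambda>y. Q y t) \<longlongrightarrow> f' x t) (at x within ball x d)" if "t \<in> space M" for t
    using has_vector_derivative_at_within[OF deriv[of x t], of "ball x d"] d that
    unfolding Q_def has_vector_derivative_at_iff_tendsto by simp
  have Qint: "integrable M (Q y)" if "y \<in> ball x d" for y
    using int[of x] int[of y] that d unfolding Q_def by (auto simp: dist_real_def abs_minus_commute)
  have Qbd: "norm (Q y t) \<le> g t" if "y \<in> ball x d" "y \<noteq> x" "t \<in> space M" for y t
  proof -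
    have "norm (f y t - f x t) \<le> g t * \<bar>y - x\<bar>"
      by (rule vector_derivative_bound[of "ball x d" "\<lambda>y. f y t" "\<lambda>y. f' y t"])
         (use that d in \<open>simp_all add: dist_real_def abs_minus_commute has_vector_derivative_at_within[OF deriv] bound\<close>)
    then show ?thesis
      using that by (simp add: Q_def divide_simps)
  qed
  have main: "integrable M (f' x) \<and> (\<lambda>n. integral\<^sup>L M (Q (X n))) \<longlonglongrightarrow> integral\<^sup>L M (f' x)"
    if X: "\<forall>n. X n \<in> ball x d - {x}" "X \<longlonglongrightarrow> x" for X
  proof -
    have lim: "(\<lambda>n. Q (X n) t) \<longlonglongrightarrow> f' x t" if "t \<in> space M" for t
      using Qlim[OF that] X unfolding tendsto_at_iff_sequentially comp_def by blast
    have meas: "Q (X n) \<in> borel_measurable M" for n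
      using Qint[of "X n"] X(1) by auto
    have measf: "f' x \<in> borel_measurable M"
      by (rule borel_measurable_LIMSEQ_metric[OF meas lim])
    have AE1: "AE t in M. (\<lambda>n. Q (X n) t) \<longlonglongrightarrow> f' x t" using lim by auto
    have AE2: "AE t in M. norm (Q (X n) t) \<le> g t" for n using Qbd[of "X n"] X(1) by auto
    show ?thesis
      using integrable_dominated_convergence[OF measf meas g AE1 AE2]
        integral_dominated_convergence[OF measf meas g AE1 AE2] by simp
  qed
  \<comment> \<open>\<open>main\<close> yields integrability of \<open>f' x\<close> only from an
    actual sequence in the punctured ball; the shift by 2 keeps even \<open>X0 0\<close> strictly
    inside.\<close>
  define X0 where "X0 n = x + d / real (n + 2)" for n
  have "X0 \<longlonglongrightarrow> x" unfolding X0_def by real_asymp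
  moreover have "\<forall>n. X0 n \<in> ball x d - {x}"
    using d by (auto simp: X0_def dist_real_def divide_simps)
  ultimately show "integrable M (f' x)" using main by blast
  have "((\<lambda>y. integral\<^sup>L M (Q y)) \<longlongrightarrow> integral\<^sup>L M (f' x)) (at x within ball x d)"
    using main unfolding tendsto_at_iff_sequentially comp_def by blast
  then have lim': "((\<lambda>y. integral\<^sup>L M (Q y)) \<longlongrightarrow> integral\<^sup>L M (f' x)) (at x)"
    using d by (simp add: at_within_open[OF _ open_ball])
  have ev: "\<forall>\<^sub>F y in at x. integral\<^sup>L M (Q y) = ((\<integral>t. f y t \<partial>M) - (\<integral>t. f x t \<partial>M)) /\<^sub>R (y - x)"
  proof -
    have "\<forall>\<^sub>F y in at x. y \<in> ball x d"
      using d by (intro eventually_at_in_open') auto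
    then show ?thesis
    proof eventually_elim
      case (elim y)
      then show ?case
        unfolding Q_def using int[of x] int[of y] d by (simp add: dist_real_def abs_minus_commute)
    qed
  qed
  show "((\<lambda>y. \<integral>t. f y t \<partial>M) has_vector_derivative (\<integral>t. f' x t \<partial>M)) (at x)"
    unfolding has_vector_derivative_at_iff_tendsto using Lim_transform_eventually[OF lim' ev] .
qed

text \<open>Substitution \<open>t = z * s\<close> in Euler's integral. That integral is available as
  a gauge integral; nonnegativity makes it absolutely integrable, and Borel measurability carries it
  from the completed measure to \<open>lborel\<close>.\<close>

lemma Gamma_integral_scaled:
  fixes z a :: real
  assumes z: "z > 0" and a: "a > 0"
  shows "set_integrable lborel {0<..} (\<lambda>s. exp (- z * s) * s powr (a - 1))"
    and "(LINT s:{0<..}|lborel. exp (- z * s) * s powr (a - 1)) = Gamma a * z powr (- a)"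
proof -
  have hi0: "((\<lambda>t. t powr (a - 1) / exp t) has_integral Gamma a) {0..}"
    using Gamma_integral_real[OF a] .
  have hi: "((\<lambda>t. exp (-t) * t powr (a - 1)) has_integral Gamma a) {0<..}"
  proof -
    have n1: "negligible {x \<in> {0..} - {0<..}. exp (- x) * x powr (a - 1) \<noteq> (0::real)}"
      by (rule negligible_subset[of "{0}"]) auto
    have n2: "negligible {x \<in> {0<..} - {0..}. exp (- x) * x powr (a - 1) \<noteq> (0::real)}"
      by (rule negligible_subset[of "{}"]) auto
    have h: "((\<lambda>t. exp (-t) * t powr (a - 1)) has_integral Gamma a) {0..}"
      using hi0 by (simp add: exp_minus field_simps)
    show ?thesis
      by (rule iffD1[OF has_integral_spike_set_eq[OF n1 n2] h])
  qed
  have ai: "(\<lambda>t. exp (-t) * t powr (a - 1)) absolutely_integrable_on {0<..}"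
    by (rule nonnegative_absolutely_integrable_1) (use hi in auto)
  have meas: "(\<lambda>t. indicator {0<..} t *\<^sub>R (exp (-t) * t powr (a - 1))) \<in> borel_measurable lborel"
    by measurable
  have int: "integrable lborel (\<lambda>t. indicator {0<..} t *\<^sub>R (exp (-t) * t powr (a - 1)))"
    using ai integrable_completion[OF meas] by (simp add: set_integrable_def)
  have eq: "(\<integral>t. indicator {0<..} t *\<^sub>R (exp (-t) * t powr (a - 1)) \<partial>lborel) = Gamma a"
    using set_lebesgue_integral_eq_integral(2)[OF ai] integral_completion[OF meas] integral_unique[OF hi]
    by (simp add: set_lebesgue_integral_def)
  have scale: "indicator {0<..} (0 + z * s) *\<^sub>R (exp (-(0 + z * s)) * (0 + z * s) powr (a - 1)) =
    z powr (a - 1) * (indicator {0<..} s *\<^sub>R (exp (- z * s) * s powr (a - 1)))" for s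
    using z by (auto simp: indicator_def zero_less_mult_iff powr_mult)
  have "integrable lborel (\<lambda>s. z powr (a - 1) * (indicator {0<..} s *\<^sub>R (exp (- z * s) * s powr (a - 1))))"
    using lborel_integrable_real_affine[OF int, of z 0] z unfolding scale by simp
  then show "set_integrable lborel {0<..} (\<lambda>s. exp (- z * s) * s powr (a - 1))"
    using z unfolding set_integrable_def by simp
  have "Gamma a = z * (z powr (a - 1) * (LINT s:{0<..}|lborel. exp (- z * s) * s powr (a - 1)))"
    using lborel_integral_real_affine[of z "\<lambda>t. indicator {0<..} t *\<^sub>R (exp (-t) * t powr (a - 1))" 0] z
    unfolding scale eq set_lebesgue_integral_def by simp
  moreover have "z * z powr (a - 1) = z powr a" using z by (simp add: powr_diff)
  ultimately have "Gamma a = z powr a * (LINT s:{0<..}|lborel. exp (- z * s) * s powr (a - 1))"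
    by (simp add: mult.assoc)
  then show "(LINT s:{0<..}|lborel. exp (- z * s) * s powr (a - 1)) = Gamma a * z powr (- a)"
    using z by (simp add: powr_minus field_simps)
qed

section \<open>Laplace integrals\<close>

definition laplace :: "(real \<Rightarrow> complex) \<Rightarrow> real \<Rightarrow> complex" where
  "laplace f z = (LINT s:{0<..}|lborel. exp (- z * s) *\<^sub>R f s)"

abbreviation laplace_integrable :: "(real \<Rightarrow> complex) \<Rightarrow> real \<Rightarrow> bool" where
  "laplace_integrable f z \<equiv> set_integrable lborel {0<..} (\<lambda>s. exp (- z * s) *\<^sub>R f s)"

text \<open>For \<open>y > z / 2\<close> half of the guaranteed decay
  \<open>exp (- (z / 2) * s)\<close> is spent on absorbing the new factor \<open>s\<close>; what
  remains is \<open>exp (- (z / 4) * s)\<close>, so integrability at \<open>z / 4\<close> supplies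
  the dominating function.\<close>

lemma has_vector_derivative_laplace:
  assumes int: "\<And>z. z > 0 \<Longrightarrow> laplace_integrable f z" and z: "z > 0"
  shows "laplace_integrable (\<lambda>s. s *\<^sub>R f s) z"
    and "(laplace f has_vector_derivative - laplace (\<lambda>s. s *\<^sub>R f s) z) (at z)"
proof -
  let ?F = "\<lambda>y s. indicator {0<..} s *\<^sub>R (exp (- y * s) *\<^sub>R f s)"
  let ?F' = "\<lambda>y s. indicator {0<..} s *\<^sub>R ((- s * exp (- y * s)) *\<^sub>R f s)"
  let ?g = "\<lambda>s. 4 / z * norm (indicator {0<..} s *\<^sub>R (exp (- (z / 4) * s) *\<^sub>R f s))"
  have d: "((\<lambda>y. ?F y s) has_vector_derivative ?F' y s) (at y)" for y s
    by (auto intro!: derivative_eq_intros simp: has_vector_derivative_def algebra_simps)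
  have b: "norm (?F' y s) \<le> ?g s" if "\<bar>y - z\<bar> < z / 2" for y s
  proof (cases "s > 0")
    case True
    have y: "y > z / 2" using that by (auto simp: abs_if split: if_splits)
    have "exp (- y * s) \<le> exp (- (z / 4) * s + - (z / 4) * s)"
      using mult_right_mono[of "z / 2" y s] y True by (auto simp: algebra_simps)
    also have "\<dots> = exp (- (z / 4) * s) * exp (- (z / 4) * s)" by (rule exp_add)
    also have "\<dots> \<le> 1 / (z / 4 * s) * exp (- (z / 4) * s)"
    proof (rule mult_right_mono)
      have "z / 4 * s \<le> exp (z / 4 * s)" using exp_ge_add_one_self[of "z / 4 * s"] by linarith
      then show "exp (- (z / 4) * s) \<le> 1 / (z / 4 * s)" using True z by (simp add: exp_minus field_simps)
    qed simp
    finally have "s * exp (- y * s) \<le> s * (1 / (z / 4 * s) * exp (- (z / 4) * s))"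
      using True by (intro mult_left_mono) auto
    also have "\<dots> = 4 / z * exp (- (z / 4) * s)" using True z by simp
    finally have "s * exp (- y * s) * norm (f s) \<le> 4 / z * exp (- (z / 4) * s) * norm (f s)"
      by (rule mult_right_mono) simp
    then show ?thesis using True by (simp add: mult.assoc)
  qed (use z in \<open>auto simp: indicator_def\<close>)
  have i: "integrable lborel (?F y)" if "\<bar>y - z\<bar> < z / 2" for y
  proof -
    have "y > 0" using that z by (auto simp: abs_if split: if_splits)
    then show ?thesis using int[of y] by (simp add: set_integrable_def)
  qed
  have g: "integrable lborel ?g"
    using int[of "z / 4"] z unfolding set_integrable_def
    by (intro integrable_mult_right integrable_norm) simp
  note * = has_vector_derivative_integral_dominated[of "z / 2" z lborel ?F ?F' ?g, OF _ i d b g]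
  have eq: "?F' y s = - (indicator {0<..} s *\<^sub>R (exp (- y * s) *\<^sub>R (s *\<^sub>R f s)))" for y s
    by (simp add: mult.commute)
  show "laplace_integrable (\<lambda>s. s *\<^sub>R f s) z"
    using *(1) z unfolding eq set_integrable_def by simp
  show "(laplace f has_vector_derivative - laplace (\<lambda>s. s *\<^sub>R f s) z) (at z)"
    using *(2) z unfolding eq laplace_def set_lebesgue_integral_def by simp
qed

text \<open>Comparison with two Gamma integrals. Two powers are allowed because one has to cover the
  behaviour of \<open>f\<close> near 0 and the other its growth at infinity.\<close>

lemma laplace_bound:
  assumes cont: "continuous_on {0<..} f" and z: "z > 0" and ab: "a > 0" "b > 0"
    and bd: "\<And>s. s > 0 \<Longrightarrow> norm (f s) \<le> C * (s powr (a - 1) + s powr (b - 1))"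
  shows "laplace_integrable f z"
    and "norm (laplace f z) \<le> C * (Gamma a * z powr (- a) + Gamma b * z powr (- b))"
proof -
  let ?h = "\<lambda>s. C * (exp (- z * s) * s powr (a - 1) + exp (- z * s) * s powr (b - 1))"
  have h: "set_integrable lborel {0<..} ?h"
    using Gamma_integral_scaled(1)[OF z] ab by (intro set_integrable_mult_right set_integral_add) auto
  have le: "norm (exp (- z * s) *\<^sub>R f s) \<le> ?h s" if "s > 0" for s
    using mult_left_mono[OF bd[OF that], of "exp (- z * s)"] by (simp add: algebra_simps)
  show int: "laplace_integrable f z"
  proof (rule set_integrable_bound[OF h])
    show "set_borel_measurable lborel {0<..} (\<lambda>s. exp (- z * s) *\<^sub>R f s)"
    proof -
      have "(\<lambda>s. indicator {0<..} s *\<^sub>R (exp (- z * s) *\<^sub>R f s)) \<in> borel_measurable borel"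
        by (intro borel_measurable_continuous_on_indicator continuous_intros cont) auto
      then show ?thesis by (simp add: set_borel_measurable_def)
    qed
    show "AE x in lborel. x \<in> {0<..} \<longrightarrow> norm (exp (- z * x) *\<^sub>R f x) \<le> norm (?h x)"
      using le by (intro AE_I2) (force intro: order_trans)
  qed
  have "norm (laplace f z) \<le> (LINT s:{0<..}|lborel. norm (exp (- z * s) *\<^sub>R f s))"
    unfolding laplace_def by (rule set_integral_norm_bound[OF int])
  also have "\<dots> \<le> (LINT s:{0<..}|lborel. ?h s)"
    by (rule set_integral_mono[OF set_integrable_norm[OF int] h]) (use le in auto)
  also have "\<dots> = C * (Gamma a * z powr (- a) + Gamma b * z powr (- b))"
    using Gamma_integral_scaled[OF z] ab by (simp add: set_integral_add)
  finally show "norm (laplace f z) \<le> C * (Gamma a * z powr (- a) + Gamma b * z powr (- b))" .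
qed

text \<open>Integration by parts: the derivative of \<open>exp (- z * s) *\<^sub>R F s\<close>
  integrates to the difference of its boundary values, and both vanish.\<close>

lemma laplace_FTC:
  assumes "z > 0" and F: "\<And>s. s > 0 \<Longrightarrow> (F has_vector_derivative f s) (at s)"
    and cont: "continuous_on {0<..} f" and int: "laplace_integrable f z"
    and int': "laplace_integrable F z"
    and lim0: "((\<lambda>s. exp (- z * s) *\<^sub>R F s) \<longlongrightarrow> 0) (at_right 0)"
    and lim: "((\<lambda>s. exp (- z * s) *\<^sub>R F s) \<longlongrightarrow> 0) at_top"
  shows "laplace f z = z *\<^sub>R laplace F z"
proof -
  let ?D = "\<lambda>s. exp (- z * s) *\<^sub>R f s - z *\<^sub>R (exp (- z * s) *\<^sub>R F s)"
  have contF: "continuous_on {0<..} F"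
    using F by (intro continuous_at_imp_continuous_on) (auto dest: has_vector_derivative_continuous)
  have "(LBINT s=0..\<infinity>. ?D s) = 0 - 0"
  proof (rule interval_integral_FTC_integrable[where F = "\<lambda>s. exp (- z * s) *\<^sub>R F s"])
    fix s assume s: "0 < ereal s"
    then have F': "(F has_vector_derivative f s) (at s)" using F by simp
    show "((\<lambda>s. exp (- z * s) *\<^sub>R F s) has_vector_derivative ?D s) (at s)"
      by (rule has_vector_derivative_eq_rhs[OF has_vector_derivative_scaleR[OF _ F', where f = "\<lambda>s. exp (- z * s)" and f' = "- z * exp (- z * s)"]])
         (auto intro!: derivative_eq_intros)
    have "continuous_on {0<..} ?D" using cont contF by (auto intro!: continuous_intros)
    then show "isCont ?D s"
      using s by (subst (asm) continuous_on_eq_continuous_at) auto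
  next
    show "set_integrable lborel (einterval 0 \<infinity>) ?D"
      using set_integral_diff(1)[OF int set_integrable_scaleR_right[OF int', of z]]
      by (simp add: zero_ereal_def)
    show "(((\<lambda>s. exp (- z * s) *\<^sub>R F s) \<circ> real_of_ereal) \<longlongrightarrow> 0) (at_right 0)"
      using lim0 by (simp add: zero_ereal_def ereal_tendsto_simps1)
    show "(((\<lambda>s. exp (- z * s) *\<^sub>R F s) \<circ> real_of_ereal) \<longlongrightarrow> 0) (at_left \<infinity>)"
      using lim by (simp add: ereal_tendsto_simps1)
  qed auto
  then have "(LINT s:{0<..}|lborel. ?D s) = 0"
    by (simp add: interval_integral_Ioi zero_ereal_def)
  then show ?thesis
    using set_integral_diff(2)[OF int set_integrable_scaleR_right[OF int', of z]]
    by (simp add: laplace_def set_integral_scaleR_right del: scaleR_scaleR)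
qed

text \<open>Moves the parameter from the weight into the argument of \<open>f\<close>, so that the
  limit \<open>z\<close> to 0 becomes dominated convergence against the fixed weight
  \<open>exp (- s)\<close>.\<close>

lemma laplace_substitute:
  assumes "z > 0"
  shows "z *\<^sub>R laplace f z = (LINT s:{0<..}|lborel. exp (- s) *\<^sub>R f (s / z))"
proof -
  have "(LINT s:{0<..}|lborel. exp (- s) *\<^sub>R f (s / z)) =
      z *\<^sub>R (\<integral>s. indicator {0<..} (0 + z * s) *\<^sub>R (exp (- (0 + z * s)) *\<^sub>R f ((0 + z * s) / z)) \<partial>lborel)"
    unfolding set_lebesgue_integral_def
    using lborel_integral_real_affine[of z "\<lambda>s. indicator {0<..} s *\<^sub>R (exp (- s) *\<^sub>R f (s / z))" 0] assms by simp
  also have "(\<lambda>s. indicator {0<..} (0 + z * s) *\<^sub>R (exp (- (0 + z * s)) *\<^sub>R f ((0 + z * s) / z))) =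
      (\<lambda>s. indicator {0<..} s *\<^sub>R (exp (- z * s) *\<^sub>R f s))"
    using assms by (auto simp: fun_eq_iff indicator_def zero_less_mult_iff)
  finally show ?thesis by (simp add: laplace_def set_lebesgue_integral_def)
qed

text \<open>The integral is the derivative of Gamma at 1, found by differentiating Euler's integral
  in its exponent, and equals \<open>Gamma 1 * Digamma 1\<close>.\<close>

lemma exp_ln_integral:
  shows "set_integrable lborel {0<..} (\<lambda>t::real. exp (- t) * ln t)"
    and "(LINT t:{0<..}|lborel. exp (- t) * ln t) = - (euler_mascheroni::real)"
proof -
  \<comment> \<open>Real integrands are embedded into the complex numbers because differentiation
    under the integral is stated for complex values.\<close>
  let ?F = "\<lambda>y t. complex_of_real (indicator {0<..} t *\<^sub>R (exp (- t) * t powr (y - 1)))"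
  let ?F' = "\<lambda>y t. complex_of_real (indicator {0<..} t *\<^sub>R (exp (- t) * (t powr (y - 1) * ln t)))"
  let ?e = "\<lambda>(a::real) t. indicator {0<..} t *\<^sub>R (exp (- 1 * t) * t powr (a - 1))"
  \<comment> \<open>The four terms come from multiplying out
    \<open>|ln t| <= 4 * (t powr (1/4) + t powr (-1/4))\<close> and
    \<open>t powr (y - 1) <= t powr (1/2) + t powr (-1/2)\<close>; the resulting powers of
    \<open>t\<close> are -3/4, -1/4, 1/4 and 3/4, all above -1.\<close>
  let ?g = "\<lambda>t. 4 * ((?e (1/4) t + ?e (5/4) t) + (?e (3/4) t + ?e (7/4) t))"
  have int: "integrable lborel (?e a)" if "a > 0" for a :: real
    using Gamma_integral_scaled(1)[of 1 a] that by (simp add: set_integrable_def)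
  have i: "integrable lborel (?F y)" if "\<bar>y - 1\<bar> < 1/2" for y
  proof -
    have "y > 0" using that by (simp add: abs_if split: if_splits)
    from int[OF this] show ?thesis by (intro integrable_of_real) simp
  qed
  have d: "((\<lambda>y. ?F y t) has_vector_derivative ?F' y t) (at y)" for y t
    by (cases "t > 0")
       (auto intro!: has_vector_derivative_of_real derivative_eq_intros simp: powr_def
             simp flip: has_real_derivative_iff_has_vector_derivative)
  have b: "norm (?F' y t) \<le> ?g t" if y: "\<bar>y - 1\<bar> < 1/2" for y t
  proof (cases "t > 0")
    case t: True
    have "\<bar>ln t\<bar> \<le> 4 * (t powr (1/4) + t powr (-1/4))"
    proof -
      have "ln (t powr (1/4)) \<le> t powr (1/4) - 1" "ln (t powr (-1/4)) \<le> t powr (-1/4) - 1"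
        using t by (simp_all only: ln_le_minus_one powr_gt_zero)
      then have "ln t / 4 \<le> t powr (1/4) - 1" "- (ln t / 4) \<le> t powr (-1/4) - 1"
        using t by (simp_all add: ln_powr)
      moreover have "t powr (1/4) \<ge> 0" "t powr (-1/4) \<ge> 0" by simp_all
      ultimately show ?thesis unfolding distrib_left by linarith
    qed
    moreover have "t powr (y - 1) \<le> t powr (1/2) + t powr (-1/2)"
    proof (cases "t \<ge> 1")
      case True
      moreover have "y - 1 \<le> 1/2" using y by linarith
      ultimately have "t powr (y - 1) \<le> t powr (1/2)" by (intro powr_mono) auto
      then show ?thesis by (simp add: add_increasing2)
    next
      case False
      moreover have "y - 1 \<ge> -1/2" using y by linarith
      ultimately have "t powr (y - 1) \<le> t powr (-1/2)" using t by (intro powr_mono') auto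
      then show ?thesis by (simp add: add_increasing)
    qed
    ultimately have "t powr (y - 1) * \<bar>ln t\<bar> \<le>
        (t powr (1/2) + t powr (-1/2)) * (4 * (t powr (1/4) + t powr (-1/4)))"
      by (intro mult_mono) auto
    also have "\<dots> = 4 * ((t powr (-3/4) + t powr (1/4)) + (t powr (-1/4) + t powr (3/4)))"
      by (simp add: algebra_simps flip: powr_add)
    finally have "exp (- t) * (t powr (y - 1) * \<bar>ln t\<bar>) \<le>
       exp (- t) * (4 * ((t powr (-3/4) + t powr (1/4)) + (t powr (-1/4) + t powr (3/4))))"
      by (rule mult_left_mono) simp
    then show ?thesis using t by (simp add: norm_mult algebra_simps)
  qed auto
  have g: "integrable lborel ?g" by (intro integrable_mult_right Bochner_Integration.integrable_add int) auto
  note * = has_vector_derivative_integral_dominated[of "1/2" 1 lborel ?F ?F' ?g, OF _ i d b g]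
  have i1: "integrable lborel (\<lambda>t::real. indicator {0<..} t *\<^sub>R (exp (- t) * ln t))"
  proof -
    have "integrable lborel (?F' 1)" by (rule *(1)) simp_all
    also have "?F' 1 = (\<lambda>t. complex_of_real (indicator {0<..} t *\<^sub>R (exp (- t) * ln t)))"
      by (auto simp: fun_eq_iff indicator_def)
    finally have "integrable lborel (\<lambda>t. complex_of_real (indicator {0<..} t *\<^sub>R (exp (- t) * ln t)))" .
    then show ?thesis unfolding complex_of_real_integrable_eq .
  qed
  then show "set_integrable lborel {0<..} (\<lambda>t::real. exp (- t) * ln t)" by (simp add: set_integrable_def)
  have "((\<lambda>y. complex_of_real (\<integral>t. ?e y t \<partial>lborel)) has_vector_derivative
      complex_of_real (LINT t:{0<..}|lborel. exp (- t) * ln t)) (at 1)"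
  proof -
    have "(\<integral>t. ?F' 1 t \<partial>lborel) = complex_of_real (LINT t:{0<..}|lborel. exp (- t) * ln t)"
      unfolding set_lebesgue_integral_def integral_complex_of_real[symmetric]
      by (intro Bochner_Integration.integral_cong) (auto simp: indicator_def)
    moreover have "(\<integral>t. ?F y t \<partial>lborel) = complex_of_real (\<integral>t. ?e y t \<partial>lborel)" for y
      by (subst integral_complex_of_real[symmetric]) simp
    ultimately show ?thesis using *(2) by simp
  qed
  then have "((\<lambda>y. Re (complex_of_real (\<integral>t. ?e y t \<partial>lborel))) has_vector_derivative
      Re (complex_of_real (LINT t:{0<..}|lborel. exp (- t) * ln t))) (at 1)"
    by (rule bounded_linear.has_vector_derivative[OF bounded_linear_Re])
  then have D1: "((\<lambda>y. \<integral>t. ?e y t \<partial>lborel) has_real_derivative (LINT t:{0<..}|lborel. exp (- t) * ln t)) (at 1)"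
    by (simp add: has_real_derivative_iff_has_vector_derivative)
  have "(Gamma has_real_derivative (LINT t:{0<..}|lborel. exp (- t) * ln t)) (at 1)"
  proof (rule has_field_derivative_transform_within_open[OF D1, of "{0<..}"])
    show "(\<integral>t. ?e y t \<partial>lborel) = Gamma y" if "y \<in> {0<..}" for y
      using Gamma_integral_scaled(2)[of 1 y] that by (simp add: set_lebesgue_integral_def)
  qed auto
  moreover have "(Gamma has_real_derivative Gamma 1 * Digamma 1) (at (1::real))"
    by (rule has_field_derivative_Gamma) (auto elim!: nonpos_Ints_cases)
  ultimately show "(LINT t:{0<..}|lborel. exp (- t) * ln t) = - (euler_mascheroni::real)"
    using DERIV_unique by fastforce
qed

section \<open>The Hankel function as a Laplace integral\<close>

text \<open>Up to a constant factor this is \<open>sqrt (w^2 - 1)\<close> on the ray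
  \<open>w = 1 + i s\<close>, along which \<open>e^(i z w)\<close> decays in the Poisson type
  integral for \<open>H_1(z) / z\<close>. For \<open>s > 0\<close> the radicand lies in the lower
  half plane, off the cut of \<open>csqrt\<close>.\<close>

definition hankel_amplitude :: "real \<Rightarrow> complex" where
  "hankel_amplitude s = csqrt (Complex (s\<^sup>2) (- 2 * s))"

lemma hankel_amplitude_square: "(hankel_amplitude s)\<^sup>2 = Complex (s\<^sup>2) (- 2 * s)"
  by (simp add: hankel_amplitude_def)

lemma hankel_amplitude_nonzero: "s > 0 \<Longrightarrow> hankel_amplitude s \<noteq> 0"
  using hankel_amplitude_square[of s] by (auto simp: complex_eq_iff)

lemma norm_hankel_amplitude_le:
  assumes "s \<ge> 0" shows "norm (hankel_amplitude s) \<le> sqrt 2 * (s + s powr (1/2))"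
proof -
  have "norm (hankel_amplitude s) = sqrt (norm (Complex (s\<^sup>2) (- 2 * s)))"
    by (simp add: hankel_amplitude_def)
  also have "\<dots> \<le> sqrt (2 * (s + sqrt s)\<^sup>2)"
  proof (rule real_sqrt_le_mono)
    have "norm (Complex (s\<^sup>2) (- 2 * s)) \<le> \<bar>s\<^sup>2\<bar> + \<bar>- 2 * s\<bar>"
      by (metis cmod_le complex.sel)
    also have "\<dots> \<le> 2 * (s + sqrt s)\<^sup>2"
      using assms by (simp add: power2_sum)
    finally show "norm (Complex (s\<^sup>2) (- 2 * s)) \<le> 2 * (s + sqrt s)\<^sup>2" .
  qed
  also have "\<dots> = sqrt 2 * (s + s powr (1/2))"
    using assms by (simp add: real_sqrt_mult powr_half_sqrt)
  finally show ?thesis .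
qed

lemma has_vector_derivative_hankel_amplitude:
  assumes "s > 0"
  shows "(hankel_amplitude has_vector_derivative (of_real s - \<i>) / hankel_amplitude s) (at s)"
proof -
  have "((\<lambda>s. csqrt (s\<^sup>2 - 2 * \<i> * s)) has_field_derivative
      (2 * of_real s - 2 * \<i>) / (2 * csqrt ((of_real s)\<^sup>2 - 2 * \<i> * of_real s))) (at (of_real s))"
  proof -
    have nr: "(of_real s)\<^sup>2 - 2 * \<i> * of_real s \<notin> \<real>\<^sub>\<le>\<^sub>0"
      using assms by (simp add: complex_nonpos_Reals_iff power2_eq_square)
    have inner: "((\<lambda>s. s\<^sup>2 - 2 * \<i> * s) has_field_derivative (2 * of_real s - 2 * \<i>)) (at (of_real s))"
      by (auto intro!: derivative_eq_intros)
    show ?thesis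
      by (rule has_field_derivative_csqrt'[OF inner nr])
  qed
  from has_vector_derivative_real_field[OF this] 
  have "((\<lambda>s. csqrt ((of_real s)\<^sup>2 - 2 * \<i> * of_real s)) has_vector_derivative
      (2 * of_real s - 2 * \<i>) / (2 * csqrt ((of_real s)\<^sup>2 - 2 * \<i> * of_real s))) (at s)" .
  moreover have "csqrt ((of_real s)\<^sup>2 - 2 * \<i> * of_real s) = hankel_amplitude s" for s
    unfolding hankel_amplitude_def by (rule arg_cong[of _ _ csqrt]) (simp add: complex_eq_iff power2_eq_square)
  moreover have "(2 * of_real s - 2 * \<i>) / (2 * w) = (of_real s - \<i>) / w" for w
    by (metis mult_divide_mult_cancel_left_if right_diff_distrib zero_neq_numeral)
  ultimately show ?thesis
    by (simp only:)
qed

text \<open>The derivative blows up at 0, so continuity there is read off from the bound on the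
  norm; elsewhere it follows from differentiability.\<close>

lemma continuous_on_hankel_amplitude: "continuous_on {0..} hankel_amplitude"
proof -
  have "continuous (at s within {0..}) hankel_amplitude" if "s \<ge> 0" for s
  proof (cases "s = 0")
    case True
    have "((\<lambda>s. sqrt 2 * (s + s powr (1/2))) \<longlongrightarrow> sqrt 2 * (0 + 0 powr (1/2))) (at 0 within {0..})"
      by (intro tendsto_intros tendsto_powr2) (auto simp: eventually_at_filter)
    then have lim: "((\<lambda>s. sqrt 2 * (s + s powr (1/2))) \<longlongrightarrow> 0) (at 0 within {0..})"
      by simp
    have "\<forall>\<^sub>F s in at 0 within {0..}. norm (hankel_amplitude s) \<le> sqrt 2 * (s + s powr (1/2))"
      unfolding eventually_at_filter using norm_hankel_amplitude_le by (intro always_eventually) auto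
    from Lim_null_comparison[OF this lim]
    have "(hankel_amplitude \<longlongrightarrow> 0) (at 0 within {0..})" .
    moreover have "hankel_amplitude 0 = 0"
      using norm_hankel_amplitude_le[of 0] by simp
    ultimately show ?thesis
      by (simp add: True continuous_within)
  next
    case False
    then have "s > 0" using that by simp
    from has_vector_derivative_continuous[OF has_vector_derivative_hankel_amplitude[OF this]]
    show ?thesis by (rule continuous_at_imp_continuous_within)
  qed
  then show ?thesis by (simp add: continuous_on_eq_continuous_within)
qed

lemma Re_hankel_amplitude_nonneg: "Re (hankel_amplitude s) \<ge> 0"
  unfolding hankel_amplitude_def using csqrt_principal[of "Complex (s\<^sup>2) (- 2 * s)"] by linarith

text \<open>The amplitude is of order \<open>sqrt s\<close> near 0 and \<open>s\<close> at infinity.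
  The exponents stay in the unevaluated form \<open>a - 1\<close> so as to match the hypothesis of
  \<open>laplace_bound\<close>.\<close>

lemma norm_scaled_hankel_amplitude_le:
  fixes s :: real
  assumes "s > 0"
  shows "norm (hankel_amplitude s) \<le> sqrt 2 * (s powr (2 - 1) + s powr (3/2 - 1))"
    and "norm (s *\<^sub>R hankel_amplitude s) \<le> sqrt 2 * (s powr (3 - 1) + s powr (5/2 - 1))"
    and "norm (s *\<^sub>R (s *\<^sub>R hankel_amplitude s)) \<le> sqrt 2 * (s powr (4 - 1) + s powr (7/2 - 1))"
proof -
  have e: "s * s powr a = s powr (a + 1)" for a using assms by (simp add: powr_add)
  have 1: "norm (hankel_amplitude s) \<le> sqrt 2 * (s + s powr (1/2))"
    using norm_hankel_amplitude_le[of s] assms by simp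
  then show "norm (hankel_amplitude s) \<le> sqrt 2 * (s powr (2 - 1) + s powr (3/2 - 1))"
    using assms by simp
  have "s * norm (hankel_amplitude s) \<le> s * (sqrt 2 * (s + s powr (1/2)))"
    using mult_left_mono[OF 1, of s] assms by simp
  also have "\<dots> = sqrt 2 * (s * s powr 1 + s * s powr (1/2))" using assms by (simp add: distrib_left)
  also have "\<dots> = sqrt 2 * (s powr 2 + s powr (3/2))" unfolding e by simp
  finally have 2: "norm (s *\<^sub>R hankel_amplitude s) \<le> sqrt 2 * (s powr 2 + s powr (3/2))"
    using assms by simp
  then show "norm (s *\<^sub>R hankel_amplitude s) \<le> sqrt 2 * (s powr (3 - 1) + s powr (5/2 - 1))"
    by simp
  have "norm (s *\<^sub>R (s *\<^sub>R hankel_amplitude s)) \<le> s * (sqrt 2 * (s powr 2 + s powr (3/2)))"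
    using mult_left_mono[OF 2, of s] assms by simp
  also have "\<dots> = sqrt 2 * (s * s powr 2 + s * s powr (3/2))" by (simp only: distrib_left mult.left_commute)
  also have "\<dots> = sqrt 2 * (s powr (4 - 1) + s powr (7/2 - 1))" unfolding e by simp
  finally show "norm (s *\<^sub>R (s *\<^sub>R hankel_amplitude s)) \<le> sqrt 2 * (s powr (4 - 1) + s powr (7/2 - 1))" .
qed

lemma continuous_on_hankel_amplitude_pos [continuous_intros]: "continuous_on {0<..} hankel_amplitude"
  by (rule continuous_on_subset[OF continuous_on_hankel_amplitude]) auto

lemma laplace_hankel_amplitude:
  assumes z: "z > 0"
  shows "laplace_integrable hankel_amplitude z"
    and "laplace_integrable (\<lambda>s. s *\<^sub>R hankel_amplitude s) z"
    and "laplace_integrable (\<lambda>s. s *\<^sub>R (s *\<^sub>R hankel_amplitude s)) z"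
    and "norm (laplace hankel_amplitude z) \<le> sqrt 2 * (z powr (- 2) + Gamma (3/2) * z powr (- (3/2)))"
    and "norm (laplace (\<lambda>s. s *\<^sub>R hankel_amplitude s) z) \<le>
           sqrt 2 * (2 * z powr (- 3) + Gamma (5/2) * z powr (- (5/2)))"
proof -
  have G: "Gamma (2::real) = 1" "Gamma (3::real) = 2"
    using Gamma_fact[of 1, where 'a=real] Gamma_fact[of 2, where 'a=real] by simp_all
  note * = laplace_bound[of _ z _ _ "sqrt 2", OF _ z]
  show "laplace_integrable hankel_amplitude z"
    by (rule *(1)[OF _ _ _ norm_scaled_hankel_amplitude_le(1)]) (auto intro!: continuous_intros)
  show "laplace_integrable (\<lambda>s. s *\<^sub>R hankel_amplitude s) z"
    by (rule *(1)[OF _ _ _ norm_scaled_hankel_amplitude_le(2)]) (auto intro!: continuous_intros)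
  show "laplace_integrable (\<lambda>s. s *\<^sub>R (s *\<^sub>R hankel_amplitude s)) z"
    by (rule *(1)[OF _ _ _ norm_scaled_hankel_amplitude_le(3)]) (auto intro!: continuous_intros)
  show "norm (laplace hankel_amplitude z) \<le> sqrt 2 * (z powr (- 2) + Gamma (3/2) * z powr (- (3/2)))"
    using *(2)[OF _ _ _ norm_scaled_hankel_amplitude_le(1)] by (simp add: G continuous_intros)
  show "norm (laplace (\<lambda>s. s *\<^sub>R hankel_amplitude s) z) \<le>
           sqrt 2 * (2 * z powr (- 3) + Gamma (5/2) * z powr (- (5/2)))"
    using *(2)[OF _ _ _ norm_scaled_hankel_amplitude_le(2)] by (simp add: G continuous_intros)
qed

text \<open>Integration by parts for the cube of the amplitude \<open>q\<close>: \<open>?F\<close>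
  is \<open>q^3 = (s^2 - 2 i s) q\<close>, and since \<open>q q' = s - i\<close> its derivative is
  \<open>3 (s - i) q\<close>, which is \<open>?f\<close>.\<close>

lemma laplace_hankel_amplitude_recurrence:
  assumes z: "z > 0"
  shows "of_real z * (laplace (\<lambda>s. s *\<^sub>R (s *\<^sub>R hankel_amplitude s)) z
            - 2 * \<i> * laplace (\<lambda>s. s *\<^sub>R hankel_amplitude s) z)
         = 3 * laplace (\<lambda>s. s *\<^sub>R hankel_amplitude s) z - 3 * \<i> * laplace hankel_amplitude z"
proof -
  let ?q = hankel_amplitude
  let ?F = "\<lambda>s. s *\<^sub>R (s *\<^sub>R ?q s) - 2 * \<i> * (s *\<^sub>R ?q s)"
  let ?f = "\<lambda>s. 3 * (s *\<^sub>R ?q s) - 3 * \<i> * ?q s"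
  note int = laplace_hankel_amplitude(1-3)[OF z]
  have i': "laplace_integrable (\<lambda>s. c * f s) z" if "laplace_integrable f z" for c f
    using set_integrable_mult_right[of c, OF that] by simp
  have l': "laplace (\<lambda>s. c * f s) z = c * laplace f z" for c f
    unfolding laplace_def by (subst set_integral_mult_right[symmetric]) simp
  have i2: "laplace_integrable (\<lambda>s. f s - g s) z" 
    and l2: "laplace (\<lambda>s. f s - g s) z = laplace f z - laplace g z"
    if "laplace_integrable f z" "laplace_integrable g z" for f g
    using set_integral_diff[OF that] by (simp_all add: laplace_def scaleR_diff_right)
  have F: "(?F has_vector_derivative ?f s) (at s)" if s: "s > 0" for s
  proof -
    have q: "?q s \<noteq> 0" using hankel_amplitude_nonzero[OF s] .
    have sq: "?q s * ?q s = of_real s * of_real s - 2 * \<i> * of_real s"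
    proof -
      have "Complex (s\<^sup>2) (- 2 * s) = of_real s * of_real s - 2 * \<i> * of_real s"
        by (simp add: complex_eq_iff power2_eq_square)
      then show ?thesis using hankel_amplitude_square[of s] by (simp add: power2_eq_square)
    qed
    have c: "(\<lambda>s. (of_real s * of_real s - 2 * \<i> * of_real s) * ?q s) = ?F"
      by (simp add: fun_eq_iff scaleR_conv_of_real algebra_simps)
    have d: "((\<lambda>s. complex_of_real s * of_real s - 2 * \<i> * of_real s) has_vector_derivative
         (2 * of_real s - 2 * \<i>)) (at s)"
      by (auto intro!: derivative_eq_intros has_vector_derivative_real_field)
    have "(?F has_vector_derivative (of_real s * of_real s - 2 * \<i> * of_real s) * ((of_real s - \<i>) / ?q s)
        + (2 * of_real s - 2 * \<i>) * ?q s) (at s)"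
      unfolding c[symmetric]
      by (rule has_vector_derivative_mult[OF d has_vector_derivative_hankel_amplitude[OF s]])
    moreover have "(of_real s * of_real s - 2 * \<i> * of_real s) * ((of_real s - \<i>) / ?q s)
        + (2 * of_real s - 2 * \<i>) * ?q s = ?f s"
      unfolding sq[symmetric] using q by (simp add: field_simps scaleR_conv_of_real)
    ultimately show ?thesis by simp
  qed
  have bd: "norm (?F s) \<le> s * (s * (2 * (s + s powr (1/2)))) + 2 * (s * (2 * (s + s powr (1/2))))" if "s > 0" for s
  proof -
    have "norm (?q s) \<le> sqrt 2 * (s + s powr (1/2))"
      using norm_hankel_amplitude_le[of s] that by simp
    also have "\<dots> \<le> 2 * (s + s powr (1/2))"
      using that sqrt2_less_2 by (intro mult_right_mono) auto
    finally have q: "norm (?q s) \<le> 2 * (s + s powr (1/2))" .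
    have "norm (?F s) \<le> norm (s *\<^sub>R (s *\<^sub>R ?q s)) + norm (2 * \<i> * (s *\<^sub>R ?q s))"
      by (rule norm_triangle_ineq4)
    also have "\<dots> = s * (s * norm (?q s)) + 2 * (s * norm (?q s))"
      using that by (simp add: norm_mult)
    also have "\<dots> \<le> s * (s * (2 * (s + s powr (1/2)))) + 2 * (s * (2 * (s + s powr (1/2))))"
      using that q by (intro add_mono mult_left_mono) auto
    finally show ?thesis .
  qed
  let ?b = "\<lambda>s. exp (- z * s) * (s * (s * (2 * (s + s powr (1/2)))) + 2 * (s * (2 * (s + s powr (1/2)))))"
  have bd': "norm (exp (- z * s) *\<^sub>R ?F s) \<le> ?b s" if "s > 0" for s
    using mult_left_mono[OF bd[OF that], of "exp (- z * s)"] by simp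
  have "laplace ?f z = z *\<^sub>R laplace ?F z"
  proof (rule laplace_FTC[OF z F])
    show "laplace_integrable ?f z" "laplace_integrable ?F z"
      using int by (intro i2 i'; simp)+
    show "((\<lambda>s. exp (- z * s) *\<^sub>R ?F s) \<longlongrightarrow> 0) (at_right 0)"
    proof (rule Lim_null_comparison)
      show "(?b \<longlongrightarrow> 0) (at_right 0)" by real_asymp
      show "\<forall>\<^sub>F s in at_right 0. norm (exp (- z * s) *\<^sub>R ?F s) \<le> ?b s"
        by (rule eventually_mono[OF eventually_at_right_less[of 0]]) (rule bd')
    qed
    show "((\<lambda>s. exp (- z * s) *\<^sub>R ?F s) \<longlongrightarrow> 0) at_top"
    proof (rule Lim_null_comparison)
      show "(?b \<longlongrightarrow> 0) at_top" using z by real_asymp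
      show "\<forall>\<^sub>F s in at_top. norm (exp (- z * s) *\<^sub>R ?F s) \<le> ?b s"
        by (rule eventually_mono[OF eventually_gt_at_top[of 0]]) (rule bd')
    qed
  qed (auto intro!: continuous_intros)
  moreover have "laplace ?f z = 3 * laplace (\<lambda>s. s *\<^sub>R ?q s) z - 3 * \<i> * laplace ?q z"
    by (subst l2, (intro i' int)+) (simp only: l')
  moreover have "laplace ?F z = laplace (\<lambda>s. s *\<^sub>R (s *\<^sub>R ?q s)) z - 2 * \<i> * laplace (\<lambda>s. s *\<^sub>R ?q s) z"
    by (subst l2, (intro i' int)+) (simp only: l')
  ultimately show ?thesis by (simp add: scaleR_conv_of_real)
qed

text \<open>The outgoing solution of \<open>f'' + 3 f' / z + f = 0\<close>, which turns out to be \<open>\<i> \<pi> H\<^sub>1 z / (2 z)\<close>.\<close>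

definition hankel_profile :: "real \<Rightarrow> complex" where
  "hankel_profile z = cis z * laplace hankel_amplitude z"

definition hankel_profile' :: "real \<Rightarrow> complex" where
  "hankel_profile' z = cis z * (\<i> * laplace hankel_amplitude z - laplace (\<lambda>s. s *\<^sub>R hankel_amplitude s) z)"

lemma has_vector_derivative_cis: "(cis has_vector_derivative \<i> * cis z) (at z)"
proof -
  have "((\<lambda>w. exp (\<i> * w)) has_field_derivative \<i> * exp (\<i> * of_real z)) (at (of_real z))"
    by (auto intro!: derivative_eq_intros)
  from has_vector_derivative_real_field[OF this] show ?thesis
    by (simp add: cis_conv_exp[abs_def])
qed

text \<open>Each derivative of a Laplace integral multiplies its amplitude by \<open>- s\<close>.
  With the phase this gives \<open>e^(iz) (G2 - 2 i G1 - G0)\<close> for the second derivative, and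
  the recurrence turns its first two terms into \<open>- 3 / z\<close> times the first
  derivative.\<close>

lemma hankel_profile_ODE:
  assumes z: "z > 0"
  shows "(hankel_profile has_vector_derivative hankel_profile' z) (at z)"
    and "(hankel_profile' has_vector_derivative - 3 / of_real z * hankel_profile' z - hankel_profile z) (at z)"
proof -
  let ?G0 = "laplace hankel_amplitude" and ?G1 = "laplace (\<lambda>s. s *\<^sub>R hankel_amplitude s)"
  let ?G2 = "laplace (\<lambda>s. s *\<^sub>R (s *\<^sub>R hankel_amplitude s))"
  have d0: "(?G0 has_vector_derivative - ?G1 z) (at z)"
    by (rule has_vector_derivative_laplace(2)[OF laplace_hankel_amplitude(1) z])
  have d1: "(?G1 has_vector_derivative - ?G2 z) (at z)"
    by (rule has_vector_derivative_laplace(2)[OF laplace_hankel_amplitude(2) z])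
  have "((\<lambda>z. cis z * ?G0 z) has_vector_derivative cis z * (- ?G1 z) + \<i> * cis z * ?G0 z) (at z)"
    by (rule has_vector_derivative_mult[OF has_vector_derivative_cis d0])
  then show "(hankel_profile has_vector_derivative hankel_profile' z) (at z)"
    by (simp add: hankel_profile_def[abs_def] hankel_profile'_def algebra_simps)
  have "((\<lambda>z. \<i> * ?G0 z - ?G1 z) has_vector_derivative \<i> * (- ?G1 z) - - ?G2 z) (at z)"
    by (intro derivative_intros has_vector_derivative_mult_right d0 d1)
  from has_vector_derivative_mult[OF has_vector_derivative_cis this]
  have D: "(hankel_profile' has_vector_derivative cis z * (\<i> * (- ?G1 z) - - ?G2 z) + \<i> * cis z * (\<i> * ?G0 z - ?G1 z)) (at z)"
    by (simp add: hankel_profile'_def[abs_def])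
  have "of_real z * (?G2 z - 2 * \<i> * ?G1 z) = 3 * ?G1 z - 3 * \<i> * ?G0 z"
    by (rule laplace_hankel_amplitude_recurrence[OF z])
  then have "?G2 z - 2 * \<i> * ?G1 z = (3 * ?G1 z - 3 * \<i> * ?G0 z) / of_real z"
    using z by (simp add: field_simps)
  then have "cis z * (?G2 z - 2 * \<i> * ?G1 z - ?G0 z) =
     - 3 / of_real z * hankel_profile' z - hankel_profile z"
    by (simp add: hankel_profile'_def hankel_profile_def ring_distribs diff_divide_distrib mult_ac)
  moreover have "cis z * (\<i> * (- ?G1 z) - - ?G2 z) + \<i> * cis z * (\<i> * ?G0 z - ?G1 z) =
     cis z * (?G2 z - 2 * \<i> * ?G1 z - ?G0 z)"
    by (simp add: algebra_simps)
  ultimately have "cis z * (\<i> * (- ?G1 z) - - ?G2 z) + \<i> * cis z * (\<i> * ?G0 z - ?G1 z) =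
     - 3 / of_real z * hankel_profile' z - hankel_profile z"
    by simp
  with D show "(hankel_profile' has_vector_derivative - 3 / of_real z * hankel_profile' z - hankel_profile z) (at z)"
    by simp
qed

text \<open>The phase has modulus one. Subtracting \<open>\<i> * hankel_profile z\<close> cancels
  the derivative of the phase and leaves only the Laplace integral with the extra factor
  \<open>s\<close>, which is smaller by one power of \<open>z\<close>.\<close>

lemma hankel_profile_bounds:
  obtains C where "C > 0"
    "\<And>z. z > 0 \<Longrightarrow> norm (hankel_profile z) \<le> C * (z powr (- 2) + z powr (- (3/2)))"
    "\<And>z. z > 0 \<Longrightarrow> norm (hankel_profile' z - \<i> * hankel_profile z) \<le> C * (z powr (- 3) + z powr (- (5/2)))"
proof -
  define C where "C = sqrt 2 * (2 + Gamma (3/2) + Gamma (5/2))"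
  have G: "Gamma (3/2) > (0::real)" "Gamma (5/2) > (0::real)" by (simp_all add: Gamma_real_pos)
  have aux: "sqrt 2 * (a * x + b * y) \<le> C * (x + y)"
    if "a \<le> 2" "b \<le> Gamma (3/2) + Gamma (5/2)" "x \<ge> 0" "y \<ge> 0" for a b x y :: real
  proof -
    have "a * x + b * y \<le> (2 + Gamma (3/2) + Gamma (5/2)) * x + (2 + Gamma (3/2) + Gamma (5/2)) * y"
      by (intro add_mono mult_right_mono; use that G in linarith)
    then have "sqrt 2 * (a * x + b * y) \<le> sqrt 2 * ((2 + Gamma (3/2) + Gamma (5/2)) * (x + y))"
      unfolding distrib_left[of _ x y] by (rule mult_left_mono) simp
    then show ?thesis by (simp only: C_def mult.assoc)
  qed
  show ?thesis
  proof
    show "C > 0" using G by (simp add: C_def add_pos_pos)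
    fix z :: real assume z: "z > 0"
    show "norm (hankel_profile z) \<le> C * (z powr (- 2) + z powr (- (3/2)))"
      using laplace_hankel_amplitude(4)[OF z] aux[of 1 "Gamma (3/2)" "z powr (-2)" "z powr (- (3/2))"] G
      by (simp add: hankel_profile_def norm_mult)
    have "hankel_profile' z - \<i> * hankel_profile z = - (cis z * laplace (\<lambda>s. s *\<^sub>R hankel_amplitude s) z)"
      by (simp add: hankel_profile'_def hankel_profile_def algebra_simps)
    then show "norm (hankel_profile' z - \<i> * hankel_profile z) \<le> C * (z powr (- 3) + z powr (- (5/2)))"
      using laplace_hankel_amplitude(5)[OF z] aux[of 2 "Gamma (5/2)" "z powr (-3)" "z powr (- (5/2))"] G
      by (simp add: norm_mult)
  qed
qed

text \<open>With \<open>t = s - \<i>\<close> the amplitude is \<open>\<surd>(1 + t\<^sup>2)\<close>, and the following is the primitive of its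
  difference to the leading term \<open>t\<close> that vanishes at \<open>s = 0\<close>.\<close>

definition amplitude_primitive :: "real \<Rightarrow> complex" where
  "amplitude_primitive s =
     ((of_real s - \<i>) * (hankel_amplitude s - (of_real s - \<i>)) + Ln (of_real s - \<i> + hankel_amplitude s)) / 2
       - 1 / 2 + \<i> * of_real (pi / 4)"

text \<open>With \<open>t = s - i\<close> this is \<open>(1 + t^2) - t^2 = 1\<close>. It shows that
  the amplitude minus \<open>t\<close> is the reciprocal of their sum, hence of order
  \<open>1 / s\<close> at infinity.\<close>

lemma amplitude_conjugates:
  "(hankel_amplitude s - (of_real s - \<i>)) * (hankel_amplitude s + (of_real s - \<i>)) = 1"
proof -
  have "hankel_amplitude s * hankel_amplitude s = (of_real s - \<i>) * (of_real s - \<i>) + 1"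
  proof -
    have "Complex (s\<^sup>2) (- 2 * s) = (of_real s - \<i>) * (of_real s - \<i>) + 1"
      by (simp add: complex_eq_iff power2_eq_square)
    then show ?thesis using hankel_amplitude_square[of s] by (simp add: power2_eq_square)
  qed
  then show ?thesis by (simp add: algebra_simps)
qed

lemma hankel_amplitude_0 [simp]: "hankel_amplitude 0 = 0"
  using norm_hankel_amplitude_le[of 0] by simp

lemma amplitude_sum_not_nonpos:
  assumes "s \<ge> 0" shows "of_real s - \<i> + hankel_amplitude s \<notin> \<real>\<^sub>\<le>\<^sub>0"
  using assms Re_hankel_amplitude_nonneg[of s]
  by (cases "s = 0") (auto simp: complex_nonpos_Reals_iff)

text \<open>At \<open>s = 0\<close> the bracket equals \<open>1 + Ln (- i) = 1 - i pi / 2\<close>;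
  the two additive constants of the definition are chosen to cancel half of it.\<close>

lemma amplitude_primitive_0: "amplitude_primitive 0 = 0"
  by (simp add: amplitude_primitive_def complex_eq_iff)

lemma continuous_on_amplitude_primitive: "continuous_on {0..} amplitude_primitive"
  unfolding amplitude_primitive_def[abs_def]
  by (intro continuous_intros continuous_on_hankel_amplitude ballI)
     (use amplitude_sum_not_nonpos in \<open>auto simp: complex_nonpos_Reals_iff\<close>)

text \<open>The classical primitive \<open>(t q + ln (t + q)) / 2\<close> of
  \<open>q = sqrt (1 + t^2)\<close>, with \<open>t^2 / 2\<close> taken off.\<close>

lemma has_vector_derivative_amplitude_primitive:
  assumes s: "s > 0"
  shows "(amplitude_primitive has_vector_derivative hankel_amplitude s - (of_real s - \<i>)) (at s)"
proof -
  let ?q = "hankel_amplitude" and ?t = "of_real s - \<i>"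
  have q: "?q s \<noteq> 0" by (rule hankel_amplitude_nonzero[OF s])
  have nr: "?t + ?q s \<notin> \<real>\<^sub>\<le>\<^sub>0" by (rule amplitude_sum_not_nonpos) (use s in simp)
  then have nz: "?t + ?q s \<noteq> 0" by auto
  have dt: "((\<lambda>s. complex_of_real s - \<i>) has_vector_derivative 1) (at s)"
    by (auto intro!: derivative_eq_intros)
  note dq = has_vector_derivative_hankel_amplitude[OF s]
  have d1: "((\<lambda>s. (of_real s - \<i>) * (?q s - (of_real s - \<i>))) has_vector_derivative
      ?t * (?t / ?q s - 1) + 1 * (?q s - ?t)) (at s)"
    by (intro has_vector_derivative_mult has_vector_derivative_diff dt dq)
  have d2: "((\<lambda>s. Ln (of_real s - \<i> + ?q s)) has_vector_derivative (1 + ?t / ?q s) * inverse (?t + ?q s)) (at s)"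
    using field_vector_diff_chain_at[OF has_vector_derivative_add[OF dt dq] has_field_derivative_Ln[OF nr]]
    by (simp add: o_def)
  have e2: "(1 + ?t / ?q s) * inverse (?t + ?q s) = 1 / ?q s"
    using q nz by (simp add: field_simps)
  have "?t * ?t + 1 = ?q s * ?q s" using amplitude_conjugates[of s] by (simp add: algebra_simps)
  then have "1 / ?q s = ?q s - ?t * ?t / ?q s" using q by (simp add: field_simps)
  moreover have "(t * (t / q - 1) + 1 * (q - t) + 1 / q) / 2 = q - t" if "1 / q = q - t * t / q" for t q :: complex
  proof -
    have "t * (t / q - 1) + 1 * (q - t) + 1 / q = 2 * (q - t)" unfolding that by (simp add: algebra_simps)
    then show ?thesis by simp
  qed
  ultimately have e: "(?t * (?t / ?q s - 1) + 1 * (?q s - ?t) + 1 / ?q s) / 2 = ?q s - ?t"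
    by blast
  have "(amplitude_primitive has_vector_derivative
      (?t * (?t / ?q s - 1) + 1 * (?q s - ?t) + 1 / ?q s) / 2 - 0 + 0) (at s)"
    unfolding amplitude_primitive_def[abs_def] e2[symmetric]
    by (intro has_vector_derivative_add has_vector_derivative_diff has_vector_derivative_const
        has_vector_derivative_divide d1 d2)
  then show ?thesis unfolding e by simp
qed

text \<open>As \<open>q - t = 1 / (q + t)\<close> with \<open>q + t\<close> asymptotic to
  \<open>2 s\<close>, the product \<open>t (q - t)\<close> tends to 1/2 and the logarithm exceeds
  \<open>ln (1 + s)\<close> by \<open>ln 2\<close> in the limit. Comparing with
  \<open>ln (1 + s)\<close> rather than \<open>ln s\<close> keeps the remainder bounded near
  0.\<close>

lemma amplitude_primitive_limit:
  "((\<lambda>s. amplitude_primitive s - of_real (ln (1 + s) / 2)) \<longlongrightarrow>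
      of_real (ln 2 / 2 - 1 / 4) + \<i> * of_real (pi / 4)) at_top"
proof -
  let ?q = "hankel_amplitude" and ?t = "\<lambda>s. of_real s - \<i>"
  have bd: "norm (?q s - ?t s) \<le> 1 / s" if s: "s > 0" for s
  proof -
    have "s \<le> Re (?q s + ?t s)" using Re_hankel_amplitude_nonneg[of s] by simp
    also have "\<dots> \<le> norm (?q s + ?t s)" by (rule complex_Re_le_cmod)
    finally have le: "s \<le> norm (?q s + ?t s)" .
    have "norm (?q s - ?t s) * s \<le> norm (?q s - ?t s) * norm (?q s + ?t s)"
      by (intro mult_left_mono le) simp
    also have "\<dots> = 1" unfolding norm_mult[symmetric] amplitude_conjugates by simp
    finally show ?thesis using s by (simp add: field_simps)
  qed
  have l0: "((\<lambda>s. ?q s - ?t s) \<longlongrightarrow> 0) at_top"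
  proof (rule Lim_null_comparison)
    show "\<forall>\<^sub>F s in at_top. norm (?q s - ?t s) \<le> 1 / s"
      by (rule eventually_mono[OF eventually_gt_at_top[of 0]]) (rule bd)
    show "((\<lambda>s. 1 / s) \<longlongrightarrow> (0::real)) at_top" by real_asymp
  qed
  have lc: "((\<lambda>s. complex_of_real (1 / (1 + s))) \<longlongrightarrow> of_real 0) at_top"
    by (intro tendsto_of_real) real_asymp
  have lt: "((\<lambda>s. ?t s * of_real (1 / (1 + s))) \<longlongrightarrow> 1) at_top"
  proof -
    have "((\<lambda>s. of_real (s / (1 + s)) - \<i> * of_real (1 / (1 + s))) \<longlongrightarrow> of_real 1 - \<i> * of_real 0) at_top"
      by (intro tendsto_intros; real_asymp)
    moreover have "(\<lambda>s. of_real (s / (1 + s)) - \<i> * of_real (1 / (1 + s))) = (\<lambda>s. ?t s * of_real (1 / (1 + s)))"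
      by (auto simp: fun_eq_iff diff_divide_distrib)
    ultimately show ?thesis by (simp only: of_real_1 of_real_0 mult_zero_right diff_zero)
  qed
  have l1: "((\<lambda>s. (?t s + ?q s) * of_real (1 / (1 + s))) \<longlongrightarrow> 2) at_top"
  proof -
    have "((\<lambda>s. 2 * (?t s * of_real (1 / (1 + s))) + (?q s - ?t s) * of_real (1 / (1 + s))) \<longlongrightarrow>
        2 * 1 + 0 * of_real 0) at_top"
      by (intro tendsto_intros lt l0 lc)
    moreover have "2 * (t * c) + (q - t) * c = (t + q) * c" for t c q :: complex by (simp add: algebra_simps)
    ultimately show ?thesis by (simp only: of_real_0 mult_zero_right mult_1_right add_0_right)
  qed
  have l2: "((\<lambda>s. ?t s * (?q s - ?t s)) \<longlongrightarrow> 1 / 2) at_top"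
  proof -
    have "((\<lambda>s. (?t s * of_real (1 / (1 + s))) / ((?t s + ?q s) * of_real (1 / (1 + s)))) \<longlongrightarrow> 1 / 2) at_top"
      by (intro tendsto_intros lt l1) simp
    moreover have "\<forall>\<^sub>F s in at_top. (?t s * of_real (1 / (1 + s))) / ((?t s + ?q s) * of_real (1 / (1 + s))) = ?t s * (?q s - ?t s)"
    proof (rule eventually_mono[OF eventually_gt_at_top[of 0]])
      fix s :: real assume s: "s > 0"
      have "?t s + ?q s \<noteq> 0" using amplitude_sum_not_nonpos[of s] s by auto
      then have inv: "?q s - ?t s = 1 / (?t s + ?q s)"
        by (rule eq_divide_imp) (use amplitude_conjugates[of s] in \<open>simp only: add.commute\<close>)
      have "complex_of_real (1 / (1 + s)) \<noteq> 0" by (subst of_real_eq_0_iff) (use s in simp)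
      then show "(?t s * of_real (1 / (1 + s))) / ((?t s + ?q s) * of_real (1 / (1 + s))) = ?t s * (?q s - ?t s)"
        unfolding inv by (subst mult_divide_mult_cancel_right) simp_all
    qed
    ultimately show ?thesis by (rule Lim_transform_eventually)
  qed
  have l3: "((\<lambda>s. Ln (?t s + ?q s) - of_real (ln (1 + s))) \<longlongrightarrow> Ln 2) at_top"
  proof -
    have "((\<lambda>s. Ln ((?t s + ?q s) * of_real (1 / (1 + s)))) \<longlongrightarrow> Ln 2) at_top"
      by (intro tendsto_Ln l1) (auto simp: complex_nonpos_Reals_iff)
    moreover have "\<forall>\<^sub>F s in at_top. Ln ((?t s + ?q s) * of_real (1 / (1 + s))) = Ln (?t s + ?q s) - of_real (ln (1 + s))"
    proof (rule eventually_mono[OF eventually_gt_at_top[of 0]])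
      fix s :: real assume s: "s > 0"
      have "?t s + ?q s \<noteq> 0" using amplitude_sum_not_nonpos[of s] s by auto
      then have "Ln (of_real (1 / (1 + s)) * (?t s + ?q s)) = of_real (ln (1 / (1 + s))) + Ln (?t s + ?q s)"
        using s by (subst Ln_times_of_real) (simp_all add: Ln_of_real del: of_real_divide)
      then show "Ln ((?t s + ?q s) * of_real (1 / (1 + s))) = Ln (?t s + ?q s) - of_real (ln (1 + s))"
        using s by (simp add: mult.commute ln_div)
    qed
    ultimately show ?thesis by (rule Lim_transform_eventually)
  qed
  have "((\<lambda>s. (?t s * (?q s - ?t s) + (Ln (?t s + ?q s) - of_real (ln (1 + s)))) / 2 - 1 / 2 + \<i> * of_real (pi / 4)) \<longlongrightarrow>
     (1 / 2 + Ln 2) / 2 - 1 / 2 + \<i> * of_real (pi / 4)) at_top"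
    by (intro tendsto_intros l2 l3) simp_all
  moreover have "Ln 2 = complex_of_real (ln 2)" using Ln_of_real[of 2] by simp
  then have "(1 / 2 + Ln 2) / 2 - 1 / 2 + \<i> * of_real (pi / 4) = of_real (ln 2 / 2 - 1 / 4) + \<i> * complex_of_real (pi / 4)"
    by (simp add: add_divide_distrib)
  moreover have "(\<lambda>s. (?t s * (?q s - ?t s) + (Ln (?t s + ?q s) - of_real (ln (1 + s)))) / 2 - 1 / 2 + \<i> * of_real (pi / 4)) =
      (\<lambda>s. amplitude_primitive s - of_real (ln (1 + s) / 2))"
    by (simp add: fun_eq_iff amplitude_primitive_def add_divide_distrib diff_divide_distrib)
  ultimately show ?thesis by (simp only:)
qed

lemma exp_integral:
  fixes z :: real
  assumes z: "z > 0"
  shows "set_integrable lborel {0<..} (\<lambda>s. exp (- z * s))"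
    and "(LINT s:{0<..}|lborel. exp (- z * s)) = 1 / z"
proof -
  have eq: "indicator {0<..} s *\<^sub>R (exp (- z * s)) = indicator {0<..} s *\<^sub>R (exp (- z * s) * s powr (1 - 1))" for s
    by (simp add: indicator_def)
  show "set_integrable lborel {0<..} (\<lambda>s. exp (- z * s))" "(LINT s:{0<..}|lborel. exp (- z * s)) = 1 / z"
    using Gamma_integral_scaled[OF z, of 1] z
    unfolding set_integrable_def set_lebesgue_integral_def eq by (simp_all add: powr_minus divide_inverse)
qed

lemma exp_times_integral:
  fixes z :: real
  assumes z: "z > 0"
  shows "set_integrable lborel {0<..} (\<lambda>s. exp (- z * s) * s)"
    and "(LINT s:{0<..}|lborel. exp (- z * s) * s) = 1 / z\<^sup>2"
proof -
  have G: "Gamma (2::real) = 1" using Gamma_fact[of 1, where 'a=real] by simp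
  have eq: "indicator {0<..} s *\<^sub>R (exp (- z * s) * s) = indicator {0<..} s *\<^sub>R (exp (- z * s) * s powr (2 - 1))" for s
    by (simp add: indicator_def)
  show "set_integrable lborel {0<..} (\<lambda>s. exp (- z * s) * s)" "(LINT s:{0<..}|lborel. exp (- z * s) * s) = 1 / z\<^sup>2"
    using Gamma_integral_scaled[OF z, of 2] z G
    unfolding set_integrable_def set_lebesgue_integral_def eq by (simp_all add: powr_minus divide_inverse)
qed

lemma bounded_amplitude_remainder:
  obtains B where "B > 0"
    "\<And>s. s \<ge> 0 \<Longrightarrow> norm (amplitude_primitive s - of_real (ln (1 + s) / 2)) \<le> B"
proof -
  let ?L = "\<lambda>s. amplitude_primitive s - of_real (ln (1 + s) / 2)"
  let ?l = "of_real (ln 2 / 2 - 1 / 4) + \<i> * complex_of_real (pi / 4)"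
  have "\<forall>\<^sub>F s in at_top. norm (?L s - ?l) < 1"
    using tendstoD[OF amplitude_primitive_limit, of 1] by (simp add: dist_norm)
  then obtain N where N: "\<And>s. s \<ge> N \<Longrightarrow> norm (?L s - ?l) < 1"
    by (auto simp: eventually_at_top_linorder)
  have "continuous_on {0..max N 0} ?L"
    by (intro continuous_intros continuous_on_subset[OF continuous_on_amplitude_primitive]) auto
  from compact_imp_bounded[OF compact_continuous_image[OF this compact_Icc]]
  obtain B where B: "B > 0" "\<And>s. s \<in> {0..max N 0} \<Longrightarrow> norm (?L s) \<le> B"
    unfolding bounded_pos by blast
  show ?thesis
  proof
    show "B + norm ?l + 1 > 0" using B(1) norm_ge_zero[of ?l] by linarith
    fix s :: real assume s: "s \<ge> 0"
    show "norm (?L s) \<le> B + norm ?l + 1"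
    proof (cases "s \<le> max N 0")
      case True
      then show ?thesis using B(2)[of s] s norm_ge_zero[of ?l] by (metis (no_types, lifting) add_increasing2 add.assoc atLeastAtMost_iff norm_ge_zero zero_le_one add_nonneg_nonneg)
    next
      case False
      then have "norm (?L s - ?l) < 1" using N by auto
      then show ?thesis using norm_triangle_ineq2[of "?L s" ?l] B(1) by linarith
    qed
  qed
qed

text \<open>An Abelian argument: after the substitution, a bounded function with a limit at infinity
  is averaged against the probability density \<open>exp (- s)\<close> at the arguments
  \<open>s / z\<close>, and these tend to infinity. The variable \<open>x\<close> is
  \<open>1 / z\<close>.\<close>

lemma laplace_remainder_limit:
  "((\<lambda>z. z *\<^sub>R laplace (\<lambda>s. amplitude_primitive s - of_real (ln (1 + s) / 2)) z) \<longlongrightarrow>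
      of_real (ln 2 / 2 - 1 / 4) + \<i> * of_real (pi / 4)) (at_right 0)"
proof -
  let ?L = "\<lambda>s. amplitude_primitive s - of_real (ln (1 + s) / 2)"
  let ?l = "of_real (ln 2 / 2 - 1 / 4) + \<i> * complex_of_real (pi / 4)"
  let ?e = "\<lambda>s. indicator {0<..} s *\<^sub>R exp (- s) :: real"
  obtain B where B: "B > 0" "\<And>s. s \<ge> 0 \<Longrightarrow> norm (?L s) \<le> B"
    by (rule bounded_amplitude_remainder) blast
  have e: "integrable lborel ?e" "(\<integral>s. ?e s \<partial>lborel) = 1"
    using exp_integral[of 1] by (simp_all add: set_integrable_def set_lebesgue_integral_def)
  \<comment> \<open>\<open>max 0\<close> extends the remainder continuously to the whole line, which
    gives measurability; only \<open>s > 0\<close> enters the integral.\<close>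
  have contL: "continuous_on UNIV (\<lambda>s. ?L (max 0 (s * x)))" for x
    by (rule continuous_on_compose2[of "{0..}" ?L])
       (auto intro!: continuous_intros continuous_on_amplitude_primitive)
  have lim: "((\<lambda>x. \<integral>s. ?e s *\<^sub>R ?L (max 0 (s * x)) \<partial>lborel) \<longlongrightarrow> (\<integral>s. ?e s *\<^sub>R ?l \<partial>lborel)) at_top"
  proof (rule integral_dominated_convergence_at_top)
    show "integrable lborel (\<lambda>s. B * ?e s)" using e by (intro integrable_mult_right) auto
    show "(\<lambda>s. ?e s *\<^sub>R ?L (max 0 (s * x))) \<in> borel_measurable lborel" for x
      using borel_measurable_continuous_onI[OF contL[of x]] by measurable
    show "AE s in lborel. ((\<lambda>x. ?e s *\<^sub>R ?L (max 0 (s * x))) \<longlongrightarrow> ?e s *\<^sub>R ?l) at_top"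
    proof (rule AE_I2)
      fix s :: real
      show "((\<lambda>x. ?e s *\<^sub>R ?L (max 0 (s * x))) \<longlongrightarrow> ?e s *\<^sub>R ?l) at_top"
      proof (cases "s > 0")
        case True
        then have "filterlim (\<lambda>x. max 0 (s * x)) at_top at_top" by real_asymp
        from filterlim_compose[OF amplitude_primitive_limit this]
        show ?thesis by (intro tendsto_scaleR tendsto_const)
      qed auto
    qed
    show "\<forall>\<^sub>F x in at_top. AE s in lborel. norm (?e s *\<^sub>R ?L (max 0 (s * x))) \<le> B * ?e s"
    proof (intro always_eventually allI AE_I2)
      fix x s :: real
      have "?e s * norm (?L (max 0 (s * x))) \<le> ?e s * B"
        by (intro mult_left_mono B) auto
      then show "norm (?e s *\<^sub>R ?L (max 0 (s * x))) \<le> B * ?e s"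
        unfolding norm_scaleR by (simp add: mult.commute)
    qed
  qed simp
  have l: "(\<integral>s. ?e s *\<^sub>R ?l \<partial>lborel) = ?l"
    using e by (subst integral_scaleR_left) simp_all
  have ev: "\<forall>\<^sub>F x in at_top. (\<integral>s. ?e s *\<^sub>R ?L (max 0 (s * x)) \<partial>lborel) = inverse x *\<^sub>R laplace ?L (inverse x)"
  proof (rule eventually_mono[OF eventually_gt_at_top[of 0]])
    fix x :: real assume x: "x > 0"
    show "(\<integral>s. ?e s *\<^sub>R ?L (max 0 (s * x)) \<partial>lborel) = inverse x *\<^sub>R laplace ?L (inverse x)"
      unfolding laplace_substitute[OF positive_imp_inverse_positive[OF x]] set_lebesgue_integral_def
    proof (rule Bochner_Integration.integral_cong[OF refl])
      fix s :: real
      have "indicator {0<..} s *\<^sub>R ?L (max 0 (s * x)) = indicator {0<..} s *\<^sub>R ?L (s / inverse x)"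
      proof (cases "s > 0")
        case True
        then have "max 0 (s * x) = s / inverse x" using x by (simp add: divide_inverse)
        then show ?thesis by (simp only:)
      qed (simp add: indicator_def)
      then show "?e s *\<^sub>R ?L (max 0 (s * x)) = indicator {0<..} s *\<^sub>R (exp (- s) *\<^sub>R ?L (s / inverse x))"
        by (simp only: real_scaleR_def scaleR_scaleR[symmetric] scaleR_left_commute[of _ "exp (- s)"])
    qed
  qed
  show ?thesis
    unfolding filterlim_at_right_to_top by (rule Lim_transform_eventually[OF lim[unfolded l] ev])
qed

text \<open>Scaling gives \<open>ln (1 + s / z) + ln z = ln (z + s)\<close>, so the expression is
  the integral of \<open>exp (- s) * ln (z + s)\<close>; dominated convergence leads to the integral
  of \<open>exp (- s) * ln s\<close>.\<close>

lemma laplace_log_limit: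
  "((\<lambda>z. z *\<^sub>R laplace (\<lambda>s. of_real (ln (1 + s))) z + of_real (ln z)) \<longlongrightarrow> of_real (- euler_mascheroni)) (at_right 0)"
proof -
  let ?e = "\<lambda>s. indicator {0<..} s *\<^sub>R exp (- s) :: real"
  \<comment> \<open>Dominating function from \<open>ln s <= ln (1/x + s) <= s\<close> for
    \<open>x >= 1\<close>.\<close>
  let ?w = "\<lambda>s::real. \<bar>indicator {0<..} s *\<^sub>R (exp (- s) * ln s)\<bar> + indicator {0<..} s *\<^sub>R (exp (- s) * s)"
  have e: "integrable lborel ?e" "(\<integral>s. ?e s \<partial>lborel) = 1"
    using exp_integral[of 1] by (simp_all add: set_integrable_def set_lebesgue_integral_def)
  have e1: "integrable lborel (\<lambda>s::real. indicator {0<..} s *\<^sub>R (exp (- s) * s))"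
    using exp_times_integral(1)[of 1] by (simp add: set_integrable_def)
  have el: "integrable lborel (\<lambda>s::real. indicator {0<..} s *\<^sub>R (exp (- s) * ln s))"
    using exp_ln_integral(1) by (simp add: set_integrable_def)
  have w: "integrable lborel ?w" by (intro Bochner_Integration.integrable_add integrable_abs el e1)
  have bd: "norm (?e s *\<^sub>R ln (inverse x + s)) \<le> ?w s" if x: "x \<ge> 1" for x s
  proof (cases "s > 0")
    case True
    have "ln s \<le> ln (inverse x + s)" using True x by (subst ln_le_cancel_iff) (auto simp: add_pos_pos)
    moreover have "ln (inverse x + s) \<le> s"
    proof -
      have "ln (inverse x + s) \<le> ln (1 + s)"
        using True x by (subst ln_le_cancel_iff) (auto simp: add_pos_pos inverse_le_1_iff)
      also have "\<dots> \<le> s" using True by (intro ln_add_one_self_le_self) auto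
      finally show ?thesis .
    qed
    ultimately have "\<bar>ln (inverse x + s)\<bar> \<le> \<bar>ln s\<bar> + s" using True by linarith
    from mult_left_mono[OF this, of "exp (- s)"]
    show ?thesis using True by (simp add: abs_mult algebra_simps)
  qed auto
  have lim: "((\<lambda>x. \<integral>s. ?e s *\<^sub>R ln (inverse x + s) \<partial>lborel) \<longlongrightarrow> (\<integral>s. ?e s *\<^sub>R ln s \<partial>lborel)) at_top"
  proof (rule integral_dominated_convergence_at_top[OF _ _ w])
    show "AE s in lborel. ((\<lambda>x. ?e s *\<^sub>R ln (inverse x + s)) \<longlongrightarrow> ?e s *\<^sub>R ln s) at_top"
    proof (rule AE_I2)
      fix s :: real
      show "((\<lambda>x. ?e s *\<^sub>R ln (inverse x + s)) \<longlongrightarrow> ?e s *\<^sub>R ln s) at_top"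
      proof (cases "s > 0")
        case True
        then have "((\<lambda>x. ln (inverse x + s)) \<longlongrightarrow> ln s) at_top" by real_asymp
        then show ?thesis by (intro tendsto_scaleR tendsto_const)
      qed auto
    qed
    show "\<forall>\<^sub>F x in at_top. AE s in lborel. norm (?e s *\<^sub>R ln (inverse x + s)) \<le> ?w s"
      by (rule eventually_mono[OF eventually_ge_at_top[of 1]]) (rule AE_I2, rule bd)
  qed measurable
  have g: "(\<integral>s. ?e s *\<^sub>R ln s \<partial>lborel) = - euler_mascheroni"
    using exp_ln_integral(2) by (simp add: set_lebesgue_integral_def mult.assoc)
  have "\<forall>\<^sub>F x in at_top. complex_of_real (\<integral>s. ?e s *\<^sub>R ln (inverse x + s) \<partial>lborel) =
      inverse x *\<^sub>R laplace (\<lambda>s. of_real (ln (1 + s))) (inverse x) + of_real (ln (inverse x))"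
  proof (rule eventually_mono[OF eventually_ge_at_top[of 1]])
    fix x :: real assume x: "x \<ge> 1"
    have i: "integrable lborel (\<lambda>s. ?e s *\<^sub>R ln (inverse x + s))"
    proof (rule Bochner_Integration.integrable_bound[OF w])
      show "AE s in lborel. norm (?e s *\<^sub>R ln (inverse x + s)) \<le> norm (?w s)"
        by (rule AE_I2, rule order_trans[OF bd[OF x]]) (simp only: real_norm_def abs_ge_self)
    qed measurable
    have "inverse x *\<^sub>R laplace (\<lambda>s. of_real (ln (1 + s))) (inverse x) =
      complex_of_real (LINT s:{0<..}|lborel. exp (- s) * ln (1 + s * x))"
      using x by (subst laplace_substitute)
        (auto simp: divide_inverse scaleR_conv_of_real simp flip: set_integral_complex_of_real)
    also have "(LINT s:{0<..}|lborel. exp (- s) * ln (1 + s * x)) =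
        (\<integral>s. ?e s *\<^sub>R ln (inverse x + s) - ln (inverse x) * ?e s \<partial>lborel)"
      unfolding set_lebesgue_integral_def
    proof (rule Bochner_Integration.integral_cong[OF refl])
      fix s :: real
      have "ln (1 + s * x) = ln (inverse x + s) - ln (inverse x)" if "s > 0"
      proof -
        have "1 + s * x = (inverse x + s) / inverse x" using x by (simp add: field_simps)
        then show ?thesis using x that by (simp only: ln_divide_pos add_pos_pos inverse_positive_iff_positive)
      qed
      then show "indicator {0<..} s *\<^sub>R (exp (- s) * ln (1 + s * x)) = ?e s *\<^sub>R ln (inverse x + s) - ln (inverse x) * ?e s"
        by (cases "s > 0") (simp_all add: right_diff_distrib mult.commute)
    qed
    also have "\<dots> = (\<integral>s. ?e s *\<^sub>R ln (inverse x + s) \<partial>lborel) - ln (inverse x)"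
      using Bochner_Integration.integral_diff[OF i integrable_mult_right[OF e(1), of "ln (inverse x)"]] e(2)
      by simp
    finally show "complex_of_real (\<integral>s. ?e s *\<^sub>R ln (inverse x + s) \<partial>lborel) =
      inverse x *\<^sub>R laplace (\<lambda>s. of_real (ln (1 + s))) (inverse x) + of_real (ln (inverse x))" by simp
  qed
  from Lim_transform_eventually[OF tendsto_of_real[OF lim] this]
  show ?thesis unfolding filterlim_at_right_to_top g .
qed

text \<open>Split the amplitude into \<open>t = s - i\<close> and the rest. The first part gives
  \<open>1/z^2 - i/z\<close> exactly, which the phase turns into \<open>1/z^2 + 1/2 + o(1)\<close>.
  The rest is integrated by parts into \<open>z\<close> times the transform of its primitive, which
  is \<open>ln (1 + s) / 2\<close> plus a bounded remainder; these contribute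
  \<open>- ln z / 2 - euler_mascheroni / 2\<close> and
  \<open>ln 2 / 2 - 1/4 + i pi / 4\<close>.\<close>

lemma hankel_profile_limit:
  "((\<lambda>z. hankel_profile z - 1 / (of_real z)\<^sup>2 + of_real (ln z / 2)) \<longlongrightarrow>
      of_real (1 / 4 + ln 2 / 2 - euler_mascheroni / 2) + \<i> * of_real (pi / 4)) (at_right 0)"
proof -
  let ?L = "\<lambda>s. amplitude_primitive s - of_real (ln (1 + s) / 2)"
  let ?ln = "\<lambda>s. complex_of_real (ln (1 + s))"
  let ?t = "\<lambda>s. complex_of_real s - \<i>"
  let ?R = "\<lambda>s. hankel_amplitude s - ?t s"
  obtain B where B: "B > 0" "\<And>s. s \<ge> 0 \<Longrightarrow> norm (?L s) \<le> B"
    by (rule bounded_amplitude_remainder) blast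
  have ln: "norm (?ln s) \<le> s" if "s > 0" for s
    using that ln_add_one_self_le_self[of s] by simp
  have bS: "norm (amplitude_primitive s) \<le> (B + 1) * (1 + s)" if s: "s > 0" for s
  proof -
    have "norm (amplitude_primitive s) \<le> norm (?L s) + norm (of_real (1/2) * ?ln s)"
      using norm_triangle_ineq[of "?L s" "of_real (1/2) * ?ln s"] by (simp add: field_simps)
    also have "\<dots> \<le> B + s" using B(2)[of s] ln[OF s] s by (simp add: norm_mult)
    also have "\<dots> \<le> (B + 1) * (1 + s)" using B(1) s by (simp add: algebra_simps)
    finally show ?thesis .
  qed
  have pw: "s powr (1 - 1) + s powr (2 - 1) = 1 + s" if "s > 0" for s :: real using that by simp
  have cS: "continuous_on {0<..} amplitude_primitive"
    by (rule continuous_on_subset[OF continuous_on_amplitude_primitive]) auto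
  have main: "hankel_profile z - 1 / (of_real z)\<^sup>2 + of_real (ln z / 2) =
      (cis z * (1 / (of_real z)\<^sup>2 - \<i> / of_real z) - 1 / (of_real z)\<^sup>2)
       + cis z * (z *\<^sub>R laplace ?L z + (z *\<^sub>R laplace ?ln z + of_real (ln z)) / 2)
       - (cis z - 1) * of_real (ln z) / 2" if z: "z > 0" for z
  proof -
    note lb = laplace_bound(1)[OF _ z, of _ 1 2]
    have iS: "laplace_integrable amplitude_primitive z"
      by (rule lb[OF cS, of "B + 1"]) (use bS pw in auto)
    have iln: "laplace_integrable (\<lambda>s. ?ln s / 2) z"
    proof (rule lb[of _ 1])
      show "continuous_on {0<..} (\<lambda>s. ?ln s / 2)" by (auto intro!: continuous_intros)
      show "norm (?ln s / 2) \<le> 1 * (s powr (1 - 1) + s powr (2 - 1))" if "s > 0" for s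
        using ln[OF that] that unfolding pw[OF that] by (simp add: norm_divide)
    qed auto
    have it: "laplace_integrable ?t z"
    proof (rule lb[of _ 1])
      show "norm (?t s) \<le> 1 * (s powr (1 - 1) + s powr (2 - 1))" if "s > 0" for s
        using norm_triangle_ineq4[of "of_real s" \<i>] that unfolding pw[OF that] by simp
    qed (auto intro!: continuous_intros)
    have iR: "laplace_integrable ?R z"
      using set_integral_diff(1)[OF laplace_hankel_amplitude(1)[OF z] it] by (simp add: scaleR_diff_right)
    have "laplace ?R z = z *\<^sub>R laplace amplitude_primitive z"
    proof (rule laplace_FTC[OF z has_vector_derivative_amplitude_primitive _ iR iS])
      show "continuous_on {0<..} ?R" by (auto intro!: continuous_intros)
      have "(amplitude_primitive \<longlongrightarrow> amplitude_primitive 0) (at 0 within {0..})"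
        using continuous_on_amplitude_primitive by (auto simp: continuous_on_def)
      then have "(amplitude_primitive \<longlongrightarrow> 0) (at_right 0)"
        unfolding amplitude_primitive_0 by (rule tendsto_within_subset) auto
      moreover have "((\<lambda>s. exp (- z * s)) \<longlongrightarrow> exp (- z * 0)) (at_right 0)" by (intro tendsto_intros)
      ultimately show "((\<lambda>s. exp (- z * s) *\<^sub>R amplitude_primitive s) \<longlongrightarrow> 0) (at_right 0)"
        using tendsto_scaleR by fastforce
      show "((\<lambda>s. exp (- z * s) *\<^sub>R amplitude_primitive s) \<longlongrightarrow> 0) at_top"
      proof (rule Lim_null_comparison)
        show "((\<lambda>s. exp (- z * s) * ((B + 1) * (1 + s))) \<longlongrightarrow> 0) at_top" using z by real_asymp
        show "\<forall>\<^sub>F s in at_top. norm (exp (- z * s) *\<^sub>R amplitude_primitive s) \<le> exp (- z * s) * ((B + 1) * (1 + s))"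
          by (rule eventually_mono[OF eventually_gt_at_top[of 0]]) (use bS in \<open>auto intro!: mult_left_mono\<close>)
      qed
    qed
    moreover have "laplace ?R z = laplace hankel_amplitude z - laplace ?t z"
      using set_integral_diff(2)[OF laplace_hankel_amplitude(1)[OF z] it] by (simp add: scaleR_diff_right laplace_def)
    moreover have "laplace ?t z = 1 / (of_real z)\<^sup>2 - \<i> / of_real z"
    proof -
      note i0 = exp_integral[OF z] and i1 = exp_times_integral[OF z]
      have ci: "set_integrable lborel {0<..} (\<lambda>s. complex_of_real (f s))" if "set_integrable lborel {0<..} f" for f
        using that by (simp add: complex_of_real_integrable_eq[symmetric] set_integrable_def scaleR_conv_of_real)
      have "laplace ?t z = (LINT s:{0<..}|lborel. complex_of_real (exp (- z * s) * s) - \<i> * complex_of_real (exp (- z * s)))"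
        unfolding laplace_def by (simp add: scaleR_conv_of_real algebra_simps)
      also have "\<dots> = of_real (1 / z\<^sup>2) - \<i> * of_real (1 / z)"
        by (subst set_integral_diff(2)[OF ci[OF i1(1)] set_integrable_mult_right[OF ci[OF i0(1)]]])
           (simp only: set_integral_mult_right set_integral_complex_of_real i1(2) i0(2))
      finally show ?thesis by simp
    qed
    moreover have "laplace amplitude_primitive z = laplace ?L z + laplace ?ln z / 2"
    proof -
      have "laplace ?L z = laplace amplitude_primitive z - laplace (\<lambda>s. ?ln s / 2) z"
        using set_integral_diff(2)[OF iS iln] by (simp add: scaleR_diff_right laplace_def)
      moreover have "laplace (\<lambda>s. ?ln s / 2) z = laplace ?ln z / 2"
      proof -
        have "(\<lambda>s. exp (- z * s) *\<^sub>R (?ln s / 2)) = (\<lambda>s. exp (- z * s) *\<^sub>R ?ln s / 2)"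
          by (simp add: scaleR_conv_of_real)
        then show ?thesis by (simp only: laplace_def set_integral_divide_zero)
      qed
      ultimately show ?thesis by simp
    qed
    ultimately have "laplace hankel_amplitude z =
        1 / (of_real z)\<^sup>2 - \<i> / of_real z + (z *\<^sub>R laplace ?L z + z *\<^sub>R laplace ?ln z / 2)"
      by (simp add: scaleR_add_right scaleR_conv_of_real algebra_simps)
    moreover have "c * (t + (l + l1 / 2)) - a + lz / 2 = (c * t - a) + c * (l + (l1 + lz) / 2) - (c - 1) * lz / 2"
      for c t l l1 a lz :: complex by (simp add: algebra_simps add_divide_distrib diff_divide_distrib)
    ultimately show ?thesis
      unfolding hankel_profile_def by (simp only: of_real_divide of_real_numeral)
  qed
  have l1: "((\<lambda>z. cis z * (1 / (of_real z)\<^sup>2 - \<i> / of_real z) - 1 / (of_real z)\<^sup>2) \<longlongrightarrow> Complex (1/2) 0) (at_right 0)"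
  proof -
    have "((\<lambda>z. Complex (cos z / z\<^sup>2 + sin z / z - 1 / z\<^sup>2) (sin z / z\<^sup>2 - cos z / z)) \<longlongrightarrow> Complex (1/2) 0) (at_right 0)"
      by (intro tendsto_Complex; real_asymp)
    moreover have "(\<lambda>z. Complex (cos z / z\<^sup>2 + sin z / z - 1 / z\<^sup>2) (sin z / z\<^sup>2 - cos z / z)) =
      (\<lambda>z. cis z * (1 / (of_real z)\<^sup>2 - \<i> / of_real z) - 1 / (of_real z)\<^sup>2)"
    proof (rule ext)
      fix z :: real
      have a: "1 / (complex_of_real z)\<^sup>2 = Complex (1 / z\<^sup>2) 0" "\<i> / complex_of_real z = Complex 0 (1 / z)"
        by (simp_all add: complex_eq_iff power2_eq_square Re_divide Im_divide) 
      show "Complex (cos z / z\<^sup>2 + sin z / z - 1 / z\<^sup>2) (sin z / z\<^sup>2 - cos z / z) =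
         cis z * (1 / (of_real z)\<^sup>2 - \<i> / of_real z) - 1 / (of_real z)\<^sup>2"
        unfolding a by (simp add: complex_eq_iff)
    qed
    ultimately show ?thesis by (simp only:)
  qed
  have l2: "((\<lambda>z. (cis z - 1) * of_real (ln z)) \<longlongrightarrow> Complex 0 0) (at_right 0)"
  proof -
    have "((\<lambda>z. Complex ((cos z - 1) * ln z) (sin z * ln z)) \<longlongrightarrow> Complex 0 0) (at_right 0)"
      by (intro tendsto_Complex; real_asymp)
    moreover have "(\<lambda>z. Complex ((cos z - 1) * ln z) (sin z * ln z)) = (\<lambda>z. (cis z - 1) * of_real (ln z))"
      by (auto simp: fun_eq_iff complex_eq_iff)
    ultimately show ?thesis by (simp only:)
  qed
  have l3: "(cis \<longlongrightarrow> cis 0) (at_right 0)"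
    using has_vector_derivative_continuous[OF has_vector_derivative_cis[of 0]]
    by (auto simp: continuous_within intro: tendsto_within_subset)
  have lim: "((\<lambda>z. (cis z * (1 / (of_real z)\<^sup>2 - \<i> / of_real z) - 1 / (of_real z)\<^sup>2)
       + cis z * (z *\<^sub>R laplace ?L z + (z *\<^sub>R laplace ?ln z + of_real (ln z)) / 2)
       - (cis z - 1) * of_real (ln z) / 2) \<longlongrightarrow> Complex (1/2) 0 + cis 0 * (of_real (ln 2 / 2 - 1 / 4) + \<i> * of_real (pi / 4)
         + of_real (- euler_mascheroni) / 2) - Complex 0 0 / 2) (at_right 0)"
    by (intro tendsto_intros l1 l2 l3 laplace_remainder_limit laplace_log_limit) simp_all
  have eq: "Complex (1/2) 0 + cis 0 * (of_real (ln 2 / 2 - 1 / 4) + \<i> * of_real (pi / 4)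
         + of_real (- euler_mascheroni) / 2) - Complex 0 0 / 2 =
       of_real (1 / 4 + ln 2 / 2 - euler_mascheroni / 2) + \<i> * of_real (pi / 4)"
    by (simp add: complex_eq_iff)
  show ?thesis
    by (rule Lim_transform_eventually[OF lim[unfolded eq]])
       (rule eventually_mono[OF eventually_at_right_less], rule main[symmetric])
qed

section \<open>Uniqueness at the singular point of the profile equation\<close>

text \<open>The term \<open>3 D' / z\<close> acts as friction, so the energy \<open>E\<close> is
  nonincreasing and vanishes once it tends to 0 at 0. What has to be excluded is a singular
  \<open>D'\<close>. The flux \<open>v = z^3 D'\<close> satisfies \<open>v' = - z^3 D\<close>, so it
  has a limit at 0, and a nonzero limit would force \<open>D\<close> to grow like
  \<open>1 / z^2\<close>.\<close>

lemma bessel_type_ODE_unique: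
  fixes D D' :: "real \<Rightarrow> complex"
  assumes D: "\<And>z. z > 0 \<Longrightarrow> (D has_vector_derivative D' z) (at z)"
    and D': "\<And>z. z > 0 \<Longrightarrow> (D' has_vector_derivative - 3 / of_real z * D' z - D z) (at z)"
    and lim: "(D \<longlongrightarrow> 0) (at_right 0)" and z: "z > 0"
  shows "D z = 0"
proof -
  define v where "v z = of_real (z ^ 3) * D' z" for z
  have v: "(v has_vector_derivative - (of_real (z ^ 3) * D z)) (at z)" if z: "z > 0" for z
  proof -
    have c: "((\<lambda>z. complex_of_real (z ^ 3)) has_vector_derivative of_real (3 * z\<^sup>2)) (at z)"
      by (intro has_vector_derivative_of_real) (auto intro!: derivative_eq_intros simp flip: has_real_derivative_iff_has_vector_derivative)
    have "of_real (z ^ 3) * (- 3 / of_real z * D' z - D z) + of_real (3 * z\<^sup>2) * D' z = - (of_real (z ^ 3) * D z)"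
      using z by (simp add: field_simps power3_eq_cube power2_eq_square)
    with has_vector_derivative_mult[OF c D'[OF z]] show ?thesis
      by (simp add: v_def[abs_def])
  qed
  have ev: "\<exists>d>0. \<forall>z. 0 < z \<and> z < d \<longrightarrow> norm (D z) < e" if "e > 0" for e
    using tendstoD[OF lim that] by (auto simp: eventually_at_right_field)
  have vdiff: "norm (v a - v b) \<le> d ^ 3 * e * \<bar>a - b\<bar>"
    if "0 < a" "a \<le> d" "0 < b" "b \<le> d" "\<And>z. 0 < z \<Longrightarrow> z \<le> d \<Longrightarrow> norm (D z) \<le> e" for a b d e
  proof (rule vector_derivative_bound[of "{0<..d}"])
    fix x assume x: "x \<in> {0<..d}"
    show "(v has_vector_derivative - (of_real (x ^ 3) * D x)) (at x within {0<..d})"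
      by (rule has_vector_derivative_at_within[OF v]) (use x in simp)
    have "x ^ 3 * norm (D x) \<le> d ^ 3 * e"
      using x that(5)[of x] by (intro mult_mono power_mono) auto
    then show "norm (- (of_real (x ^ 3) * D x)) \<le> d ^ 3 * e"
      using x by (simp add: norm_mult norm_power)
  qed (use that in auto)
  obtain d0 where d0: "d0 > 0" "\<And>z. 0 < z \<Longrightarrow> z < d0 \<Longrightarrow> norm (D z) < 1"
    using ev[of 1] by auto
  text \<open>Were \<open>v\<close> not small near \<open>0\<close>, then \<open>D' = v / z\<^sup>3\<close> would make \<open>D\<close> vary by a large amount
    between \<open>b / 2\<close> and \<open>b\<close>.\<close>
  have vsmall: "norm (v b) \<le> 2 / 3 * (2 * b\<^sup>2 + 4 * b ^ 4)" if b: "0 < b" "b < d0" for b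
  proof -
    \<comment> \<open>The added term cancels the variation of \<open>D\<close> that a constant flux
      \<open>v b\<close> would cause, so the derivative of \<open>g\<close> is
      \<open>(v x - v b) / x^3\<close>, where the numerator is controlled by
      \<open>vdiff\<close>.\<close>
    define g where "g x = D x + of_real (1 / (2 * x\<^sup>2)) * v b" for x
    have "norm (g b - g (b / 2)) \<le> 8 * b * \<bar>b - b / 2\<bar>"
    proof (rule vector_derivative_bound[of "{b / 2..b}"])
      fix x assume x: "x \<in> {b / 2..b}"
      then have x0: "x > 0" using b by auto
      have "((\<lambda>x. complex_of_real (1 / (2 * x\<^sup>2))) has_vector_derivative of_real (- 1 / x ^ 3)) (at x)"
        using x0
        by (intro has_vector_derivative_of_real)
           (auto intro!: derivative_eq_intros simp: power2_eq_square power3_eq_cube field_simps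
                 simp flip: has_real_derivative_iff_has_vector_derivative)
      from has_vector_derivative_add[OF D[OF x0] has_vector_derivative_mult_left[OF this, of "v b"]]
      have "(g has_vector_derivative D' x + of_real (- 1 / x ^ 3) * v b) (at x)"
        by (simp add: g_def[abs_def])
      then show "(g has_vector_derivative D' x + of_real (- 1 / x ^ 3) * v b) (at x within {b / 2..b})"
        by (rule has_vector_derivative_at_within)
      have "D' x + of_real (- 1 / x ^ 3) * v b = of_real (1 / x ^ 3) * (v x - v b)"
        using x0 by (simp add: v_def field_simps)
      then have "norm (D' x + of_real (- 1 / x ^ 3) * v b) = norm (v x - v b) / x ^ 3"
        using x0 by (simp add: norm_mult norm_divide norm_power)
      also have "\<dots> \<le> (b ^ 3 * 1 * \<bar>x - b\<bar>) / (b / 2) ^ 3"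
      proof (rule frac_le)
        show "norm (v x - v b) \<le> b ^ 3 * 1 * \<bar>x - b\<bar>"
          using x0 x b d0(2) by (intro vdiff) (auto intro: less_imp_le)
        show "(b / 2) ^ 3 \<le> x ^ 3" using x b by (intro power_mono) auto
      qed (use b in auto)
      also have "\<dots> = 8 * \<bar>x - b\<bar>" using b by (simp add: power3_eq_cube)
      also have "\<dots> \<le> 8 * b" using x b by auto
      finally show "norm (D' x + of_real (- 1 / x ^ 3) * v b) \<le> 8 * b" .
    qed (use b in auto)
    then have 1: "norm (g b - g (b / 2)) \<le> 4 * b\<^sup>2" using b by (simp add: power2_eq_square)
    have 2: "norm (D (b / 2)) < 1" "norm (D b) < 1" using b by (auto intro!: d0(2))
    have "of_real (3 / (2 * b\<^sup>2)) * v b = D b - D (b / 2) - (g b - g (b / 2))"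
    proof -
      have "1 / (2 * (b / 2)\<^sup>2) - 1 / (2 * b\<^sup>2) = 3 / (2 * b\<^sup>2)" using b by (simp add: field_simps power2_eq_square)
      then have "complex_of_real (3 / (2 * b\<^sup>2)) = of_real (1 / (2 * (b / 2)\<^sup>2)) - of_real (1 / (2 * b\<^sup>2))"
        by (metis of_real_diff)
      then show ?thesis by (simp only: g_def) (simp only: left_diff_distrib, simp)
    qed
    then have "norm (of_real (3 / (2 * b\<^sup>2)) * v b) = norm (D b - D (b / 2) - (g b - g (b / 2)))"
      by (rule arg_cong)
    then have "norm (of_real (3 / (2 * b\<^sup>2)) * v b) \<le> 2 + 4 * b\<^sup>2"
      using 1 2 norm_triangle_ineq4[of "D b - D (b / 2)" "g b - g (b / 2)"] norm_triangle_ineq4[of "D b" "D (b / 2)"]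
      by linarith
    then have "3 / (2 * b\<^sup>2) * norm (v b) \<le> 2 + 4 * b\<^sup>2"
      using b by (simp add: norm_mult norm_divide norm_power)
    from mult_left_mono[OF this, of "2 / 3 * b\<^sup>2"] show ?thesis
      using b by (simp add: field_simps power4_eq_xxxx power2_eq_square)
  qed
  \<comment> \<open>Letting \<open>b\<close> tend to 0 in the estimate for \<open>v a - v b\<close>
    gives \<open>|v a| <= a^4 * e\<close>; division by \<open>a^3\<close> returns to
    \<open>D'\<close>.\<close>
  have D'b: "norm (D' a) \<le> a * e"
    if a: "0 < a" "a < d" and e: "\<And>z. 0 < z \<Longrightarrow> z < d \<Longrightarrow> norm (D z) < e" for a d e
  proof -
    have "norm (v a) \<le> a ^ 4 * e"
    proof (rule tendsto_le[of "at_right 0"])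
      show "((\<lambda>b. norm (v a)) \<longlongrightarrow> norm (v a)) (at_right 0)" by simp
      show "((\<lambda>b. a ^ 3 * e * \<bar>a - b\<bar> + 2 / 3 * (2 * b\<^sup>2 + 4 * b ^ 4)) \<longlongrightarrow> a ^ 4 * e) (at_right 0)"
        using a by (auto intro!: tendsto_eq_intros simp: power4_eq_xxxx power3_eq_cube)
      show "\<forall>\<^sub>F b in at_right 0. norm (v a) \<le> a ^ 3 * e * \<bar>a - b\<bar> + 2 / 3 * (2 * b\<^sup>2 + 4 * b ^ 4)"
        unfolding eventually_at_right_field
      proof (intro exI[of _ "min a d0"] conjI allI impI)
        fix b assume b: "0 < b" "b < min a d0"
        have "norm (v a - v b) \<le> a ^ 3 * e * \<bar>a - b\<bar>"
          using a b e by (intro vdiff) (auto intro: less_imp_le)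
        moreover have "norm (v b) \<le> 2 / 3 * (2 * b\<^sup>2 + 4 * b ^ 4)" using vsmall[of b] b by simp
        ultimately show "norm (v a) \<le> a ^ 3 * e * \<bar>a - b\<bar> + 2 / 3 * (2 * b\<^sup>2 + 4 * b ^ 4)"
          using norm_triangle_ineq2[of "v a" "v b"] by linarith
      qed (use a d0 in auto)
    qed simp
    then have "a ^ 3 * norm (D' a) \<le> a ^ 3 * (a * e)"
      using a by (simp add: v_def norm_mult norm_power power4_eq_xxxx power3_eq_cube mult.assoc)
    then show ?thesis using a by (simp add: mult_le_cancel_left)
  qed
  have D'lim: "(D' \<longlongrightarrow> 0) (at_right 0)"
  proof (rule tendstoI)
    fix e :: real assume e: "e > 0"
    obtain d where d: "d > 0" "\<And>z. 0 < z \<Longrightarrow> z < d \<Longrightarrow> norm (D z) < e" using ev[OF e] by blast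
    have "norm (D' a) < e" if "0 < a" "a < min d 1" for a
    proof -
      have "norm (D' a) \<le> a * e" using D'b[of a d e] d that by auto
      also have "\<dots> < 1 * e" using that e by (intro mult_strict_right_mono) auto
      finally show ?thesis by simp
    qed
    then show "\<forall>\<^sub>F x in at_right 0. dist (D' x) 0 < e"
      unfolding eventually_at_right_field using d(1) by (intro exI[of _ "min d 1"]) auto
  qed
  define E where "E z = (norm (D' z))\<^sup>2 + (norm (D z))\<^sup>2" for z
  have Ed: "(E has_real_derivative - 6 / z * (norm (D' z))\<^sup>2) (at z)" if z: "z > 0" for z
  proof -
    let ?D'' = "- 3 / of_real z * D' z - D z"
    have r: "?D'' = of_real (- 3 / z) * D' z - D z" by simp
    have rD'': "Re ?D'' = - 3 / z * Re (D' z) - Re (D z)" "Im ?D'' = - 3 / z * Im (D' z) - Im (D z)"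
      unfolding r by (simp_all del: of_real_minus of_real_divide)
    have R: "((\<lambda>z. Re (f z)) has_real_derivative Re f') (at z)" "((\<lambda>z. Im (f z)) has_real_derivative Im f') (at z)"
      if "(f has_vector_derivative f') (at z)" for f f'
      using bounded_linear.has_vector_derivative[OF bounded_linear_Re that]
        bounded_linear.has_vector_derivative[OF bounded_linear_Im that]
      by (simp_all add: has_real_derivative_iff_has_vector_derivative)
    have "((\<lambda>z. (Re (D' z))\<^sup>2 + (Im (D' z))\<^sup>2 + ((Re (D z))\<^sup>2 + (Im (D z))\<^sup>2)) has_real_derivative
        - 6 / z * ((Re (D' z))\<^sup>2 + (Im (D' z))\<^sup>2)) (at z)"
      by (rule derivative_eq_intros R[OF D[OF z]] R[OF D'[OF z]] refl)+
         (use z in \<open>simp only: rD'', simp add: field_simps power2_eq_square\<close>)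
    then show ?thesis by (simp add: E_def[abs_def] cmod_power2)
  qed
  have "E z \<le> 0"
  proof (rule tendsto_le[of "at_right 0"])
    show "(E \<longlongrightarrow> 0) (at_right 0)"
      unfolding E_def[abs_def] by (auto intro!: tendsto_eq_intros D'lim lim)
    show "((\<lambda>b. E z) \<longlongrightarrow> E z) (at_right 0)" by simp
    show "\<forall>\<^sub>F b in at_right 0. E z \<le> E b"
      unfolding eventually_at_right_field
    proof (intro exI[of _ z] conjI allI impI)
      fix b assume b: "0 < b" "b < z"
      show "E z \<le> E b"
      proof (rule DERIV_nonpos_imp_nonincreasing[of b z E])
        fix x assume "b \<le> x" "x \<le> z"
        then show "\<exists>y. (E has_real_derivative y) (at x) \<and> y \<le> 0"
          using b by (intro exI[of _ "- 6 / x * (norm (D' x))\<^sup>2"] conjI Ed) auto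
      qed (use b in auto)
    qed (rule z)
  qed simp
  then show ?thesis by (simp add: E_def sum_power2_le_zero_iff)
qed

section \<open>Comparison with the power series\<close>

text \<open>\<open>J_1(z)\<close> is \<open>z / 2\<close> times the power series with these
  coefficients at \<open>z^2 / 4\<close>. The \<open>neumann_coeff\<close> below give the part of
  \<open>Y_1\<close> that is neither logarithmic nor polar, up to the factor
  \<open>- z / (2 pi)\<close>.\<close>

definition bessel_coeff :: "nat \<Rightarrow> real" where
  "bessel_coeff m = (- 1) ^ m / (fact m * fact (Suc m))"

definition neumann_coeff :: "nat \<Rightarrow> real" where
  "neumann_coeff m = (Digamma (real m + 1) + Digamma (real m + 2)) * bessel_coeff m"

abbreviation powser :: "(nat \<Rightarrow> real) \<Rightarrow> real \<Rightarrow> real" where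
  "powser c x \<equiv> (\<Sum>n. c n * x ^ n)"

lemma bessel_coeff_Suc: "real (m + 1) * real (m + 2) * bessel_coeff (Suc m) = - bessel_coeff m"
proof -
  have "bessel_coeff (Suc m) = - ((- 1) ^ m) / ((real (m + 1) * fact m) * (real (m + 2) * fact (Suc m)))"
    by (simp add: bessel_coeff_def algebra_simps)
  also have "\<dots> = - bessel_coeff m / (real (m + 1) * real (m + 2))"
    by (simp add: bessel_coeff_def)
  finally show ?thesis by (simp del: of_nat_add)
qed

text \<open>Passing to the next index adds \<open>1/(m+1) + 1/(m+2)\<close> to the sum of the two
  digamma values; times \<open>(m+1)(m+2)\<close> this is the \<open>2 m + 3\<close> of the
  inhomogeneous term.\<close>

lemma neumann_coeff_Suc:
  "real (m + 1) * real (m + 2) * neumann_coeff (Suc m) =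
     - neumann_coeff m + (2 * real m + 3) * bessel_coeff (Suc m)"
proof -
  have D1: "Digamma (real m + 2) = Digamma (real m + 1) + 1 / (real m + 1)"
    using Digamma_plus1[of "real m + 1"] by (simp add: add.assoc)
  have D2: "Digamma (real m + 3) = Digamma (real m + 2) + 1 / (real m + 2)"
    using Digamma_plus1[of "real m + 2"] by (simp add: add.assoc)
  have "neumann_coeff (Suc m) = (Digamma (real m + 2) + Digamma (real m + 3)) * bessel_coeff (Suc m)"
    by (simp add: neumann_coeff_def add_ac)
  then have "neumann_coeff (Suc m) = (Digamma (real m + 1) + Digamma (real m + 2) + (1 / (real m + 1) + 1 / (real m + 2))) * bessel_coeff (Suc m)"
    by (simp only: D1 D2) (simp add: algebra_simps)
  then have "real (m + 1) * real (m + 2) * neumann_coeff (Suc m) =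
     (Digamma (real m + 1) + Digamma (real m + 2)) * (real (m + 1) * real (m + 2) * bessel_coeff (Suc m)) +
     (real (m + 1) * real (m + 2) * (1 / (real m + 1) + 1 / (real m + 2))) * bessel_coeff (Suc m)"
    by (simp only:) (simp only: algebra_simps)
  moreover have "real (m + 1) * real (m + 2) * (1 / (real m + 1) + 1 / (real m + 2)) = 2 * real m + 3"
  proof -
    have "a * b * (1 / a + 1 / b) = b + a" if "a \<noteq> 0" "b \<noteq> 0" for a b :: real
      using that by (simp add: distrib_left)
    from this[of "real m + 1" "real m + 2"] show ?thesis by (simp add: add.commute)
  qed
  ultimately show ?thesis
    by (simp only: bessel_coeff_Suc) (simp add: neumann_coeff_def)
qed

lemma summable_bounded_by_exp:
  fixes c :: "nat \<Rightarrow> real"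
  assumes "\<And>m. \<bar>c m\<bar> \<le> K / fact m"
  shows "summable (\<lambda>m. c m * x ^ m)"
proof (rule summable_comparison_test')
  show "summable (\<lambda>m. K * (inverse (fact m) * \<bar>x\<bar> ^ m))" by (intro summable_mult summable_exp)
  show "norm (c m * x ^ m) \<le> K * (inverse (fact m) * \<bar>x\<bar> ^ m)" for m
    using mult_right_mono[OF assms[of m], of "\<bar>x\<bar> ^ m"] by (simp add: abs_mult power_abs divide_inverse mult.assoc)
qed

lemma summable_bessel_coeff: "summable (\<lambda>m. bessel_coeff m * x ^ m)"
proof (rule summable_bounded_by_exp)
  show "\<bar>bessel_coeff m\<bar> \<le> 1 / fact m" for m
  proof -
    have "(fact m :: real) * 1 \<le> fact m * fact (Suc m)"
      by (intro mult_left_mono fact_ge_1) auto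
    then show ?thesis
      by (simp add: bessel_coeff_def abs_mult power_abs frac_le del: fact_Suc)
  qed
qed

text \<open>Digamma at \<open>n + 1\<close> is a harmonic number minus Euler's constant, so at most
  linear in \<open>n\<close>; the linear factor is absorbed by one of the two factorials.\<close>

lemma summable_neumann_coeff: "summable (\<lambda>m. neumann_coeff m * x ^ m)"
proof (rule summable_bounded_by_exp)
  fix m
  have harm: "harm n \<le> real n" for n
  proof (induction n)
    case (Suc n)
    have "inverse (real (Suc n)) \<le> 1" by (simp add: field_simps)
    then show ?case using Suc by (simp add: harm_Suc)
  qed (simp add: harm_def)
  have harm0: "harm n \<ge> (0::real)" for n by (rule harm_nonneg)
  have e: "(0::real) < euler_mascheroni" "euler_mascheroni < (1::real)"
    using euler_mascheroni_pos euler_mascheroni_less_13_over_22 by auto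
  have d: "\<bar>Digamma (real n + 1)\<bar> \<le> real n + 1" for n
    using Digamma_of_nat[of n, where 'a=real] harm[of n] harm0[of n] e by (simp add: add.commute)
  have "\<bar>Digamma (real m + 1) + Digamma (real m + 2)\<bar> \<le> 3 * real (Suc m)"
    using d[of m] d[of "Suc m"] by (simp add: add_ac)
  then have "\<bar>neumann_coeff m\<bar> \<le> 3 * real (Suc m) * (1 / (fact m * fact (Suc m)))"
    unfolding neumann_coeff_def abs_mult
    by (intro mult_mono) (auto simp: bessel_coeff_def abs_mult power_abs)
  also have "\<dots> = 3 / (fact m * fact m)" by (simp del: of_nat_Suc)
  also have "\<dots> \<le> 3 / fact m"
    using mult_left_mono[OF fact_ge_1[of m, where 'a=real], of "fact m"] by (intro divide_left_mono) auto
  finally show "\<bar>neumann_coeff m\<bar> \<le> 3 / fact m" .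
qed

text \<open>For \<open>f(z) = y(z^2 / 4)\<close> the operator \<open>f'' + 3 f' / z\<close> becomes
  \<open>x y'' + 2 y'\<close> in the variable \<open>x = z^2 / 4\<close>. This is its action on
  coefficients.\<close>

lemma powser_second_order:
  assumes c: "\<And>x. summable (\<lambda>n. c n * x ^ n)"
  shows "summable (\<lambda>n. real (n + 1) * real (n + 2) * c (Suc n) * x ^ n)"
    and "x * powser (diffs (diffs c)) x + 2 * powser (diffs c) x =
         (\<Sum>n. real (n + 1) * real (n + 2) * c (Suc n) * x ^ n)"
proof -
  have s1: "summable (\<lambda>n. diffs c n * x ^ n)" for x
    by (rule termdiff_converges_all) (rule c)
  have s2: "summable (\<lambda>n. diffs (diffs c) n * x ^ n)"
    by (rule termdiff_converges_all) (rule s1)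
  let ?f = "\<lambda>n. real n * real (n + 1) * c (Suc n) * x ^ n"
  have fS: "?f (Suc n) = x * (diffs (diffs c) n * x ^ n)" for n
    by (simp add: diffs_def algebra_simps)
  have sf: "summable ?f"
    by (subst summable_Suc_iff[symmetric]) (use s2 fS in \<open>simp only: summable_mult\<close>)
  have eq: "?f n + 2 * (diffs c n * x ^ n) = real (n + 1) * real (n + 2) * c (Suc n) * x ^ n" for n
    by (simp add: diffs_def algebra_simps)
  show "summable (\<lambda>n. real (n + 1) * real (n + 2) * c (Suc n) * x ^ n)"
    using summable_add[OF sf summable_mult[OF s1, of 2 x]] unfolding eq .
  have "x * powser (diffs (diffs c)) x = (\<Sum>n. ?f (Suc n))"
    by (simp only: fS suminf_mult[OF s2])
  \<comment> \<open>The term of index 0 of \<open>?f\<close> is zero because of its factor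
    \<open>real n\<close>.\<close>
  also have "\<dots> = suminf ?f" using suminf_split_head[OF sf] by simp
  finally have "x * powser (diffs (diffs c)) x + 2 * powser (diffs c) x =
      suminf ?f + (\<Sum>n. 2 * (diffs c n * x ^ n))"
    by (simp only: suminf_mult[OF s1])
  also have "\<dots> = (\<Sum>n. real (n + 1) * real (n + 2) * c (Suc n) * x ^ n)"
    by (subst suminf_add[OF sf summable_mult[OF s1]]) (simp only: eq)
  finally show "x * powser (diffs (diffs c)) x + 2 * powser (diffs c) x =
         (\<Sum>n. real (n + 1) * real (n + 2) * c (Suc n) * x ^ n)" .
qed

lemma powser_bessel_ODE:
  "x * powser (diffs (diffs bessel_coeff)) x + 2 * powser (diffs bessel_coeff) x = - powser bessel_coeff x"
  unfolding powser_second_order(2)[OF summable_bessel_coeff] bessel_coeff_Suc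
  using suminf_minus[OF summable_bessel_coeff[of x]] by simp

lemma powser_bessel_split:
  "powser bessel_coeff x = 1 + x * (\<Sum>n. bessel_coeff (Suc n) * x ^ n)"
  using powser_split_head(1)[OF summable_bessel_coeff[of x]] by (simp add: bessel_coeff_def mult.commute)

text \<open>The right-hand side is what balances the terms produced when the operator hits the
  factor \<open>ln (z / 2)\<close> and the pole \<open>1 / z^2\<close> in the series for the
  profile. Multiplication by \<open>x\<close> turns the shifted Bessel series into the series itself
  minus 1.\<close>

lemma powser_neumann_ODE:
  "x * (x * powser (diffs (diffs neumann_coeff)) x + 2 * powser (diffs neumann_coeff) x + powser neumann_coeff x) =
    2 * x * powser (diffs bessel_coeff) x + powser bessel_coeff x - 1"
proof -
  have s1: "summable (\<lambda>n. diffs bessel_coeff n * x ^ n)" for x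
    by (rule termdiff_converges_all) (rule summable_bessel_coeff)
  have s2: "summable (\<lambda>n. bessel_coeff (Suc n) * x ^ n)"
    using powser_split_head(3)[OF summable_bessel_coeff[of x]] .
  have eq: "real (n + 1) * real (n + 2) * neumann_coeff (Suc n) * x ^ n + neumann_coeff n * x ^ n =
      2 * (diffs bessel_coeff n * x ^ n) + bessel_coeff (Suc n) * x ^ n" for n
    unfolding neumann_coeff_Suc by (simp add: diffs_def algebra_simps)
  have "x * powser (diffs (diffs neumann_coeff)) x + 2 * powser (diffs neumann_coeff) x + powser neumann_coeff x =
     (\<Sum>n. 2 * (diffs bessel_coeff n * x ^ n) + bessel_coeff (Suc n) * x ^ n)"
    unfolding powser_second_order(2)[OF summable_neumann_coeff]
    by (subst suminf_add[OF powser_second_order(1)[OF summable_neumann_coeff] summable_neumann_coeff]) (simp only: eq)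
  also have "\<dots> = 2 * powser (diffs bessel_coeff) x + (\<Sum>n. bessel_coeff (Suc n) * x ^ n)"
    using suminf_add[OF summable_mult[OF s1, of 2 x] s2] suminf_mult[OF s1, of 2 x] by simp
  finally show ?thesis
    by (simp add: powser_bessel_split[of x] algebra_simps)
qed

lemma powser_derivs:
  assumes c: "\<And>x. summable (\<lambda>n. c n * x ^ n)"
  shows "((\<lambda>z. powser c (z\<^sup>2 / 4)) has_real_derivative powser (diffs c) (z\<^sup>2 / 4) * (z / 2)) (at z)"
    and "((\<lambda>z. powser (diffs c) (z\<^sup>2 / 4)) has_real_derivative powser (diffs (diffs c)) (z\<^sup>2 / 4) * (z / 2)) (at z)"
proof -
  have s1: "summable (\<lambda>n. diffs c n * x ^ n)" for x
    by (rule termdiff_converges_all) (rule c)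
  have d: "((\<lambda>z::real. z\<^sup>2 / 4) has_real_derivative z / 2) (at z)" by (auto intro!: derivative_eq_intros)
  show "((\<lambda>z. powser c (z\<^sup>2 / 4)) has_real_derivative powser (diffs c) (z\<^sup>2 / 4) * (z / 2)) (at z)"
    by (rule DERIV_chain2[OF termdiffs_strong_converges_everywhere[OF c] d])
  show "((\<lambda>z. powser (diffs c) (z\<^sup>2 / 4)) has_real_derivative powser (diffs (diffs c)) (z\<^sup>2 / 4) * (z / 2)) (at z)"
    by (rule DERIV_chain2[OF termdiffs_strong_converges_everywhere[OF s1] d])
qed

text \<open>The factor \<open>i\<close> exchanges the roles of the two series: \<open>J_1\<close>
  moves to the imaginary part and \<open>- Y_1\<close> to the real part.\<close>

lemma hankel1_series:
  assumes z: "z > 0"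
  shows "\<i> * of_real (pi / 2) * hankel1 1 z / of_real z =
    Complex (1 / z\<^sup>2 - ln (z / 2) / 2 * powser bessel_coeff (z\<^sup>2 / 4) + powser neumann_coeff (z\<^sup>2 / 4) / 4)
      (pi / 4 * powser bessel_coeff (z\<^sup>2 / 4))"
proof -
  have t: "(- (z\<^sup>2 / 4)) ^ m / (fact m * fact (1 + m)) = bessel_coeff m * (z\<^sup>2 / 4) ^ m" for m
    by (simp add: bessel_coeff_def power_minus[of "z\<^sup>2 / 4"])
  then have J: "bessel_J 1 z = z / 2 * powser bessel_coeff (z\<^sup>2 / 4)"
    by (simp add: bessel_J_def)
  have t': "(Digamma (real m + 1) + Digamma (real (1 + m) + 1)) * (- (z\<^sup>2 / 4)) ^ m / (fact m * fact (1 + m)) =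
      neumann_coeff m * (z\<^sup>2 / 4) ^ m" for m
  proof -
    have "(Digamma (real m + 1) + Digamma (real (1 + m) + 1)) * (- (z\<^sup>2 / 4)) ^ m / (fact m * fact (1 + m)) =
       (Digamma (real m + 1) + Digamma (real m + 2)) * ((- (z\<^sup>2 / 4)) ^ m / (fact m * fact (1 + m)))"
      by (simp add: add_ac)
    then show ?thesis unfolding t by (simp add: neumann_coeff_def)
  qed
  have Y: "bessel_Y 1 z = - (2 / (pi * z)) + 2 / pi * ln (z / 2) * (z / 2 * powser bessel_coeff (z\<^sup>2 / 4))
      - z / 2 / pi * powser neumann_coeff (z\<^sup>2 / 4)"
    unfolding bessel_Y_def t' J by simp
  have "\<i> * of_real (pi / 2) * hankel1 1 z / of_real z =
      Complex (- (pi / (2 * z) * bessel_Y 1 z)) (pi / (2 * z) * bessel_J 1 z)"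
    using z by (simp add: hankel1_def complex_eq_iff)
  also have "pi / (2 * z) * bessel_J 1 z = pi / 4 * powser bessel_coeff (z\<^sup>2 / 4)"
    unfolding J using z by simp
  also have "- (pi / (2 * z) * bessel_Y 1 z) =
      1 / z\<^sup>2 - ln (z / 2) / 2 * powser bessel_coeff (z\<^sup>2 / 4) + powser neumann_coeff (z\<^sup>2 / 4) / 4"
  proof -
    have "- (pi / (2 * z) * (- (2 / (pi * z)) + 2 / pi * l * (z / 2 * e) - z / 2 / pi * d)) =
       1 / z\<^sup>2 - l / 2 * e + d / 4" for l e d :: real
      using z by (simp add: field_simps power2_eq_square)
    then show ?thesis unfolding Y by blast
  qed
  finally show ?thesis .
qed

text \<open>\<open>A\<close> and \<open>B\<close> are the real and imaginary part of the series
  side. At 0 the two power series take the values 1 and \<open>1 - 2 * euler_mascheroni\<close>, so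
  after removal of \<open>1/z^2 - ln z / 2\<close> the constant term is
  \<open>ln 2 / 2 + (1 - 2 * euler_mascheroni) / 4 + i pi / 4\<close>, as for the Laplace
  integral.\<close>

lemma hankel1_eq_profile:
  assumes "z > 0"
  shows "\<i> * of_real (pi / 2) * hankel1 1 z / of_real z = hankel_profile z"
proof -
  let ?E = "\<lambda>z. powser bessel_coeff (z\<^sup>2 / 4)" and ?E1 = "\<lambda>z. powser (diffs bessel_coeff) (z\<^sup>2 / 4)"
    and ?E2 = "\<lambda>z. powser (diffs (diffs bessel_coeff)) (z\<^sup>2 / 4)"
  let ?D = "\<lambda>z. powser neumann_coeff (z\<^sup>2 / 4)" and ?D1 = "\<lambda>z. powser (diffs neumann_coeff) (z\<^sup>2 / 4)"
    and ?D2 = "\<lambda>z. powser (diffs (diffs neumann_coeff)) (z\<^sup>2 / 4)"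
  note dE = powser_derivs[OF summable_bessel_coeff] and dD = powser_derivs[OF summable_neumann_coeff]
  define A where "A z = 1 / z\<^sup>2 - ln (z / 2) / 2 * ?E z + ?D z / 4" for z
  define A' where "A' z = - 2 / z ^ 3 - (?E z / z + ln (z / 2) * (?E1 z * (z / 2))) / 2 + ?D1 z * (z / 2) / 4" for z
  define B where "B z = pi / 4 * ?E z" for z
  define B' where "B' z = pi / 4 * (?E1 z * (z / 2))" for z
  have E2: "?E2 z = (- ?E z - 2 * ?E1 z) * 4 / z\<^sup>2" if "z > 0" for z
    using powser_bessel_ODE[of "z\<^sup>2 / 4"] that by (simp add: field_simps)
  have D2: "?D2 z = ((8 * ?E1 z + 16 * (?E z - 1) / z\<^sup>2) - 8 * ?D1 z - 4 * ?D z) / z\<^sup>2" if "z > 0" for z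
  proof -
    have *: "d2 = ((8 * e1 + 16 * (e - 1) / z\<^sup>2) - 8 * d1 - 4 * d) / z\<^sup>2"
      if "z\<^sup>2 / 4 * (z\<^sup>2 / 4 * d2 + 2 * d1 + d) = 2 * (z\<^sup>2 / 4) * e1 + e - 1" for d2 d1 d e e1
      using that \<open>z > 0\<close> by (simp add: field_simps)
    show ?thesis by (rule *[OF powser_neumann_ODE])
  qed
  have A1: "(A has_real_derivative A' z) (at z)" if z: "z > 0" for z
    unfolding A_def A'_def
    by (rule derivative_eq_intros dE dD refl | use z in \<open>simp; fail\<close>)+
       (use z in \<open>simp add: field_simps power2_eq_square power3_eq_cube\<close>)
  have A2: "(A' has_real_derivative - 3 / z * A' z - A z) (at z)" if z: "z > 0" for z
    unfolding A'_def A_def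
    apply (rule derivative_eq_intros dE dD refl | use z in \<open>simp; fail\<close>)+
    unfolding E2[OF z] D2[OF z]
    using z by (simp add: field_simps power2_eq_square power3_eq_cube)
  have B1: "(B has_real_derivative B' z) (at z)" for z
    unfolding B_def B'_def by (rule derivative_eq_intros dE refl | simp)+
  have B2: "(B' has_real_derivative - 3 / z * B' z - B z) (at z)" if z: "z > 0" for z
    unfolding B'_def B_def
    apply (rule derivative_eq_intros dE dD refl | use z in \<open>simp; fail\<close>)+
    unfolding E2[OF z]
    using z by (simp add: field_simps power2_eq_square power3_eq_cube)
  have cd: "((\<lambda>z. Complex (f z) (g z)) has_vector_derivative Complex f' g') (at z)"
    if "(f has_real_derivative f') (at z)" "(g has_real_derivative g') (at z)" for f g f' g' z
    using that
    unfolding Complex_eq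
    by (intro has_vector_derivative_add has_vector_derivative_mult_right has_vector_derivative_of_real)
       (simp_all add: has_real_derivative_iff_has_vector_derivative)
  have "hankel_profile z - Complex (A z) (B z) = 0"
  proof (rule bessel_type_ODE_unique[where D' = "\<lambda>z. hankel_profile' z - Complex (A' z) (B' z)", OF _ _ _ assms])
    fix z :: real assume z: "z > 0"
    show "((\<lambda>z. hankel_profile z - Complex (A z) (B z)) has_vector_derivative hankel_profile' z - Complex (A' z) (B' z)) (at z)"
      by (intro has_vector_derivative_diff hankel_profile_ODE(1)[OF z] cd A1[OF z] B1)
    have "((\<lambda>z. hankel_profile' z - Complex (A' z) (B' z)) has_vector_derivative
        (- 3 / of_real z * hankel_profile' z - hankel_profile z) -
        Complex (- 3 / z * A' z - A z) (- 3 / z * B' z - B z)) (at z)"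
      by (intro has_vector_derivative_diff hankel_profile_ODE(2)[OF z] cd A2[OF z] B2[OF z])
    moreover have "Complex (- 3 / z * A' z - A z) (- 3 / z * B' z - B z) =
        - 3 / of_real z * Complex (A' z) (B' z) - Complex (A z) (B z)"
      by (simp add: complex_eq_iff)
    moreover have lin: "(- 3 / w * h' - h) - (- 3 / w * c' - c) = - 3 / w * (h' - c') - (h - c)" for w h h' c c' :: complex
      by (simp add: algebra_simps diff_divide_distrib)
    ultimately show "((\<lambda>z. hankel_profile' z - Complex (A' z) (B' z)) has_vector_derivative
      - 3 / of_real z * (hankel_profile' z - Complex (A' z) (B' z)) - (hankel_profile z - Complex (A z) (B z))) (at z)"
      by (simp only: lin)
  next
    \<comment> \<open>\<open>?E z = 1 + z^2 / 4 * ?G z\<close>: this separates the pure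
      \<open>ln z\<close> from a logarithmic term that tends to 0.\<close>
    let ?G = "\<lambda>z. \<Sum>n. bessel_coeff (Suc n) * (z\<^sup>2 / 4) ^ n"
    have contE: "(?E \<longlongrightarrow> ?E 0) (at_right 0)" and contD: "(?D \<longlongrightarrow> ?D 0) (at_right 0)"
      using DERIV_isCont[OF dE(1)[of 0]] DERIV_isCont[OF dD(1)[of 0]]
      by (auto simp: isCont_def intro: tendsto_within_subset)
    have sG: "summable (\<lambda>n. bessel_coeff (Suc n) * x ^ n)" for x
      using powser_split_head(3)[OF summable_bessel_coeff[of x]] .
    have contG: "(?G \<longlongrightarrow> ?G 0) (at_right 0)"
      using DERIV_isCont[OF powser_derivs(1)[OF sG, of 0]]
      by (auto simp: isCont_def intro: tendsto_within_subset)
    have E0: "?E 0 = 1" using powser_bessel_split[of 0] by simp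
    have D0: "?D 0 = 1 - 2 * euler_mascheroni"
    proof -
      have "?D 0 = neumann_coeff 0" using powser_zero[of neumann_coeff] by simp
      also have "\<dots> = 1 - 2 * euler_mascheroni"
        using Digamma_numeral[of "Num.Bit0 Num.One", where 'a = real]
        by (simp add: neumann_coeff_def bessel_coeff_def harm_def)
      finally show ?thesis .
    qed
    have l0: "((\<lambda>z. z\<^sup>2 / 4 * ln z) \<longlongrightarrow> (0::real)) (at_right 0)" by real_asymp
    have lim: "((\<lambda>z. Complex (ln 2 / 2 * ?E z - (z\<^sup>2 / 4 * ln z) / 2 * ?G z + ?D z / 4) (pi / 4 * ?E z)) \<longlongrightarrow>
        Complex (ln 2 / 2 * 1 - 0 / 2 * ?G 0 + (1 - 2 * euler_mascheroni) / 4) (pi / 4 * 1)) (at_right 0)"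
      by (intro tendsto_intros l0 contG contE[unfolded E0] contD[unfolded D0]) simp_all
    from tendsto_diff[OF hankel_profile_limit lim]
    have "((\<lambda>z. (hankel_profile z - 1 / (of_real z)\<^sup>2 + of_real (ln z / 2)) -
         Complex (ln 2 / 2 * ?E z - (z\<^sup>2 / 4 * ln z) / 2 * ?G z + ?D z / 4) (pi / 4 * ?E z)) \<longlongrightarrow> 0) (at_right 0)"
      by (rule tendsto_eq_rhs) (simp add: complex_eq_iff field_simps del: of_real_euler_mascheroni)
    moreover have "\<forall>\<^sub>F z in at_right 0. (hankel_profile z - 1 / (of_real z)\<^sup>2 + of_real (ln z / 2)) -
         Complex (ln 2 / 2 * ?E z - (z\<^sup>2 / 4 * ln z) / 2 * ?G z + ?D z / 4) (pi / 4 * ?E z) =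
         hankel_profile z - Complex (A z) (B z)"
    proof (rule eventually_mono[OF eventually_at_right_less])
      fix z :: real assume z: "0 < z"
      have "A z = 1 / z\<^sup>2 - ln z / 2 + (ln 2 / 2 * ?E z - (z\<^sup>2 / 4 * ln z) / 2 * ?G z + ?D z / 4)"
        unfolding A_def powser_bessel_split[of "z\<^sup>2 / 4"] using z by (simp add: ln_div algebra_simps diff_divide_distrib)
      moreover have "1 / (complex_of_real z)\<^sup>2 = Complex (1 / z\<^sup>2) 0"
        by (simp add: complex_eq_iff power2_eq_square Re_divide Im_divide)
      ultimately show "(hankel_profile z - 1 / (of_real z)\<^sup>2 + of_real (ln z / 2)) -
         Complex (ln 2 / 2 * ?E z - (z\<^sup>2 / 4 * ln z) / 2 * ?G z + ?D z / 4) (pi / 4 * ?E z) =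
         hankel_profile z - Complex (A z) (B z)"
        by (simp add: B_def complex_eq_iff)
    qed
    ultimately show "((\<lambda>z. hankel_profile z - Complex (A z) (B z)) \<longlongrightarrow> 0) (at_right 0)"
      by (rule Lim_transform_eventually)
  qed
  then show ?thesis
    unfolding hankel1_series[OF assms] by (simp add: A_def B_def)
qed

section \<open>The Poisson kernel of the half plane\<close>

definition rho :: "real \<Rightarrow> real \<Rightarrow> real" where
  "rho a y = sqrt (a\<^sup>2 + y\<^sup>2)"

lemma rho_pos: "a \<noteq> 0 \<Longrightarrow> rho a y > 0"
  by (simp add: rho_def add_pos_nonneg)

lemma rho_square: "rho a y * rho a y = a * a + y * y"
  using real_sqrt_mult_self[of "a\<^sup>2 + y\<^sup>2"] by (simp add: rho_def power2_eq_square)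

lemma rho_ge: "\<bar>a\<bar> \<le> rho a y" "\<bar>y\<bar> \<le> rho a y" "rho a y \<ge> 0"
  by (simp_all add: rho_def real_le_rsqrt)

lemma rho_minus [simp]: "rho a (- y) = rho a y"
  by (simp add: rho_def)

lemma rho_triangle: "\<bar>rho a y - rho b z\<bar> \<le> \<bar>a - b\<bar> + \<bar>y - z\<bar>"
proof -
  have n: "rho a y = norm (Complex a y)" for a y by (simp add: rho_def cmod_def)
  have "\<bar>rho a y - rho b z\<bar> \<le> norm (Complex a y - Complex b z)"
    unfolding n by (rule norm_triangle_ineq3)
  also have "\<dots> \<le> \<bar>a - b\<bar> + \<bar>y - z\<bar>" using cmod_le[of "Complex a y - Complex b z"] by simp
  finally show ?thesis .
qed

lemma rho_curve_deriv:
  assumes "(f has_real_derivative f') (at r)" "(g has_real_derivative g') (at r)" "f r > 0"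
  shows "((\<lambda>r. rho (f r) (g r)) has_real_derivative (f r * f' + g r * g') / rho (f r) (g r)) (at r)"
proof -
  have pos: "(f r)\<^sup>2 + (g r)\<^sup>2 > 0" using assms(3) by (simp add: add_pos_nonneg)
  have d: "((\<lambda>r. (f r)\<^sup>2 + (g r)\<^sup>2) has_real_derivative 2 * (f r * f' + g r * g')) (at r)"
    by (auto intro!: derivative_eq_intros assms(1,2))
  have e: "inverse y / 2 * (2 * z) = z / y" for y z :: real by (simp add: field_simps)
  show ?thesis
    unfolding rho_def
    by (rule DERIV_cong[OF DERIV_chain2[where f = sqrt and g = "\<lambda>r. (f r)\<^sup>2 + (g r)\<^sup>2", OF DERIV_real_sqrt[OF pos] d]])
       (rule e)
qed

lemma rho_derivs:
  assumes "a > 0"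
  shows "((\<lambda>a. rho a y) has_real_derivative a / rho a y) (at a)"
    and "((\<lambda>y. rho a y) has_real_derivative y / rho a y) (at y)"
  using rho_curve_deriv[OF DERIV_ident DERIV_const assms, of y] rho_curve_deriv[OF DERIV_const DERIV_ident assms, of y]
  by simp_all

lemma rho_polar: "c\<^sup>2 + s\<^sup>2 = 1 \<Longrightarrow> r \<ge> 0 \<Longrightarrow> rho (r * c) (r * s) = r"
proof -
  assume cs: "c\<^sup>2 + s\<^sup>2 = 1" and r: "r \<ge> 0"
  have "(r * c)\<^sup>2 + (r * s)\<^sup>2 = r\<^sup>2 * (c\<^sup>2 + s\<^sup>2)" by (simp add: power_mult_distrib distrib_left)
  then show ?thesis unfolding rho_def cs using r by simp
qed

lemma continuous_on_rho [continuous_intros]: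
  "continuous_on S f \<Longrightarrow> continuous_on S g \<Longrightarrow> continuous_on S (\<lambda>x. rho (f x) (g x))"
  unfolding rho_def by (intro continuous_intros)

text \<open>Compares direction cosines: moving a point by a distance \<open>d\<close> changes its
  direction by at most a multiple of \<open>d\<close> over its distance. It is used to compare the
  directions in which the wave and the kernel propagate far away.\<close>

lemma rho_direction_bound:
  assumes "a > 0" "b > 0"
  shows "\<bar>a / rho a y - b / rho b z\<bar> \<le> 2 * (\<bar>a - b\<bar> + \<bar>y - z\<bar>) / rho b z"
proof -
  have p: "rho a y > 0" "rho b z > 0" using assms by (auto intro: rho_pos)
  have "\<bar>a / rho a y - b / rho b z\<bar> * rho b z = \<bar>a / rho a y * (rho b z - rho a y) + (a - b)\<bar>"
  proof -
    have "(a / rho a y - b / rho b z) * rho b z = a / rho a y * (rho b z - rho a y) + (a - b)"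
      using p by (simp add: field_simps)
    then show ?thesis using p by (metis abs_mult abs_of_pos)
  qed
  also have "\<dots> \<le> \<bar>a / rho a y\<bar> * \<bar>rho b z - rho a y\<bar> + \<bar>a - b\<bar>"
    by (metis abs_mult abs_triangle_ineq)
  also have "\<dots> \<le> 1 * (\<bar>a - b\<bar> + \<bar>y - z\<bar>) + (\<bar>a - b\<bar> + \<bar>y - z\<bar>)"
    using p assms rho_ge(1)[of a y] rho_triangle[of b z a y]
    by (intro add_mono mult_mono) (auto simp: abs_minus_commute)
  finally show ?thesis using p by (simp add: field_simps)
qed

lemma integrable_decay:
  assumes q: "q > 1"
  shows "integrable lborel (\<lambda>t::real. (1 + \<bar>t\<bar>) powr (- q))"
proof -
  have hi: "((\<lambda>x. x powr (- q)) has_integral - (1 powr (- q + 1)) / (- q + 1)) {1..}"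
    using q by (intro has_integral_powr_to_inf) auto
  have ai: "(\<lambda>x. x powr (- q)) absolutely_integrable_on {1..}"
    by (rule nonnegative_absolutely_integrable_1) (use hi in auto)
  have meas: "(\<lambda>x. indicator {1..} x *\<^sub>R (x powr (- q))) \<in> borel_measurable lborel" by measurable
  have int: "integrable lborel (\<lambda>x::real. indicator {1..} x *\<^sub>R (x powr (- q)))"
    using ai integrable_completion[OF meas] by (simp add: set_integrable_def)
  have i1: "integrable lborel (\<lambda>x::real. indicator {0..} x *\<^sub>R ((1 + x) powr (- q)))"
    using lborel_integrable_real_affine[OF int, of 1 1]
    by (rule Bochner_Integration.integrable_cong[THEN iffD1, rotated 2]) (auto simp: indicator_def)
  have i2: "integrable lborel (\<lambda>x::real. indicator {0..} (- x) *\<^sub>R ((1 - x) powr (- q)))"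
    using lborel_integrable_real_affine[OF i1, of "- 1" 0] by simp
  show ?thesis
  proof (rule Bochner_Integration.integrable_bound[OF Bochner_Integration.integrable_add[OF i1 i2]])
    show "AE x in lborel. norm ((1 + \<bar>x\<bar>) powr (- q)) \<le>
      norm (indicator {0..} x *\<^sub>R ((1 + x) powr (- q)) + indicator {0..} (- x) *\<^sub>R ((1 - x) powr (- q)))"
      by (intro AE_I2) (auto simp: indicator_def)
  qed measurable
qed

lemma integrable_rho_powr:
  assumes "r > 1"
  shows "integrable lborel (\<lambda>v. rho 1 v powr (- r))"
proof (rule Bochner_Integration.integrable_bound[OF integrable_mult_right[OF integrable_decay[OF assms], of "2 powr r"]])
  show "AE v in lborel. norm (rho 1 v powr (- r)) \<le> norm (2 powr r * (1 + \<bar>v\<bar>) powr (- r))"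
  proof (rule AE_I2)
    fix v :: real
    have "(1 + \<bar>v\<bar>) / 2 \<le> rho 1 v" using rho_ge(1)[of 1 v] rho_ge(2)[of v 1] by simp
    then have "rho 1 v powr (- r) \<le> ((1 + \<bar>v\<bar>) / 2) powr (- r)"
      using assms by (intro powr_mono2') auto
    also have "\<dots> = 2 powr r * (1 + \<bar>v\<bar>) powr (- r)"
      by (simp add: powr_divide powr_minus field_simps)
    finally show "norm (rho 1 v powr (- r)) \<le> norm (2 powr r * (1 + \<bar>v\<bar>) powr (- r))" by simp
  qed
qed (simp add: rho_def)

lemma rho_scale: "e > 0 \<Longrightarrow> rho e (e * v) = e * rho 1 v"
  using real_sqrt_mult[of "e\<^sup>2" "1 + v\<^sup>2"] by (simp add: rho_def power_mult_distrib distrib_left)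

text \<open>Homogeneity of the distance under the scaling \<open>t = x - a * v\<close>; each
  integral reduces to the one at height 1.\<close>

lemma rho_powr_integral:
  assumes r: "r > 1" and a: "a > 0"
  shows "integrable lborel (\<lambda>t. rho a (x - t) powr (- r))"
    and "(\<integral>t. rho a (x - t) powr (- r) \<partial>lborel) = a powr (1 - r) * (\<integral>v. rho 1 v powr (- r) \<partial>lborel)"
proof -
  have e: "rho a (x - t) powr (- r) = a powr (- r) * rho 1 (x / a + (- 1 / a) * t) powr (- r)" for t
  proof -
    have "rho a (a * (x / a + (- 1 / a) * t)) = a * rho 1 (x / a + (- 1 / a) * t)"
      by (rule rho_scale[OF a])
    moreover have "a * (x / a + (- 1 / a) * t) = x - t" using a by (simp add: field_simps)
    ultimately show ?thesis using a by (simp add: powr_mult rho_ge)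
  qed
  note i = integrable_rho_powr[OF r]
  show "integrable lborel (\<lambda>t. rho a (x - t) powr (- r))"
    unfolding e using lborel_integrable_real_affine[OF i, of "- 1 / a" "x / a"] a
    by (intro integrable_mult_right) auto
  have "(\<integral>v. rho 1 v powr (- r) \<partial>lborel) = (1 / a) * (\<integral>t. rho 1 (x / a + (- 1 / a) * t) powr (- r) \<partial>lborel)"
    using lborel_integral_real_affine[of "- 1 / a" "\<lambda>v. rho 1 v powr (- r)" "x / a"] a by simp
  then have "(\<integral>t. rho 1 (x / a + (- 1 / a) * t) powr (- r) \<partial>lborel) = a * (\<integral>v. rho 1 v powr (- r) \<partial>lborel)"
    using a by simp
  moreover have "a powr (- r) * a = a powr (1 - r)" using a by (simp add: powr_diff powr_minus divide_inverse)
  ultimately show "(\<integral>t. rho a (x - t) powr (- r) \<partial>lborel) = a powr (1 - r) * (\<integral>v. rho 1 v powr (- r) \<partial>lborel)"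
    unfolding e integral_mult_right_zero by (simp only: mult.assoc[symmetric])
qed

text \<open>Collects what is used of the kernel written as \<open>a * h r\<close>. The equation for
  \<open>h\<close> expresses the Helmholtz equation for this product; the coefficient is 3 because
  of the angular factor \<open>a / r\<close>. \<open>h_bound\<close> and \<open>h'_bound\<close> are
  decay and radiation. \<open>h_zero\<close> says that near its singularity the kernel looks like
  the Poisson kernel \<open>a / (pi r^2)\<close> of the Laplacian, which fixes the
  normalisation.\<close>

locale radiating_profile =
  fixes k :: real and h h' :: "real \<Rightarrow> complex" and C :: real
  assumes k: "k > 0" and C: "C > 0"
    and h_deriv: "\<And>r. r > 0 \<Longrightarrow> (h has_vector_derivative h' r) (at r)"
    and h'_deriv: "\<And>r. r > 0 \<Longrightarrow> (h' has_vector_derivative - (3 / of_real r) * h' r - of_real (k\<^sup>2) * h r) (at r)"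
    and h_bound: "\<And>r. r > 0 \<Longrightarrow> norm (h r) \<le> C * (r powr (- 2) + r powr (- (3/2)))"
    and h'_bound: "\<And>r. r > 0 \<Longrightarrow> norm (h' r - \<i> * of_real k * h r) \<le> C * (r powr (- 3) + r powr (- (5/2)))"
    and h_zero: "((\<lambda>r. of_real (r\<^sup>2) * h r) \<longlongrightarrow> of_real (1 / pi)) (at_right 0)"
begin

definition h'' :: "real \<Rightarrow> complex" where
  "h'' r = - (3 / of_real r) * h' r - of_real (k\<^sup>2) * h r"

lemma h_large:
  assumes "r \<ge> 1"
  shows "norm (h r) \<le> 2 * C * r powr (- (3/2))"
    and "norm (h' r - \<i> * of_real k * h r) \<le> 2 * C * r powr (- (5/2))"
    and "norm (h' r) \<le> 2 * C * (k + 1) * r powr (- (3/2))"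
proof -
  have "r powr (- 2) \<le> r powr (- (3/2))" "r powr (- 3) \<le> r powr (- (5/2))" "r powr (- (5/2)) \<le> r powr (- (3/2))"
    using assms by (auto intro!: powr_mono)
  then have m: "C * r powr (- 2) \<le> C * r powr (- (3/2))" "C * r powr (- 3) \<le> C * r powr (- (5/2))"
     "2 * C * r powr (- (5/2)) \<le> 2 * C * r powr (- (3/2))"
    using C by (simp_all only: mult_left_mono less_imp_le mult_pos_pos zero_less_numeral)
  show 1: "norm (h r) \<le> 2 * C * r powr (- (3/2))"
    using h_bound[of r] m(1) assms unfolding distrib_left by linarith
  show 2: "norm (h' r - \<i> * of_real k * h r) \<le> 2 * C * r powr (- (5/2))"
    using h'_bound[of r] m(2) assms unfolding distrib_left by linarith
  have "norm (h' r) \<le> norm (h' r - \<i> * of_real k * h r) + norm (\<i> * of_real k * h r)"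
    by (metis diff_add_cancel norm_triangle_ineq)
  also have "norm (\<i> * of_real k * h r) \<le> k * (2 * C * r powr (- (3/2)))"
    using 1 k by (simp add: norm_mult)
  finally show "norm (h' r) \<le> 2 * C * (k + 1) * r powr (- (3/2))"
    using 2 m(3) unfolding distrib_left distrib_right by (simp add: mult_ac)
qed

lemma continuous_on_h [continuous_intros]:
  assumes "continuous_on S f" "\<And>x. x \<in> S \<Longrightarrow> f x > 0"
  shows "continuous_on S (\<lambda>x. h (f x))" "continuous_on S (\<lambda>x. h' (f x))"
proof -
  have "continuous_on {0<..} h"
    by (intro continuous_at_imp_continuous_on ballI has_vector_derivative_continuous[OF h_deriv]) auto
  from continuous_on_compose2[OF this assms(1)] show "continuous_on S (\<lambda>x. h (f x))" using assms(2) by auto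
  have "continuous_on {0<..} h'"
    by (intro continuous_at_imp_continuous_on ballI has_vector_derivative_continuous[OF h'_deriv]) auto
  from continuous_on_compose2[OF this assms(1)] show "continuous_on S (\<lambda>x. h' (f x))" using assms(2) by auto
qed

lemma h_chain:
  assumes "(f has_real_derivative f') (at x)" "f x > 0"
  shows "((\<lambda>x. h (f x)) has_vector_derivative of_real f' * h' (f x)) (at x)"
    and "((\<lambda>x. h' (f x)) has_vector_derivative of_real f' * h'' (f x)) (at x)"
  using vector_diff_chain_at[OF assms(1)[unfolded has_real_derivative_iff_has_vector_derivative] h_deriv[OF assms(2)]]
    vector_diff_chain_at[OF assms(1)[unfolded has_real_derivative_iff_has_vector_derivative] h'_deriv[OF assms(2)]]
  by (simp_all add: o_def scaleR_conv_of_real h''_def)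

definition P :: "real \<Rightarrow> real \<Rightarrow> complex" where
  "P a y = of_real a * h (rho a y)"

definition P_a :: "real \<Rightarrow> real \<Rightarrow> complex" where
  "P_a a y = h (rho a y) + of_real (a * a / rho a y) * h' (rho a y)"

definition P_y :: "real \<Rightarrow> real \<Rightarrow> complex" where
  "P_y a y = of_real (a * y / rho a y) * h' (rho a y)"

definition P_aa :: "real \<Rightarrow> real \<Rightarrow> complex" where
  "P_aa a y = of_real (a / rho a y) * h' (rho a y) + of_real (2 * a / rho a y - a ^ 3 / rho a y ^ 3) * h' (rho a y)
     + of_real (a ^ 3 / (rho a y)\<^sup>2) * h'' (rho a y)"

definition P_yy :: "real \<Rightarrow> real \<Rightarrow> complex" where
  "P_yy a y = of_real (a / rho a y - a * y\<^sup>2 / rho a y ^ 3) * h' (rho a y)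
     + of_real (a * y\<^sup>2 / (rho a y)\<^sup>2) * h'' (rho a y)"

text \<open>In the Laplacian of \<open>P\<close> the coefficients of \<open>h'\<close> collect to
  \<open>3 a / rho\<close> and those of \<open>h''\<close> to \<open>a\<close>; the ODE for
  \<open>h\<close> then leaves \<open>- k^2 a h\<close>.\<close>

lemma P_derivs:
  assumes a: "a > 0"
  shows "((\<lambda>a. P a y) has_vector_derivative P_a a y) (at a)"
    and "((\<lambda>y. P a y) has_vector_derivative P_y a y) (at y)"
    and "((\<lambda>a. P_a a y) has_vector_derivative P_aa a y) (at a)"
    and "((\<lambda>y. P_y a y) has_vector_derivative P_yy a y) (at y)"
    and "P_aa a y + P_yy a y = - of_real (k\<^sup>2) * P a y"
proof -
  have r: "rho a y > 0" using a by (intro rho_pos) auto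
  note da = rho_derivs(1)[OF a, of y] and dy = rho_derivs(2)[OF a, of y]
  have id: "(complex_of_real has_vector_derivative 1) (at x)" for x
    using has_vector_derivative_of_real[OF DERIV_ident[of "at x"]] by simp
  show "((\<lambda>a. P a y) has_vector_derivative P_a a y) (at a)"
    unfolding P_def P_a_def
    by (rule has_vector_derivative_eq_rhs[OF has_vector_derivative_mult[OF id h_chain(1)[OF da r]]])
       (simp add: algebra_simps)
  show "((\<lambda>y. P a y) has_vector_derivative P_y a y) (at y)"
    unfolding P_def P_y_def
    by (rule has_vector_derivative_eq_rhs[OF has_vector_derivative_mult_right[OF h_chain(1)[OF dy r]]])
       (simp add: algebra_simps)
  have 1: "((\<lambda>a. a * a / rho a y) has_real_derivative 2 * a / rho a y - a ^ 3 / rho a y ^ 3) (at a)"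
    by (rule derivative_eq_intros da refl | use r in \<open>simp; fail\<close>)+
       (use r in \<open>simp add: field_simps power3_eq_cube\<close>)
  show "((\<lambda>a. P_a a y) has_vector_derivative P_aa a y) (at a)"
    unfolding P_a_def P_aa_def
    by (rule has_vector_derivative_eq_rhs[OF has_vector_derivative_add[OF h_chain(1)[OF da r]
          has_vector_derivative_mult[OF has_vector_derivative_of_real[OF 1] h_chain(2)[OF da r]]]])
       (simp add: algebra_simps power3_eq_cube power2_eq_square)
  have 2: "((\<lambda>y. a * y / rho a y) has_real_derivative a / rho a y - a * y\<^sup>2 / rho a y ^ 3) (at y)"
    by (rule derivative_eq_intros dy refl | use r in \<open>simp; fail\<close>)+
       (use r in \<open>simp add: field_simps power3_eq_cube power2_eq_square\<close>)
  show "((\<lambda>y. P_y a y) has_vector_derivative P_yy a y) (at y)"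
    unfolding P_y_def P_yy_def
    by (rule has_vector_derivative_eq_rhs[OF 
          has_vector_derivative_mult[OF has_vector_derivative_of_real[OF 2] h_chain(2)[OF dy r]]])
       (simp add: algebra_simps power2_eq_square)
  have e1: "a / rho a y + (2 * a / rho a y - a ^ 3 / rho a y ^ 3) + (a / rho a y - a * y\<^sup>2 / rho a y ^ 3) = 3 * a / rho a y"
  proof -
    have "a ^ 3 / rho a y ^ 3 + a * y\<^sup>2 / rho a y ^ 3 = a * (rho a y * rho a y) / rho a y ^ 3"
      unfolding rho_square by (simp add: power3_eq_cube power2_eq_square add_divide_distrib algebra_simps)
    then show ?thesis using r by (simp add: power3_eq_cube)
  qed
  have e2: "a ^ 3 / (rho a y)\<^sup>2 + a * y\<^sup>2 / (rho a y)\<^sup>2 = a"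
  proof -
    have "a ^ 3 / (rho a y)\<^sup>2 + a * y\<^sup>2 / (rho a y)\<^sup>2 = a * (rho a y * rho a y) / (rho a y)\<^sup>2"
      unfolding rho_square by (simp add: power3_eq_cube power2_eq_square add_divide_distrib algebra_simps)
    then show ?thesis using r by (simp add: power2_eq_square)
  qed
  have "P_aa a y + P_yy a y =
     of_real (a / rho a y + (2 * a / rho a y - a ^ 3 / rho a y ^ 3) + (a / rho a y - a * y\<^sup>2 / rho a y ^ 3)) * h' (rho a y)
     + of_real (a ^ 3 / (rho a y)\<^sup>2 + a * y\<^sup>2 / (rho a y)\<^sup>2) * h'' (rho a y)"
    unfolding P_aa_def P_yy_def of_real_add by (simp only: distrib_right add_ac)
  also have "\<dots> = - of_real (k\<^sup>2) * P a y"
    unfolding e1 e2 using r by (simp add: h''_def P_def algebra_simps)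
  finally show "P_aa a y + P_yy a y = - of_real (k\<^sup>2) * P a y" .
qed

lemma P_minus [simp]: "P a (- y) = P a y"
  by (simp add: P_def)

lemma continuous_on_P [continuous_intros]:
  assumes "continuous_on S f" "continuous_on S g" "\<And>x. x \<in> S \<Longrightarrow> f x > 0"
  shows "continuous_on S (\<lambda>x. P (f x) (g x))" "continuous_on S (\<lambda>x. P_a (f x) (g x))"
    "continuous_on S (\<lambda>x. P_aa (f x) (g x))"
proof -
  have r: "rho (f x) (g x) > 0" if "x \<in> S" for x using assms(3)[OF that] by (intro rho_pos) auto
  have r': "rho (f x) (g x) \<noteq> 0" if "x \<in> S" for x using r[OF that] by simp
  have c: "continuous_on S (\<lambda>x. h'' (rho (f x) (g x)))"
    unfolding h''_def by (intro continuous_intros assms r) (use r' in auto)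
  show "continuous_on S (\<lambda>x. P (f x) (g x))"
    unfolding P_def by (intro continuous_intros assms r)
  show "continuous_on S (\<lambda>x. P_a (f x) (g x))"
    unfolding P_a_def by (intro continuous_intros assms r) (use r' in auto)
  show "continuous_on S (\<lambda>x. P_aa (f x) (g x))"
    unfolding P_aa_def by (intro continuous_intros assms r c) (use r' in auto)
qed

text \<open>The second estimate is the radiation condition for the vertical derivative, with the
  direction cosine \<open>a / rho a y\<close>. Its bound has no factor \<open>a\<close>, unlike the
  bound for \<open>P\<close>, so the defect is one order smaller than \<open>P\<close> where
  \<open>a\<close> is comparable to \<open>rho a y\<close>.\<close>

lemma P_large:
  assumes a: "a > 0" and r: "rho a y \<ge> 1"
  shows "norm (P a y) \<le> 2 * C * a * rho a y powr (- (3/2))"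
    and "norm (P_a a y - \<i> * of_real (k * a / rho a y) * P a y) \<le> 4 * C * rho a y powr (- (3/2))"
    and "norm (P_y a y) \<le> 2 * C * (k + 1) * a * rho a y powr (- (3/2))"
proof -
  note b = h_large[OF r]
  show "norm (P a y) \<le> 2 * C * a * rho a y powr (- (3/2))"
    using mult_left_mono[OF b(1), of a] a by (simp add: P_def norm_mult mult_ac)
  have ar: "a / rho a y \<le> 1" "\<bar>y\<bar> / rho a y \<le> 1" using rho_ge[of a y] rho_ge(2)[of y a] r a by (simp_all add: divide_simps)
  have "P_a a y - \<i> * of_real (k * a / rho a y) * P a y = h (rho a y) + of_real (a * a / rho a y) * (h' (rho a y) - \<i> * of_real k * h (rho a y))"
    by (simp add: P_a_def P_def algebra_simps)
  also have "norm \<dots> \<le> norm (h (rho a y)) + norm (of_real (a * a / rho a y) * (h' (rho a y) - \<i> * of_real k * h (rho a y)))"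
    by (rule norm_triangle_ineq)
  also have "\<dots> = norm (h (rho a y)) + a * (a / rho a y) * norm (h' (rho a y) - \<i> * of_real k * h (rho a y))"
    using a r by (simp add: norm_mult norm_divide)
  also have "\<dots> \<le> 2 * C * rho a y powr (- (3/2)) + rho a y * 1 * (2 * C * rho a y powr (- (5/2)))"
    using b ar a rho_ge(1)[of a y] C by (intro add_mono mult_mono) auto
  also have "rho a y * 1 * (2 * C * rho a y powr (- (5/2))) = 2 * C * (rho a y powr 1 * rho a y powr (- (5/2)))"
    using r by simp
  also have "rho a y powr 1 * rho a y powr (- (5/2)) = rho a y powr (- (3/2))"
    by (simp only: powr_add[symmetric]) simp
  finally show "norm (P_a a y - \<i> * of_real (k * a / rho a y) * P a y) \<le> 4 * C * rho a y powr (- (3/2))"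
    by simp
  have "norm (P_y a y) = a * (\<bar>y\<bar> / rho a y) * norm (h' (rho a y))"
    using a r by (simp add: P_y_def norm_mult norm_divide)
  also have "\<dots> \<le> a * 1 * (2 * C * (k + 1) * rho a y powr (- (3/2)))"
    using b ar a C k rho_ge(3)[of a y] by (intro mult_mono) auto
  finally show "norm (P_y a y) \<le> 2 * C * (k + 1) * a * rho a y powr (- (3/2))" by (simp add: mult_ac)
qed

lemma P_bound:
  assumes a: "a > 0"
  shows "norm (P a y) \<le> C * a * (rho a y powr (- 2) + rho a y powr (- (3/2)))"
  using mult_left_mono[OF h_bound[of "rho a y"], of a] a rho_pos[of a y] by (simp add: P_def norm_mult mult_ac)

end

section \<open>An exact solution of the Helmholtz equation\<close>

text \<open>Bundles a solution above height \<open>A\<close> with its explicit derivatives, so that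
  Green's identity applies equally to the wave and to shifted kernels. The continuity clauses serve
  differentiation in \<open>a\<close> under an integral over \<open>t\<close>; in the
  \<open>t\<close> direction the fundamental theorem of calculus is used.\<close>

definition helmholtz ::
  "real \<Rightarrow> real \<Rightarrow> (real \<Rightarrow> real \<Rightarrow> complex) \<Rightarrow> (real \<Rightarrow> real \<Rightarrow> complex) \<Rightarrow> (real \<Rightarrow> real \<Rightarrow> complex) \<Rightarrow>
     (real \<Rightarrow> real \<Rightarrow> complex) \<Rightarrow> (real \<Rightarrow> real \<Rightarrow> complex) \<Rightarrow> bool" where
  "helmholtz k A F Fa Ft Faa Ftt \<longleftrightarrow>
     (\<forall>a>A. \<forall>t. ((\<lambda>a. F a t) has_vector_derivative Fa a t) (at a) \<and>
        ((\<lambda>t. F a t) has_vector_derivative Ft a t) (at t) \<and>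
        ((\<lambda>a. Fa a t) has_vector_derivative Faa a t) (at a) \<and>
        ((\<lambda>t. Ft a t) has_vector_derivative Ftt a t) (at t) \<and>
        Faa a t + Ftt a t = - of_real (k\<^sup>2) * F a t) \<and>
     continuous_on ({A<..} \<times> UNIV) (\<lambda>(a, t). F a t) \<and>
     continuous_on ({A<..} \<times> UNIV) (\<lambda>(a, t). Fa a t) \<and>
     continuous_on ({A<..} \<times> UNIV) (\<lambda>(a, t). Faa a t)"

lemma helmholtzD:
  assumes "helmholtz k A F Fa Ft Faa Ftt" "a > A"
  shows "((\<lambda>a. F a t) has_vector_derivative Fa a t) (at a)"
    and "((\<lambda>t. F a t) has_vector_derivative Ft a t) (at t)"
    and "((\<lambda>a. Fa a t) has_vector_derivative Faa a t) (at a)"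
    and "((\<lambda>t. Ft a t) has_vector_derivative Ftt a t) (at t)"
    and "Faa a t + Ftt a t = - of_real (k\<^sup>2) * F a t"
  using assms unfolding helmholtz_def by blast+

lemma helmholtz_cont:
  assumes "helmholtz k A F Fa Ft Faa Ftt"
    and "continuous_on S f" "continuous_on S g" "\<And>x. x \<in> S \<Longrightarrow> f x > A"
  shows "continuous_on S (\<lambda>x. F (f x) (g x))" "continuous_on S (\<lambda>x. Fa (f x) (g x))"
    "continuous_on S (\<lambda>x. Faa (f x) (g x))"
proof -
  have c: "continuous_on S (\<lambda>x. (f x, g x))" by (intro continuous_intros assms)
  have s: "(\<lambda>x. (f x, g x)) ` S \<subseteq> {A<..} \<times> UNIV" using assms(4) by auto
  show "continuous_on S (\<lambda>x. F (f x) (g x))" "continuous_on S (\<lambda>x. Fa (f x) (g x))"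
    "continuous_on S (\<lambda>x. Faa (f x) (g x))"
    using assms(1) continuous_on_compose2[OF _ c s] unfolding helmholtz_def by fastforce+
qed

lemma helmholtz_mono:
  assumes "helmholtz k A F Fa Ft Faa Ftt" "A \<le> A'"
  shows "helmholtz k A' F Fa Ft Faa Ftt"
proof -
  have "{A'<..} \<times> (UNIV :: real set) \<subseteq> {A<..} \<times> UNIV" using assms(2) by auto
  then show ?thesis
    using assms unfolding helmholtz_def by (auto intro: continuous_on_subset)
qed

text \<open>Differentiation under the integral produces \<open>Faa G - F Gaa\<close>. The
  \<open>k^2\<close> terms cancel, so this equals \<open>F Gtt - Ftt G\<close>, an exact
  \<open>t\<close> derivative.\<close>

lemma green_identity:
  assumes F: "helmholtz k A F Fa Ft Faa Ftt" and G: "helmholtz k A G Ga Gt Gaa Gtt"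
    and s: "s > A" and T: "T \<ge> 0"
  shows "((\<lambda>s. integral {-T..T} (\<lambda>t. Fa s t * G s t - F s t * Ga s t)) has_vector_derivative
     (F s T * Gt s T - Ft s T * G s T) - (F s (- T) * Gt s (- T) - Ft s (- T) * G s (- T))) (at s)"
proof -
  note cF = helmholtz_cont[OF F] and cG = helmholtz_cont[OF G]
  have "((\<lambda>s. integral (cbox (-T) T) (\<lambda>t. Fa s t * G s t - F s t * Ga s t)) has_vector_derivative
      integral (cbox (-T) T) (\<lambda>t. Faa s t * G s t - F s t * Gaa s t)) (at s within {A<..})"
  proof (rule leibniz_rule_vector_derivative)
    fix a t assume "a \<in> {A<..}"
    then have a: "a > A" by simp
    have "((\<lambda>s. Fa s t * G s t - F s t * Ga s t) has_vector_derivative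
        (Fa a t * Ga a t + Faa a t * G a t) - (F a t * Gaa a t + Fa a t * Ga a t)) (at a)"
      by (intro has_vector_derivative_diff has_vector_derivative_mult helmholtzD[OF F a] helmholtzD[OF G a])
    from has_vector_derivative_at_within[OF has_vector_derivative_eq_rhs[OF this]]
    show "((\<lambda>s. Fa s t * G s t - F s t * Ga s t) has_vector_derivative
        Faa a t * G a t - F a t * Gaa a t) (at a within {A<..})" by simp
  next
    fix a assume "a \<in> {A<..}"
    then show "(\<lambda>t. Fa a t * G a t - F a t * Ga a t) integrable_on cbox (- T) T"
      by (intro integrable_continuous continuous_intros cF cG) auto
  next
    show "continuous_on ({A<..} \<times> cbox (- T) T) (\<lambda>(a, t). Faa a t * G a t - F a t * Gaa a t)"
      unfolding split_beta by (intro continuous_intros cF cG) auto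
  qed (use s in auto)
  moreover have "((\<lambda>t. Faa s t * G s t - F s t * Gaa s t) has_integral
     (F s T * Gt s T - Ft s T * G s T) - (F s (- T) * Gt s (- T) - Ft s (- T) * G s (- T))) {-T..T}"
  proof (rule fundamental_theorem_of_calculus)
    fix t
    have "((\<lambda>t. F s t * Gt s t - Ft s t * G s t) has_vector_derivative
        (F s t * Gtt s t + Ft s t * Gt s t) - (Ft s t * Gt s t + Ftt s t * G s t)) (at t)"
      by (intro has_vector_derivative_diff has_vector_derivative_mult helmholtzD[OF F s] helmholtzD[OF G s])
    moreover have e: "Faa s t = - of_real (k\<^sup>2) * F s t - Ftt s t" "Gaa s t = - of_real (k\<^sup>2) * G s t - Gtt s t"
      using helmholtzD(5)[OF F s, of t] helmholtzD(5)[OF G s, of t] by (simp_all add: algebra_simps)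
    have "(F s t * Gtt s t + Ft s t * Gt s t) - (Ft s t * Gt s t + Ftt s t * G s t) =
        Faa s t * G s t - F s t * Gaa s t"
      unfolding e by (simp add: algebra_simps)
    ultimately show "((\<lambda>t. F s t * Gt s t - Ft s t * G s t) has_vector_derivative
        Faa s t * G s t - F s t * Gaa s t) (at t within {-T..T})"
      by (simp add: has_vector_derivative_at_within)
  qed (use T in simp)
  ultimately show ?thesis
    using s by (simp add: at_within_open[of s "{A<..}"] integral_unique)
qed

text \<open>The value at the origin is a junk value; every use has \<open>b > 0\<close>, mostly \<open>b = 1 + a\<close> with \<open>a \<ge> 0\<close>,
  so that the singularity lies outside the closed half plane.\<close>

definition wave :: "real \<Rightarrow> real \<Rightarrow> real \<Rightarrow> complex" where
  "wave k b t = cis (k * rho b t) * inverse (csqrt (Complex b t))"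

definition wave_b :: "real \<Rightarrow> real \<Rightarrow> real \<Rightarrow> complex" where
  "wave_b k b t = (\<i> * of_real (k * b / rho b t) - inverse (2 * Complex b t)) * wave k b t"

definition wave_t :: "real \<Rightarrow> real \<Rightarrow> real \<Rightarrow> complex" where
  "wave_t k b t = (\<i> * of_real (k * t / rho b t) - \<i> * inverse (2 * Complex b t)) * wave k b t"

definition wave_bb :: "real \<Rightarrow> real \<Rightarrow> real \<Rightarrow> complex" where
  "wave_bb k b t = (\<i> * of_real (k * b / rho b t) - inverse (2 * Complex b t)) * wave_b k b t +
     (\<i> * of_real (k * (1 / rho b t - b\<^sup>2 / rho b t ^ 3)) + inverse (2 * (Complex b t)\<^sup>2)) * wave k b t"

definition wave_tt :: "real \<Rightarrow> real \<Rightarrow> real \<Rightarrow> complex" where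
  "wave_tt k b t = (\<i> * of_real (k * t / rho b t) - \<i> * inverse (2 * Complex b t)) * wave_t k b t +
     (\<i> * of_real (k * (1 / rho b t - t\<^sup>2 / rho b t ^ 3)) - inverse (2 * (Complex b t)\<^sup>2)) * wave k b t"

lemma norm_Complex_rho: "norm (Complex b t) = rho b t"
  by (simp add: rho_def cmod_def)

lemma norm_wave: "b > 0 \<Longrightarrow> norm (wave k b t) = rho b t powr (- (1/2))"
  by (simp only: wave_def norm_mult norm_inverse norm_cis norm_csqrt norm_Complex_rho powr_minus
      powr_half_sqrt rho_ge mult_1)

lemma has_vector_derivative_Complex:
  "((\<lambda>b. Complex b t) has_vector_derivative 1) (at b)" "((\<lambda>t. Complex b t) has_vector_derivative \<i>) (at t)"
proof -
  have "((\<lambda>b. of_real b + \<i> * of_real t) has_vector_derivative of_real 1 + 0) (at b)"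
    by (intro has_vector_derivative_add has_vector_derivative_of_real has_vector_derivative_const) simp
  then show "((\<lambda>b. Complex b t) has_vector_derivative 1) (at b)" by (simp add: Complex_eq)
  have "((\<lambda>t. of_real b + \<i> * of_real t) has_vector_derivative 0 + \<i> * of_real 1) (at t)"
    by (intro has_vector_derivative_add has_vector_derivative_of_real has_vector_derivative_const
        has_vector_derivative_mult_right) simp
  then show "((\<lambda>t. Complex b t) has_vector_derivative \<i>) (at t)" by (simp add: Complex_eq)
qed

lemma DERIV_inverse_csqrt:
  assumes "z \<notin> \<real>\<^sub>\<le>\<^sub>0"
  shows "((\<lambda>z. inverse (csqrt z)) has_field_derivative - inverse (2 * z) * inverse (csqrt z)) (at z)"
proof -
  have z: "z \<noteq> 0" "csqrt z \<noteq> 0" using assms by auto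
  have sq: "csqrt z * csqrt z = z" using power2_csqrt[of z] by (simp only: power2_eq_square)
  have "((\<lambda>z. inverse (csqrt z)) has_field_derivative - (1 / (2 * csqrt z)) / (csqrt z * csqrt z)) (at z)"
    using z assms by (auto intro!: derivative_eq_intros simp: field_simps)
  then show ?thesis
    unfolding sq by (rule DERIV_cong) (use z in \<open>simp add: field_simps\<close>)
qed

lemma wave_derivs:
  assumes b: "b > 0"
  shows "((\<lambda>b. wave k b t) has_vector_derivative wave_b k b t) (at b)"
    and "((\<lambda>t. wave k b t) has_vector_derivative wave_t k b t) (at t)"
    and "((\<lambda>b. wave_b k b t) has_vector_derivative wave_bb k b t) (at b)"
    and "((\<lambda>t. wave_t k b t) has_vector_derivative wave_tt k b t) (at t)"
    and "wave_bb k b t + wave_tt k b t = - of_real (k\<^sup>2) * wave k b t"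
proof -
  let ?z = "Complex b t"
  have r: "rho b t > 0" using b by (intro rho_pos) auto
  have z: "?z \<noteq> 0" "?z \<notin> \<real>\<^sub>\<le>\<^sub>0"
    using b by (auto simp: complex_eq_iff complex_nonpos_Reals_iff)
  note db = rho_derivs(1)[OF b, of t] and dt = rho_derivs(2)[OF b, of t]
  note cb = has_vector_derivative_Complex(1)[of t b] and ct = has_vector_derivative_Complex(2)[of b t]
  have cis: "((\<lambda>x. cis (k * f x)) has_vector_derivative \<i> * of_real (k * f') * cis (k * f x)) (at x)"
    if "(f has_real_derivative f') (at x)" for f f' x
    using vector_diff_chain_at[OF DERIV_cmult[OF that, of k, unfolded has_real_derivative_iff_has_vector_derivative] has_vector_derivative_cis]
    by (simp add: o_def scaleR_conv_of_real mult_ac)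
  note isq = DERIV_inverse_csqrt[OF z(2)]
  have inv: "((\<lambda>z. inverse (2 * z)) has_field_derivative - inverse (2 * ?z\<^sup>2)) (at ?z)"
    using z by (auto intro!: derivative_eq_intros simp: field_simps power2_eq_square)
  show 1: "((\<lambda>b. wave k b t) has_vector_derivative wave_b k b t) (at b)"
    unfolding wave_def wave_b_def
    by (rule has_vector_derivative_eq_rhs[OF has_vector_derivative_mult[OF cis[OF db] field_vector_diff_chain_at[OF cb isq, unfolded o_def]]])
       (simp add: algebra_simps)
  show 2: "((\<lambda>t. wave k b t) has_vector_derivative wave_t k b t) (at t)"
    unfolding wave_def wave_t_def
    by (rule has_vector_derivative_eq_rhs[OF has_vector_derivative_mult[OF cis[OF dt] field_vector_diff_chain_at[OF ct isq, unfolded o_def]]])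
       (simp add: algebra_simps)
  have q1: "((\<lambda>b. k * b / rho b t) has_real_derivative k * (1 / rho b t - b\<^sup>2 / rho b t ^ 3)) (at b)"
    by (rule derivative_eq_intros db refl | use r in \<open>simp; fail\<close>)+
       (use r in \<open>simp add: field_simps power3_eq_cube power2_eq_square\<close>)
  have q2: "((\<lambda>t. k * t / rho b t) has_real_derivative k * (1 / rho b t - t\<^sup>2 / rho b t ^ 3)) (at t)"
    by (rule derivative_eq_intros dt refl | use r in \<open>simp; fail\<close>)+
       (use r in \<open>simp add: field_simps power3_eq_cube power2_eq_square\<close>)
  have f1: "((\<lambda>b. \<i> * of_real (k * b / rho b t) - inverse (2 * Complex b t)) has_vector_derivative
      \<i> * of_real (k * (1 / rho b t - b\<^sup>2 / rho b t ^ 3)) - 1 * (- inverse (2 * ?z\<^sup>2))) (at b)"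
    by (intro has_vector_derivative_diff has_vector_derivative_mult_right has_vector_derivative_of_real[OF q1]
        field_vector_diff_chain_at[OF cb inv, unfolded o_def])
  have f2: "((\<lambda>t. \<i> * of_real (k * t / rho b t) - \<i> * inverse (2 * Complex b t)) has_vector_derivative
      \<i> * of_real (k * (1 / rho b t - t\<^sup>2 / rho b t ^ 3)) - \<i> * (\<i> * (- inverse (2 * ?z\<^sup>2)))) (at t)"
    by (intro has_vector_derivative_diff has_vector_derivative_mult_right has_vector_derivative_of_real[OF q2]
        field_vector_diff_chain_at[OF ct inv, unfolded o_def])
  show "((\<lambda>b. wave_b k b t) has_vector_derivative wave_bb k b t) (at b)"
    using has_vector_derivative_mult[OF f1 1] by (simp add: wave_b_def[abs_def] wave_bb_def)
  show "((\<lambda>t. wave_t k b t) has_vector_derivative wave_tt k b t) (at t)"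
    using has_vector_derivative_mult[OF f2 2] by (simp add: wave_t_def[abs_def] wave_tt_def)
  \<comment> \<open>With these names the Helmholtz equation is a polynomial identity modulo two
    relations: \<open>X * X * (B * B + T * T) = 1\<close> for the distance and
    \<open>2 * Z * (B + i T) = 1\<close> for the square root.\<close>
  define X where "X = complex_of_real (1 / rho b t)"
  define Z where "Z = inverse (2 * ?z)"
  define K where "K = complex_of_real k"
  define B where "B = complex_of_real b"
  define T where "T = complex_of_real t"
  have zeq: "?z = B + \<i> * T" by (simp add: B_def T_def Complex_eq)
  have "2 * inverse (2 * w) * w = 1" if "w \<noteq> 0" for w :: complex using that by simp
  from this[OF z(1)] have Z1: "2 * Z * (B + \<i> * T) = 1" unfolding Z_def zeq .
  have Z2: "inverse (2 * ?z\<^sup>2) = 2 * Z * Z" using z by (simp add: Z_def power2_eq_square)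
  have X1: "X * X * (B * B + T * T) = 1"
  proof -
    have "(1 / rho b t) * (1 / rho b t) * (rho b t * rho b t) = 1" using r by simp
    then have "(1 / rho b t) * (1 / rho b t) * (b * b + t * t) = 1" unfolding rho_square .
    then have "complex_of_real ((1 / rho b t) * (1 / rho b t) * (b * b + t * t)) = of_real 1" by (rule arg_cong)
    then show ?thesis unfolding X_def B_def T_def by (simp only: of_real_mult of_real_add of_real_1)
  qed
  have eb: "complex_of_real (k * b / rho b t) = K * B * X" "complex_of_real (k * t / rho b t) = K * T * X"
     "complex_of_real (k * (1 / rho b t - b\<^sup>2 / rho b t ^ 3)) = K * (X - B * B * X * X * X)"
     "complex_of_real (k * (1 / rho b t - t\<^sup>2 / rho b t ^ 3)) = K * (X - T * T * X * X * X)"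
    by (simp_all add: K_def B_def X_def T_def power2_eq_square power3_eq_cube)
  have "(\<i> * (K * B * X) - Z) * (\<i> * (K * B * X) - Z) + (\<i> * (K * (X - B * B * X * X * X)) + 2 * Z * Z)
      + ((\<i> * (K * T * X) - \<i> * Z) * (\<i> * (K * T * X) - \<i> * Z) + (\<i> * (K * (X - T * T * X * X * X)) - 2 * Z * Z))
      = - (K * K) * (X * X * (B * B + T * T)) + \<i> * K * X * (2 - X * X * (B * B + T * T) - 2 * Z * (B + \<i> * T))"
    by (simp add: algebra_simps)
  also have "\<dots> = - (K * K)" unfolding X1 Z1 by simp
  finally have "((\<i> * (K * B * X) - Z) * (\<i> * (K * B * X) - Z) + (\<i> * (K * (X - B * B * X * X * X)) + 2 * Z * Z)
      + ((\<i> * (K * T * X) - \<i> * Z) * (\<i> * (K * T * X) - \<i> * Z) + (\<i> * (K * (X - T * T * X * X * X)) - 2 * Z * Z))) * wave k b t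
      = - (K * K) * wave k b t" by simp
  then show "wave_bb k b t + wave_tt k b t = - of_real (k\<^sup>2) * wave k b t"
    unfolding wave_bb_def wave_tt_def wave_b_def wave_t_def eb Z2 Z_def[symmetric]
    by (simp only: K_def power2_eq_square of_real_mult distrib_right mult.assoc mult_minus_left)
qed

lemma continuous_on_Complex [continuous_intros]:
  fixes f g :: "'a::t2_space \<Rightarrow> real"
  shows "continuous_on S f \<Longrightarrow> continuous_on S g \<Longrightarrow> continuous_on S (\<lambda>x. Complex (f x) (g x))"
  unfolding Complex_eq by (intro continuous_intros)

lemma continuous_on_cis' [continuous_intros]:
  fixes f :: "'a::t2_space \<Rightarrow> real"
  shows "continuous_on S f \<Longrightarrow> continuous_on S (\<lambda>x. cis (f x))"
  unfolding cis.code by (auto intro!: continuous_intros)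

lemma continuous_on_wave [continuous_intros]:
  fixes f g :: "'a::t2_space \<Rightarrow> real"
  assumes "continuous_on S f" "continuous_on S g" "\<And>x. x \<in> S \<Longrightarrow> f x > 0"
  shows "continuous_on S (\<lambda>x. wave k (f x) (g x))" "continuous_on S (\<lambda>x. wave_b k (f x) (g x))"
    "continuous_on S (\<lambda>x. wave_bb k (f x) (g x))"
proof -
  have r: "rho (f x) (g x) \<noteq> 0" if "x \<in> S" for x using rho_pos[of "f x" "g x"] assms(3)[OF that] by auto
  have z: "Complex (f x) (g x) \<noteq> 0" "Complex (f x) (g x) \<notin> \<real>\<^sub>\<le>\<^sub>0" if "x \<in> S" for x
    using assms(3)[OF that] by (auto simp: complex_eq_iff complex_nonpos_Reals_iff)
  have cs: "continuous_on S (\<lambda>x. csqrt (Complex (f x) (g x)))"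
  proof (rule continuous_on_compose2[of "- \<real>\<^sub>\<le>\<^sub>0" csqrt])
    show "continuous_on (- \<real>\<^sub>\<le>\<^sub>0) csqrt"
      by (intro continuous_at_imp_continuous_on ballI continuous_at_csqrt) simp
    show "continuous_on S (\<lambda>x. Complex (f x) (g x))" by (intro continuous_intros assms)
  qed (use z in auto)
  show 1: "continuous_on S (\<lambda>x. wave k (f x) (g x))"
    unfolding wave_def by (intro continuous_intros assms cs) (use z in auto)
  show 2: "continuous_on S (\<lambda>x. wave_b k (f x) (g x))"
    unfolding wave_b_def by (intro continuous_intros assms 1) (use z r in auto)
  show "continuous_on S (\<lambda>x. wave_bb k (f x) (g x))"
    unfolding wave_bb_def by (intro continuous_intros assms 1 2) (use z r in auto)
qed

text \<open>Up to the stated error, the vertical derivative of the wave is \<open>i k\<close> times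
  the direction cosine times the wave, the same pattern as for \<open>P_a\<close>; the cancellation
  in the flux rests on this match.\<close>

lemma wave_bounds:
  assumes b: "b \<ge> 1" and k: "k > 0"
  shows "norm (wave k b t) \<le> 1"
    and "norm (wave_b k b t - \<i> * of_real (k * b / rho b t) * wave k b t) \<le> norm (wave k b t) / (2 * rho b t)"
    and "norm (wave_t k b t) \<le> (k + 1) * norm (wave k b t)"
proof -
  have r: "rho b t \<ge> 1" using rho_ge(1)[of b t] b by simp
  have "rho b t powr (- (1/2)) \<le> 1 powr (- (1/2))" using r by (intro powr_mono2') auto
  then show "norm (wave k b t) \<le> 1" using b by (simp add: norm_wave)
  show "norm (wave_b k b t - \<i> * of_real (k * b / rho b t) * wave k b t) \<le> norm (wave k b t) / (2 * rho b t)"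
  proof -
    have "wave_b k b t - \<i> * of_real (k * b / rho b t) * wave k b t = - inverse (2 * Complex b t) * wave k b t"
      by (simp add: wave_b_def left_diff_distrib)
    moreover have "norm (- inverse (2 * Complex b t)) = 1 / (2 * rho b t)"
      by (simp only: norm_minus_cancel norm_inverse norm_mult norm_Complex_rho) (simp add: inverse_eq_divide)
    ultimately show ?thesis by (simp only: norm_mult) simp
  qed
  have "norm (\<i> * of_real (k * t / rho b t) - \<i> * inverse (2 * Complex b t)) \<le>
     norm (\<i> * of_real (k * t / rho b t)) + norm (\<i> * inverse (2 * Complex b t))"
    by (rule norm_triangle_ineq4)
  also have "\<dots> = k * (\<bar>t\<bar> / rho b t) + 1 / (2 * rho b t)"
  proof -
    have "norm (\<i> * of_real (k * t / rho b t)) = k * (\<bar>t\<bar> / rho b t)"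
      using k r by (simp only: norm_mult norm_ii mult_1 norm_of_real) (simp add: abs_mult)
    moreover have "norm (\<i> * inverse (2 * Complex b t)) = 1 / (2 * rho b t)"
      by (simp only: norm_mult norm_ii mult_1 norm_inverse norm_Complex_rho) (simp add: inverse_eq_divide)
    ultimately show ?thesis by simp
  qed
  also have "\<dots> \<le> k * 1 + 1"
    using k r rho_ge(2)[of t b] by (intro add_mono mult_left_mono) (auto simp: divide_simps)
  finally show "norm (wave_t k b t) \<le> (k + 1) * norm (wave k b t)"
    unfolding wave_t_def norm_mult by (intro mult_right_mono) auto
qed

lemma helmholtz_wave:
  "helmholtz k (- 1) (\<lambda>a. wave k (1 + a)) (\<lambda>a. wave_b k (1 + a)) (\<lambda>a. wave_t k (1 + a))
     (\<lambda>a. wave_bb k (1 + a)) (\<lambda>a. wave_tt k (1 + a))"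
proof -
  have sh: "((\<lambda>a. f (1 + a)) has_vector_derivative f') (at a)" if "(f has_vector_derivative f') (at (1 + a))"
    for f :: "real \<Rightarrow> complex" and f' a
  proof -
    have "((\<lambda>a::real. 1 + a) has_vector_derivative 1) (at a)"
      by (auto intro!: derivative_eq_intros simp flip: has_real_derivative_iff_has_vector_derivative)
    from vector_diff_chain_at[OF this that] show ?thesis by (simp add: o_def)
  qed
  show ?thesis
    unfolding helmholtz_def split_beta
    by (intro conjI allI impI sh wave_derivs continuous_intros) auto
qed

context radiating_profile
begin

lemma helmholtz_P:
  "helmholtz k (- b) (\<lambda>a t. P (a + b) (x - t)) (\<lambda>a t. P_a (a + b) (x - t)) (\<lambda>a t. - P_y (a + b) (x - t))
     (\<lambda>a t. P_aa (a + b) (x - t)) (\<lambda>a t. P_yy (a + b) (x - t))"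
proof -
  have sh: "((\<lambda>a. f (a + b)) has_vector_derivative f') (at a)" if "(f has_vector_derivative f') (at (a + b))"
    for f :: "real \<Rightarrow> complex" and f' a
  proof -
    have "((\<lambda>a::real. a + b) has_vector_derivative 1) (at a)"
      by (auto intro!: derivative_eq_intros simp flip: has_real_derivative_iff_has_vector_derivative)
    from vector_diff_chain_at[OF this that] show ?thesis by (simp add: o_def)
  qed
  have rf: "((\<lambda>t. f (x - t)) has_vector_derivative - f') (at t)" if "(f has_vector_derivative f') (at (x - t))"
    for f :: "real \<Rightarrow> complex" and f' t
  proof -
    have "((\<lambda>t::real. x - t) has_vector_derivative - 1) (at t)"
      by (auto intro!: derivative_eq_intros simp flip: has_real_derivative_iff_has_vector_derivative)
    from vector_diff_chain_at[OF this that] show ?thesis by (simp add: o_def)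
  qed
  have rf2: "((\<lambda>t. - f (x - t)) has_vector_derivative f') (at t)" if "(f has_vector_derivative f') (at (x - t))"
    for f :: "real \<Rightarrow> complex" and f' t
    using has_vector_derivative_minus[OF rf[OF that]] by simp
  show ?thesis
    unfolding helmholtz_def split_beta
    by (intro conjI allI impI sh rf rf2 P_derivs continuous_intros) auto
qed

end

section \<open>The Poisson formula for the exact solution\<close>

text \<open>Links the bounded intervals on which Green's identity is applied with the integrals over
  the line that define potentials.\<close>

lemma integral_symmetric_Icc_tendsto:
  fixes f :: "real \<Rightarrow> complex"
  assumes f: "integrable lborel f"
  shows "((\<lambda>T. integral {-T..T} f) \<longlongrightarrow> (\<integral>t. f t \<partial>lborel)) at_top"
proof -
  have "((\<lambda>T. \<integral>t. indicator {-T..T} t *\<^sub>R f t \<partial>lborel) \<longlongrightarrow> (\<integral>t. f t \<partial>lborel)) at_top"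
  proof (rule integral_dominated_convergence_at_top)
    show "integrable lborel (\<lambda>t. norm (f t))" using f by (rule integrable_norm)
    show "f \<in> borel_measurable lborel" using f by auto
    then show "(\<lambda>t. indicator {-T..T} t *\<^sub>R f t) \<in> borel_measurable lborel" for T by measurable
    show "AE t in lborel. ((\<lambda>T. indicator {-T..T} t *\<^sub>R f t) \<longlongrightarrow> f t) at_top"
    proof (rule AE_I2, rule tendsto_eventually)
      fix t :: real
      show "\<forall>\<^sub>F T in at_top. indicator {-T..T} t *\<^sub>R f t = f t"
        by (rule eventually_mono[OF eventually_ge_at_top[of "\<bar>t\<bar>"]]) (auto simp: indicator_def)
    qed
    show "\<forall>\<^sub>F T in at_top. AE t in lborel. norm (indicator {-T..T} t *\<^sub>R f t) \<le> norm (f t)"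
      by (intro always_eventually allI AE_I2) (auto simp: indicator_def)
  qed
  moreover have "integral {-T..T} f = (\<integral>t. indicator {-T..T} t *\<^sub>R f t \<partial>lborel)" for T
  proof -
    have "set_integrable lborel {-T..T} f"
      unfolding set_integrable_def using f by (intro integrable_mult_indicator) auto
    from set_borel_integral_eq_integral(2)[OF this] show ?thesis
      by (simp add: set_lebesgue_integral_def)
  qed
  ultimately show ?thesis by simp
qed

lemma integral_inverse_rho_square:
  "integrable lborel (\<lambda>v. rho 1 v powr (- 2))" "(\<integral>v. rho 1 v powr (- 2) \<partial>lborel) = pi"
proof -
  have e: "rho 1 v powr (- 2) = inverse (1 + v\<^sup>2)" for v
  proof -
    have "rho 1 v powr (- 2) = inverse (rho 1 v * rho 1 v)"
      using rho_ge(3)[of 1 v] rho_pos[of 1 v] by (simp add: powr_minus power2_eq_square)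
    then show ?thesis unfolding rho_square by (simp add: power2_eq_square)
  qed
  show "integrable lborel (\<lambda>v. rho 1 v powr (- 2))" by (rule integrable_rho_powr) simp
  show "(\<integral>v. rho 1 v powr (- 2) \<partial>lborel) = pi"
    using LBINT_inverse_1_plus_square unfolding e
    by (simp add: interval_lebesgue_integral_def set_lebesgue_integral_def)
qed

context radiating_profile
begin

lemma integrable_P:
  assumes a: "a > 0"
  shows "integrable lborel (\<lambda>t. P a (x - t))"
proof (rule Bochner_Integration.integrable_bound)
  show "integrable lborel (\<lambda>t. C * a * (rho a (x - t) powr (- 2) + rho a (x - t) powr (- (3/2))))"
    by (intro integrable_mult_right Bochner_Integration.integrable_add rho_powr_integral a) auto
  have "continuous_on UNIV (\<lambda>t. P a (x - t))" by (intro continuous_intros) (use a in auto)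
  then show "(\<lambda>t. P a (x - t)) \<in> borel_measurable lborel"
    by (simp add: borel_measurable_continuous_onI)
  show "AE t in lborel. norm (P a (x - t)) \<le> norm (C * a * (rho a (x - t) powr (- 2) + rho a (x - t) powr (- (3/2))))"
    by (intro AE_I2 order_trans[OF P_bound[OF a]]) simp
qed

lemma integrable_P_mult:
  assumes a: "a > 0" and f: "f \<in> borel_measurable lborel" and B: "\<And>t. norm (f t) \<le> B"
  shows "integrable lborel (\<lambda>t. P a (x - t) * f t)"
proof (rule Bochner_Integration.integrable_bound[OF integrable_mult_right[OF integrable_norm[OF integrable_P[OF a]], of B x]])
  show "(\<lambda>t. P a (x - t) * f t) \<in> borel_measurable lborel"
    using borel_measurable_integrable[OF integrable_P[OF a]] f by measurable
  have "B \<ge> 0" using B[of 0] norm_ge_zero order_trans by blast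
  then show "AE t in lborel. norm (P a (x - t) * f t) \<le> norm (B * norm (P a (x - t)))"
    using B by (intro AE_I2) (simp add: norm_mult mult.commute mult_right_mono)
qed

text \<open>Each of the two products is only of order \<open>1 / s\<close>. Since both factors are
  outgoing, their vertical derivatives agree with \<open>i k\<close> times almost equal direction
  cosines, and the difference gains another power of \<open>s\<close>.\<close>

lemma flux_density_bound:
  assumes A: "A > 0" and b: "\<bar>b\<bar> \<le> A" and s: "s \<ge> 2 * A + 2"
  shows "norm (wave_b k (1 + s) t * P (s + b) (x - t) - wave k (1 + s) t * P_a (s + b) (x - t))
     \<le> (16 * k * C * (1 + A + \<bar>x\<bar>) + 20 * C) / s\<^sup>2"
proof -
  \<comment> \<open>\<open>m\<close> bounds both distances from below: \<open>|b| <= A\<close> and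
    \<open>s >= 2 A + 2\<close> give \<open>s + b >= s / 2\<close>.\<close>
  define m where "m = s / 2"
  define rw where "rw = rho (1 + s) t"
  define r where "r = rho (s + b) (x - t)"
  define w where "w = wave k (1 + s) t"
  define p where "p = P (s + b) (x - t)"
  define E where "E = P_a (s + b) (x - t) - \<i> * of_real (k * (s + b) / r) * p"
  define D where "D = wave_b k (1 + s) t - \<i> * of_real (k * (1 + s) / rw) * w"
  have m: "m \<ge> 1" using s A by (simp add: m_def)
  have sb: "s + b \<ge> m" "s + b > 0" using s b A m unfolding m_def by linarith+
  have rw: "rw \<ge> m" using rho_ge(1)[of "1 + s" t] s A unfolding rw_def m_def by linarith
  have r: "r \<ge> m" "s + b \<le> r" using rho_ge(1)[of "s + b" "x - t"] sb unfolding r_def by linarith+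
  have pw: "y powr (- q) \<le> m powr (- q)" if "y \<ge> m" "q \<ge> 0" for y q
    using that m by (intro powr_mono2') auto
  have mm: "m powr (- (1/2)) * m powr (- (1/2)) = 1 / m" "m powr (- (1/2)) * m powr (- (3/2)) = 1 / m\<^sup>2"
    unfolding powr_add[symmetric] using m by (simp_all add: powr_minus_divide)
  have nw: "norm w \<le> m powr (- (1/2))"
    using pw[OF rw, of "1/2"] s A by (simp add: w_def norm_wave rw_def)
  have np: "norm p \<le> 2 * C * m powr (- (1/2))"
  proof -
    have "norm p \<le> 2 * C * (s + b) * r powr (- (3/2))"
      unfolding p_def r_def by (rule P_large(1)) (use sb r m in \<open>auto simp: r_def\<close>)
    also have "\<dots> \<le> 2 * C * r * r powr (- (3/2))"
      using r C by (intro mult_right_mono mult_left_mono) auto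
    also have "\<dots> = 2 * C * (r powr 1 * r powr (- (3/2)))" using r m by simp
    also have "\<dots> = 2 * C * r powr (- (1/2))" by (simp only: powr_add[symmetric]) simp
    also have "\<dots> \<le> 2 * C * m powr (- (1/2))" using pw[OF r(1), of "1/2"] C by simp
    finally show ?thesis .
  qed
  have nwp: "norm w * norm p \<le> 2 * C / m"
  proof -
    have "norm w * norm p \<le> m powr (- (1/2)) * (2 * C * m powr (- (1/2)))"
      using nw np by (intro mult_mono) auto
    also have "\<dots> = 2 * C * (m powr (- (1/2)) * m powr (- (1/2)))" by simp
    finally show ?thesis unfolding mm by simp
  qed
  have t1: "norm (D * p) \<le> C / m\<^sup>2"
  proof -
    have "norm D \<le> norm w / (2 * rw)"
      unfolding D_def w_def rw_def by (rule wave_bounds(2)) (use s A k in auto)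
    then have "norm (D * p) \<le> norm w / (2 * rw) * norm p"
      unfolding norm_mult by (rule mult_right_mono) simp
    also have "\<dots> = norm w * norm p / (2 * rw)" by simp
    also have "\<dots> \<le> (2 * C / m) / (2 * m)"
      using nwp rw m C by (intro frac_le) auto
    also have "\<dots> = C / m\<^sup>2" by (simp add: power2_eq_square)
    finally show ?thesis .
  qed
  have t2: "norm (w * E) \<le> 4 * C / m\<^sup>2"
  proof -
    have "norm E \<le> 4 * C * r powr (- (3/2))"
      unfolding E_def p_def r_def by (rule P_large(2)) (use sb r m in \<open>auto simp: r_def\<close>)
    also have "\<dots> \<le> 4 * C * m powr (- (3/2))" using pw[OF r(1), of "3/2"] C by simp
    finally have "norm w * norm E \<le> m powr (- (1/2)) * (4 * C * m powr (- (3/2)))"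
      using nw by (intro mult_mono) auto
    also have "\<dots> = 4 * C * (m powr (- (1/2)) * m powr (- (3/2)))" by simp
    finally show ?thesis unfolding mm norm_mult by simp
  qed
  have t3: "norm (\<i> * of_real (k * ((1 + s) / rw - (s + b) / r)) * (w * p)) \<le> 4 * k * C * (1 + A + \<bar>x\<bar>) / m\<^sup>2"
  proof -
    have "\<bar>(1 + s) / rw - (s + b) / r\<bar> \<le> 2 * (\<bar>1 + s - (s + b)\<bar> + \<bar>t - (t - x)\<bar>) / rho (s + b) (t - x)"
      unfolding rw_def r_def
      using rho_direction_bound[of "1 + s" "s + b" t "t - x"] rho_minus[of "s + b" "t - x"] s A sb by simp
    also have "rho (s + b) (t - x) = r" using rho_minus[of "s + b" "t - x"] by (simp add: r_def)
    also have "2 * (\<bar>1 + s - (s + b)\<bar> + \<bar>t - (t - x)\<bar>) / r \<le> 2 * (1 + A + \<bar>x\<bar>) / m"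
    proof (rule frac_le)
      have "\<bar>1 + s - (s + b)\<bar> \<le> 1 + A" using b by linarith
      then show "2 * (\<bar>1 + s - (s + b)\<bar> + \<bar>t - (t - x)\<bar>) \<le> 2 * (1 + A + \<bar>x\<bar>)" by simp
    qed (use r m A in auto)
    finally have d: "\<bar>(1 + s) / rw - (s + b) / r\<bar> \<le> 2 * (1 + A + \<bar>x\<bar>) / m" .
    have "norm (\<i> * of_real (k * ((1 + s) / rw - (s + b) / r)) * (w * p)) =
        k * \<bar>(1 + s) / rw - (s + b) / r\<bar> * (norm w * norm p)"
      using k by (simp only: norm_mult norm_ii mult_1 norm_of_real abs_mult)
    also have "\<dots> \<le> k * (2 * (1 + A + \<bar>x\<bar>) / m) * (2 * C / m)"
      using d nwp k m A C by (intro mult_mono mult_left_mono) auto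
    also have "\<dots> = 4 * k * C * (1 + A + \<bar>x\<bar>) / m\<^sup>2" by (simp add: power2_eq_square)
    finally show ?thesis .
  qed
  \<comment> \<open>The three terms are the radiation defect of the wave, that of the kernel, and
    the mismatch of the two direction cosines.\<close>
  have "wave_b k (1 + s) t * P (s + b) (x - t) - wave k (1 + s) t * P_a (s + b) (x - t) =
     D * p - w * E + \<i> * of_real (k * ((1 + s) / rw - (s + b) / r)) * (w * p)"
    by (simp add: D_def E_def w_def p_def algebra_simps)
  also have "norm \<dots> \<le> norm (D * p) + norm (w * E) + norm (\<i> * of_real (k * ((1 + s) / rw - (s + b) / r)) * (w * p))"
    by (intro order_trans[OF norm_triangle_ineq] add_mono norm_triangle_ineq4) simp
  also have "\<dots> \<le> C / m\<^sup>2 + 4 * C / m\<^sup>2 + 4 * k * C * (1 + A + \<bar>x\<bar>) / m\<^sup>2"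
    by (intro add_mono t1 t2 t3)
  also have "\<dots> = (16 * k * C * (1 + A + \<bar>x\<bar>) + 20 * C) / s\<^sup>2"
    using m by (simp add: m_def power_divide add_divide_distrib[symmetric] algebra_simps)
  finally show ?thesis .
qed

text \<open>On the lateral sides no cancellation is used: the wave is of order
  \<open>T^(-1/2)\<close> and the kernel of order \<open>(s + b) T^(-3/2)\<close>, the height being
  small compared with the distance.\<close>

lemma boundary_flux_bound:
  assumes T: "\<bar>t\<bar> = T" "T \<ge> 2 * \<bar>x\<bar> + 2" and s: "s \<ge> 0" "s + b > 0"
  shows "norm (wave k (1 + s) t * (- P_y (s + b) (x - t)) - wave_t k (1 + s) t * P (s + b) (x - t))
     \<le> 16 * C * (k + 1) * (s + b) / T\<^sup>2"
proof -
  define m where "m = T / 2"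
  have m: "m \<ge> 1" using T by (simp add: m_def)
  have rw: "rho (1 + s) t \<ge> m" using rho_ge(2)[of t "1 + s"] T unfolding m_def by linarith
  have r: "rho (s + b) (x - t) \<ge> m" using rho_ge(2)[of "x - t" "s + b"] T unfolding m_def by linarith
  have r1: "rho (s + b) (x - t) \<ge> 1" using r m by simp
  have pw: "y powr (- q) \<le> m powr (- q)" if "y \<ge> m" "q \<ge> 0" for y q
    using that m by (intro powr_mono2') auto
  have mm: "m powr (- (1/2)) * m powr (- (3/2)) = 1 / m\<^sup>2"
    unfolding powr_add[symmetric] using m by (simp add: powr_minus_divide)
  have nw: "norm (wave k (1 + s) t) \<le> m powr (- (1/2))"
    using pw[OF rw, of "1/2"] s by (simp add: norm_wave)
  have nwt: "norm (wave_t k (1 + s) t) \<le> (k + 1) * m powr (- (1/2))"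
  proof -
    have "norm (wave_t k (1 + s) t) \<le> (k + 1) * norm (wave k (1 + s) t)"
      by (rule wave_bounds(3)) (use s k in auto)
    also have "\<dots> \<le> (k + 1) * m powr (- (1/2))" using nw k by (intro mult_left_mono) auto
    finally show ?thesis .
  qed
  have e: "2 * C * c * (s + b) * rho (s + b) (x - t) powr (- (3/2)) \<le> 2 * C * c * (s + b) * m powr (- (3/2))" if "c \<ge> 0" for c
    using pw[OF r, of "3/2"] C s that by (intro mult_left_mono) auto
  have np: "norm (P (s + b) (x - t)) \<le> 2 * C * (s + b) * m powr (- (3/2))"
    using order_trans[OF P_large(1)[OF s(2) r1]] e[of 1] by simp
  have npy: "norm (P_y (s + b) (x - t)) \<le> 2 * C * (k + 1) * (s + b) * m powr (- (3/2))"
    using order_trans[OF P_large(3)[OF s(2) r1]] e[of "k + 1"] k by simp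
  have "norm (wave k (1 + s) t * (- P_y (s + b) (x - t)) - wave_t k (1 + s) t * P (s + b) (x - t)) \<le>
     norm (wave k (1 + s) t) * norm (P_y (s + b) (x - t)) + norm (wave_t k (1 + s) t) * norm (P (s + b) (x - t))"
    by (rule order_trans[OF norm_triangle_ineq4]) (simp add: norm_mult)
  also have "\<dots> \<le> m powr (- (1/2)) * (2 * C * (k + 1) * (s + b) * m powr (- (3/2))) +
      (k + 1) * m powr (- (1/2)) * (2 * C * (s + b) * m powr (- (3/2)))"
    using nw nwt np npy k by (intro add_mono mult_mono) auto
  also have "\<dots> = 4 * C * (k + 1) * (s + b) * (m powr (- (1/2)) * m powr (- (3/2)))"
    by (simp add: algebra_simps)
  also have "\<dots> = 16 * C * (k + 1) * (s + b) / T\<^sup>2"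
    unfolding mm by (simp add: m_def power_divide)
  finally show ?thesis .
qed

text \<open>The flux through the segment at height \<open>s\<close> is carried to height \<open>R\<^sup>3\<close>, where the radiation
  condition makes it small, at the cost of the fluxes through the sides at \<open>\<plusminus> R\<^sup>4\<close>.\<close>

lemma flux_bound:
  assumes s: "0 < s" "s < A" and R: "R \<ge> 2 * A + 2" "R \<ge> 2 * \<bar>x\<bar> + 2"
  shows "norm (integral {- (R ^ 4)..R ^ 4} (\<lambda>t. wave_b k (1 + s) t * P (A - s) (x - t) - wave k (1 + s) t * P_a (A - s) (x - t)))
     \<le> (64 * C * (k + 1) + 2 * (16 * k * C * (1 + A + \<bar>x\<bar>) + 20 * C)) / R\<^sup>2"
proof -
  \<comment> \<open>Reflection across height \<open>s\<close>: the kernel \<open>P (A - y)\<close>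
    has its pole at height \<open>A\<close>, the reflected kernel \<open>P (y + b)\<close> at
    \<open>- b = 2 s - A < s\<close>. Both agree at \<open>y = s\<close>, and the reflected one is
    regular at all heights \<open>y >= s\<close>, so Green's identity can be applied up to the
    top.\<close>
  define b where "b = A - 2 * s"
  define K where "K = 16 * k * C * (1 + A + \<bar>x\<bar>) + 20 * C"
  define Q where "Q s = integral {- (R ^ 4)..R ^ 4} (\<lambda>t. wave_b k (1 + s) t * P (s + b) (x - t) - wave k (1 + s) t * P_a (s + b) (x - t))" for s
  have A: "A > 0" and b: "\<bar>b\<bar> \<le> A" and R1: "R \<ge> 1" using s R by (auto simp: b_def)
  have pR: "R \<le> R ^ 3" "R \<le> R ^ 4" using R1 by (auto intro: self_le_power)
  note G = helmholtz_mono[OF helmholtz_P[of b x], of "max (-1) (-b)"]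
  note W = helmholtz_mono[OF helmholtz_wave[of k], of "max (-1) (-b)"]
  have d: "(Q has_vector_derivative
      (wave k (1 + y) (R ^ 4) * (- P_y (y + b) (x - R ^ 4)) - wave_t k (1 + y) (R ^ 4) * P (y + b) (x - R ^ 4))
      - (wave k (1 + y) (- (R ^ 4)) * (- P_y (y + b) (x - - (R ^ 4))) - wave_t k (1 + y) (- (R ^ 4)) * P (y + b) (x - - (R ^ 4)))) (at y)"
    if "y \<ge> s" for y
    unfolding Q_def[abs_def]
    by (rule green_identity[OF W G]) (use that s R1 in \<open>auto simp: b_def\<close>)
  have "norm (Q s - Q (R ^ 3)) \<le> (64 * C * (k + 1) * R ^ 3 / R ^ 8) * \<bar>s - R ^ 3\<bar>"
  proof (rule vector_derivative_bound[of "{s..R ^ 3}", OF _ has_vector_derivative_at_within[OF d]])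
    fix y assume y: "y \<in> {s..R ^ 3}"
    then have y0: "y \<ge> 0" "y + b > 0" using s by (auto simp: b_def)
    have T: "R ^ 4 \<ge> 2 * \<bar>x\<bar> + 2" using R pR by linarith
    have B: "norm (wave k (1 + y) t * (- P_y (y + b) (x - t)) - wave_t k (1 + y) t * P (y + b) (x - t))
        \<le> 32 * C * (k + 1) * R ^ 3 / R ^ 8" if "\<bar>t\<bar> = R ^ 4" for t
    proof -
      have "norm (wave k (1 + y) t * (- P_y (y + b) (x - t)) - wave_t k (1 + y) t * P (y + b) (x - t))
        \<le> 16 * C * (k + 1) * (y + b) / (R ^ 4)\<^sup>2"
        by (rule boundary_flux_bound[OF that T y0])
      also have "\<dots> \<le> 16 * C * (k + 1) * (2 * R ^ 3) / (R ^ 4)\<^sup>2"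
        using y b R pR A C k by (intro divide_right_mono mult_left_mono) auto
      finally show ?thesis by (simp flip: power_mult)
    qed
    show "norm ((wave k (1 + y) (R ^ 4) * (- P_y (y + b) (x - R ^ 4)) - wave_t k (1 + y) (R ^ 4) * P (y + b) (x - R ^ 4))
      - (wave k (1 + y) (- (R ^ 4)) * (- P_y (y + b) (x - - (R ^ 4))) - wave_t k (1 + y) (- (R ^ 4)) * P (y + b) (x - - (R ^ 4))))
      \<le> 64 * C * (k + 1) * R ^ 3 / R ^ 8"
      using order_trans[OF norm_triangle_ineq4 add_mono[OF B[of "R ^ 4"] B[of "- (R ^ 4)"]]] R1 by simp
  qed (use s R pR in auto)
  also have "\<dots> \<le> (64 * C * (k + 1) * R ^ 3 / R ^ 8) * R ^ 3"
    using s R pR C k R1 by (intro mult_left_mono) auto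
  also have "\<dots> = 64 * C * (k + 1) / R\<^sup>2"
    using R1 by (simp add: field_simps flip: power_add)
  finally have 1: "norm (Q s - Q (R ^ 3)) \<le> 64 * C * (k + 1) / R\<^sup>2" .
  \<comment> \<open>The exponents 3 and 4 balance the two contributions: the sides give
    \<open>R^3 * R^3 / R^8\<close>, the top gives \<open>R^4 / R^6\<close>, both of order
    \<open>R^(-2)\<close>.\<close>
  have "norm (Q (R ^ 3)) \<le> K / (R ^ 3)\<^sup>2 * (R ^ 4 - - (R ^ 4))"
    unfolding Q_def
  proof (rule integral_bound)
    show "continuous_on {- (R ^ 4)..R ^ 4} (\<lambda>t. wave_b k (1 + R ^ 3) t * P (R ^ 3 + b) (x - t) - wave k (1 + R ^ 3) t * P_a (R ^ 3 + b) (x - t))"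
      using R pR b A by (intro continuous_intros) auto
    show "norm (wave_b k (1 + R ^ 3) t * P (R ^ 3 + b) (x - t) - wave k (1 + R ^ 3) t * P_a (R ^ 3 + b) (x - t)) \<le> K / (R ^ 3)\<^sup>2" for t
      unfolding K_def using R pR by (intro flux_density_bound[OF A b]) auto
  qed (use R1 in auto)
  also have "\<dots> = 2 * K / R\<^sup>2"
    using R1 by (simp add: field_simps flip: power_mult power_add)
  finally have 2: "norm (Q (R ^ 3)) \<le> 2 * K / R\<^sup>2" .
  have "norm (Q s) \<le> norm (Q s - Q (R ^ 3)) + norm (Q (R ^ 3))"
    by (metis diff_add_cancel norm_triangle_ineq)
  also have "\<dots> \<le> 64 * C * (k + 1) / R\<^sup>2 + 2 * K / R\<^sup>2" using 1 2 by linarith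
  finally have "norm (Q s) \<le> (64 * C * (k + 1) + 2 * K) / R\<^sup>2" by (simp add: add_divide_distrib)
  moreover have "s + b = A - s" by (simp add: b_def)
  ultimately show ?thesis unfolding Q_def K_def by simp
qed

end

context radiating_profile
begin

text \<open>The derivative in \<open>s\<close> of the truncated integral is the flux of
  \<open>flux_bound\<close>, hence of order \<open>R^(-2)\<close> for \<open>T = R^4\<close>. The
  mean value inequality bounds the difference of the truncated integrals by the same order, and
  \<open>R\<close> tends to infinity.\<close>

lemma poisson_wave_invariant:
  assumes s: "0 < s1" "s1 \<le> s2" "s2 < A"
  shows "(\<integral>t. P (A - s1) (x - t) * wave k (1 + s1) t \<partial>lborel) = (\<integral>t. P (A - s2) (x - t) * wave k (1 + s2) t \<partial>lborel)"
proof -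
  define n where "n T s = integral {-T..T} (\<lambda>t. P (A - s) (x - t) * wave k (1 + s) t)" for T s
  define N where "N s = (\<integral>t. P (A - s) (x - t) * wave k (1 + s) t \<partial>lborel)" for s
  define K where "K = 64 * C * (k + 1) + 2 * (16 * k * C * (1 + A + \<bar>x\<bar>) + 20 * C)"
  have lim: "((\<lambda>T. n T s) \<longlongrightarrow> N s) at_top" if "0 < s" "s < A" for s
    unfolding n_def N_def
  proof (rule integral_symmetric_Icc_tendsto, rule integrable_P_mult)
    have "continuous_on UNIV (\<lambda>t. wave k (1 + s) t)" by (intro continuous_intros) (use that in auto)
    then show "(\<lambda>t. wave k (1 + s) t) \<in> borel_measurable lborel"
      by (simp add: borel_measurable_continuous_onI)
    show "norm (wave k (1 + s) t) \<le> 1" for t by (rule wave_bounds(1)) (use that k in auto)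
  qed (use that in auto)
  have d: "(n T has_vector_derivative
      integral {-T..T} (\<lambda>t. wave_b k (1 + s) t * P (A - s) (x - t) - wave k (1 + s) t * P_a (A - s) (x - t))) (at s)"
    if "0 < s" "s < A" for T s
  proof -
    have "((\<lambda>s. integral (cbox (-T) T) (\<lambda>t. P (A - s) (x - t) * wave k (1 + s) t)) has_vector_derivative
      integral (cbox (-T) T) (\<lambda>t. wave_b k (1 + s) t * P (A - s) (x - t) - wave k (1 + s) t * P_a (A - s) (x - t))) (at s within {0<..<A})"
    proof (rule leibniz_rule_vector_derivative)
      fix y t assume y: "y \<in> {0<..<A}"
      have "((\<lambda>s::real. A - s) has_vector_derivative - 1) (at y)" "((\<lambda>s::real. 1 + s) has_vector_derivative 1) (at y)"
        by (auto intro!: derivative_eq_intros simp flip: has_real_derivative_iff_has_vector_derivative)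
      note c = vector_diff_chain_at[OF this(1) P_derivs(1)] vector_diff_chain_at[OF this(2) wave_derivs(1)]
      have "((\<lambda>s. P (A - s) (x - t) * wave k (1 + s) t) has_vector_derivative
          P (A - y) (x - t) * (1 *\<^sub>R wave_b k (1 + y) t) + (- 1 *\<^sub>R P_a (A - y) (x - t)) * wave k (1 + y) t) (at y)"
        by (rule has_vector_derivative_mult[OF c[unfolded o_def]]) (use y in auto)
      from has_vector_derivative_at_within[OF this]
      show "((\<lambda>s. P (A - s) (x - t) * wave k (1 + s) t) has_vector_derivative
          wave_b k (1 + y) t * P (A - y) (x - t) - wave k (1 + y) t * P_a (A - y) (x - t)) (at y within {0<..<A})"
        by (rule has_vector_derivative_eq_rhs) (simp add: mult.commute)
    next
      fix y assume "y \<in> {0<..<A}"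
      then show "(\<lambda>t. P (A - y) (x - t) * wave k (1 + y) t) integrable_on cbox (- T) T"
        by (intro integrable_continuous continuous_intros) auto
    next
      show "continuous_on ({0<..<A} \<times> cbox (- T) T)
        (\<lambda>(y, t). wave_b k (1 + y) t * P (A - y) (x - t) - wave k (1 + y) t * P_a (A - y) (x - t))"
        unfolding split_beta by (intro continuous_intros) auto
    qed (use that in auto)
    then show ?thesis using that by (simp add: at_within_open[of s "{0<..<A}"] n_def[abs_def])
  qed
  have bd: "norm (n (R ^ 4) s1 - n (R ^ 4) s2) \<le> K / R\<^sup>2 * \<bar>s1 - s2\<bar>"
    if "R \<ge> 2 * A + 2" "R \<ge> 2 * \<bar>x\<bar> + 2" for R
    by (rule vector_derivative_bound[of "{s1..s2}", OF _ has_vector_derivative_at_within[OF d]])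
       (use s flux_bound[OF _ _ that] in \<open>auto simp: K_def\<close>)
  have "norm (N s1 - N s2) \<le> 0"
  proof (rule tendsto_le)
    show "((\<lambda>R. K / R\<^sup>2 * \<bar>s1 - s2\<bar>) \<longlongrightarrow> 0) at_top" by real_asymp
    have R4: "filterlim (\<lambda>R::real. R ^ 4) at_top at_top" by real_asymp
    show "((\<lambda>R. norm (n (R ^ 4) s1 - n (R ^ 4) s2)) \<longlongrightarrow> norm (N s1 - N s2)) at_top"
      by (intro tendsto_intros filterlim_compose[OF lim R4]) (use s in auto)
    show "\<forall>\<^sub>F R in at_top. norm (n (R ^ 4) s1 - n (R ^ 4) s2) \<le> K / R\<^sup>2 * \<bar>s1 - s2\<bar>"
      using eventually_ge_at_top[of "2 * A + 2"] eventually_ge_at_top[of "2 * \<bar>x\<bar> + 2"]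
      by eventually_elim (rule bd)
  qed simp
  then show ?thesis by (simp add: N_def)
qed

text \<open>Dominated convergence as the height \<open>s = a / (n + 2)\<close> tends to 0. As
  \<open>s <= a / 2\<close>, all distances are at least those at height \<open>a / 2\<close>, so a
  single integrable bound serves every \<open>n\<close>.\<close>

lemma poisson_wave_boundary_limit:
  assumes a: "a > 0"
  shows "(\<lambda>n. \<integral>t. P (a - a / real (n + 2)) (x - t) * wave k (1 + a / real (n + 2)) t \<partial>lborel)
     \<longlonglongrightarrow> (\<integral>t. P a (x - t) * wave k 1 t \<partial>lborel)"
proof (rule integral_dominated_convergence)
  let ?s = "\<lambda>n. a / real (n + 2)"
  have s: "0 < ?s n" "?s n \<le> a / 2" for n using a by (auto simp: field_simps)
  have meas: "(\<lambda>t. P c (x - t) * wave k b t) \<in> borel_measurable lborel" if "c > 0" "b > 0" for c b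
  proof -
    have "continuous_on UNIV (\<lambda>t. P c (x - t) * wave k b t)" by (intro continuous_intros) (use that in auto)
    then show ?thesis by (simp add: borel_measurable_continuous_onI)
  qed
  show "(\<lambda>t. P a (x - t) * wave k 1 t) \<in> borel_measurable lborel" using a by (intro meas) auto
  show "(\<lambda>t. P (a - ?s n) (x - t) * wave k (1 + ?s n) t) \<in> borel_measurable lborel" for n
  proof (rule meas)
    show "a - ?s n > 0" "1 + ?s n > 0" using s[of n] a by linarith+
  qed
  show "integrable lborel (\<lambda>t. C * a * (rho (a / 2) (x - t) powr (- 2) + rho (a / 2) (x - t) powr (- (3/2))))"
    using a by (intro integrable_mult_right Bochner_Integration.integrable_add rho_powr_integral) auto
  have slim: "?s \<longlonglongrightarrow> 0" by real_asymp
  show "AE t in lborel. (\<lambda>n. P (a - ?s n) (x - t) * wave k (1 + ?s n) t) \<longlonglongrightarrow> P a (x - t) * wave k 1 t"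
  proof (rule AE_I2, rule tendsto_mult)
    fix t
    have "(\<lambda>n. a - ?s n) \<longlonglongrightarrow> a - 0" "(\<lambda>n. 1 + ?s n) \<longlonglongrightarrow> 1 + 0"
      by (intro tendsto_diff tendsto_add tendsto_const slim)+
    then show "(\<lambda>n. P (a - ?s n) (x - t)) \<longlonglongrightarrow> P a (x - t)" "(\<lambda>n. wave k (1 + ?s n) t) \<longlonglongrightarrow> wave k 1 t"
      using isCont_tendsto_compose[OF has_vector_derivative_continuous[OF P_derivs(1)[OF a]]]
        isCont_tendsto_compose[OF has_vector_derivative_continuous[OF wave_derivs(1)[of 1 k t]]] by auto
  qed
  show "AE t in lborel. norm (P (a - ?s n) (x - t) * wave k (1 + ?s n) t) \<le>
      C * a * (rho (a / 2) (x - t) powr (- 2) + rho (a / 2) (x - t) powr (- (3/2)))" for n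
  proof (rule AE_I2)
    fix t
    have c: "a - ?s n > 0" "a - ?s n \<ge> a / 2" "a - ?s n \<le> a" using s[of n] a by linarith+
    have r: "rho (a / 2) (x - t) \<le> rho (a - ?s n) (x - t)" "rho (a / 2) (x - t) > 0"
      using c a by (auto simp: rho_def add_pos_nonneg intro!: power_mono)
    have "norm (P (a - ?s n) (x - t) * wave k (1 + ?s n) t) \<le> norm (P (a - ?s n) (x - t)) * 1"
      unfolding norm_mult by (intro mult_left_mono wave_bounds(1)) (use s[of n] k in auto)
    also have "\<dots> \<le> C * (a - ?s n) * (rho (a - ?s n) (x - t) powr (- 2) + rho (a - ?s n) (x - t) powr (- (3/2)))"
      using P_bound[OF c(1)] by simp
    also have "\<dots> \<le> C * a * (rho (a / 2) (x - t) powr (- 2) + rho (a / 2) (x - t) powr (- (3/2)))"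
      using c r C by (intro mult_mono add_mono powr_mono2' mult_nonneg_nonneg add_nonneg_nonneg) auto
    finally show "norm (P (a - ?s n) (x - t) * wave k (1 + ?s n) t) \<le>
      C * a * (rho (a / 2) (x - t) powr (- 2) + rho (a / 2) (x - t) powr (- (3/2)))" .
  qed
qed

text \<open>\<open>P e\<close> is an approximate identity. After \<open>t = x - e * v\<close> it
  becomes \<open>rho 1 v powr (- 2)\<close> times \<open>y^2 h(y)\<close> with
  \<open>y = e * rho 1 v\<close>; by \<open>h_zero\<close> the limit is
  \<open>1 / (pi (1 + v^2))\<close>, which has integral 1.\<close>

lemma poisson_wave_interior_limit:
  assumes a: "a > 0"
  shows "((\<lambda>e. \<integral>t. P e (x - t) * wave k (1 + (a - e)) t \<partial>lborel) \<longlongrightarrow> wave k (1 + a) x) (at_right 0)"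
proof -
  let ?f = "\<lambda>e v. of_real e * P e (e * v) * wave k (1 + (a - e)) (x - e * v)"
  have sub: "(\<integral>t. P e (x - t) * wave k (1 + (a - e)) t \<partial>lborel) = (\<integral>v. ?f e v \<partial>lborel)" if "e > 0" for e
    using lborel_integral_real_affine[of "- e" "\<lambda>t. P e (x - t) * wave k (1 + (a - e)) t" x] that
    by (simp add: scaleR_conv_of_real mult.assoc flip: integral_mult_right_zero)
  have fe: "of_real e * P e (e * v) = of_real (rho 1 v powr (- 2)) * (of_real ((e * rho 1 v)\<^sup>2) * h (e * rho 1 v))"
    if e: "e > 0" for e v
  proof -
    have r: "rho 1 v > 0" by (rule rho_pos) simp
    have "rho 1 v powr (- 2) * (e * rho 1 v)\<^sup>2 = e * e"
      using r by (simp add: powr_minus_divide power2_eq_square)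
    then have "complex_of_real (rho 1 v powr (- 2)) * of_real ((e * rho 1 v)\<^sup>2) = of_real e * of_real e"
      by (simp only: of_real_mult[symmetric])
    then show ?thesis unfolding P_def rho_scale[OF e] by (simp only: mult.assoc[symmetric])
  qed
  \<comment> \<open>In \<open>min a 1\<close> the entry \<open>a\<close> keeps the wave in the half
    plane, and 1 gives \<open>y <= rho 1 v\<close>, from which the dominating function is
    obtained.\<close>
  have "(\<lambda>n. \<integral>v. ?f (X n) v \<partial>lborel) \<longlonglongrightarrow> (\<integral>v. of_real (rho 1 v powr (- 2)) * of_real (1 / pi) * wave k (1 + a) x \<partial>lborel)"
    if X: "\<And>n. X n \<in> {0<..<min a 1}" "X \<longlonglongrightarrow> 0" for X
  proof (rule integral_dominated_convergence)
    show "(\<lambda>v. complex_of_real (rho 1 v powr (- 2)) * of_real (1 / pi) * wave k (1 + a) x) \<in> borel_measurable lborel"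
      using borel_measurable_integrable[OF integral_inverse_rho_square(1)] by measurable
    show "?f (X n) \<in> borel_measurable lborel" for n
    proof -
      have "continuous_on UNIV (?f (X n))" by (intro continuous_intros) (use X(1)[of n] in auto)
      then show ?thesis by (simp add: borel_measurable_continuous_onI)
    qed
    show "integrable lborel (\<lambda>v. 2 * C * rho 1 v powr (- (3/2)))"
      by (intro integrable_mult_right integrable_rho_powr) simp
    show "AE v in lborel. (\<lambda>n. ?f (X n) v) \<longlonglongrightarrow> of_real (rho 1 v powr (- 2)) * of_real (1 / pi) * wave k (1 + a) x"
    proof (rule AE_I2, rule tendsto_mult)
      fix v
      have r: "rho 1 v > 0" by (rule rho_pos) simp
      have "filterlim (\<lambda>n. X n * rho 1 v) (at_right 0) sequentially"
        unfolding filterlim_at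
      proof (intro conjI always_eventually allI)
        fix n
        have p: "X n * rho 1 v > 0" using X(1)[of n] r by simp
        show "X n * rho 1 v \<in> {0<..}" using p by (simp only: greaterThan_iff)
        show "X n * rho 1 v \<noteq> 0" using p by linarith
        show "(\<lambda>n. X n * rho 1 v) \<longlonglongrightarrow> 0" using tendsto_mult[OF X(2) tendsto_const[of "rho 1 v"]] by simp
      qed
      from filterlim_compose[OF h_zero this]
      have "(\<lambda>n. complex_of_real (rho 1 v powr (- 2)) * (of_real ((X n * rho 1 v)\<^sup>2) * h (X n * rho 1 v)))
         \<longlonglongrightarrow> of_real (rho 1 v powr (- 2)) * of_real (1 / pi)"
        by (intro tendsto_mult tendsto_const)
      moreover have "complex_of_real (rho 1 v powr (- 2)) * (of_real ((X n * rho 1 v)\<^sup>2) * h (X n * rho 1 v)) =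
          of_real (X n) * P (X n) (X n * v)" for n using X(1)[of n] by (subst fe) auto
      ultimately show "(\<lambda>n. of_real (X n) * P (X n) (X n * v)) \<longlonglongrightarrow> of_real (rho 1 v powr (- 2)) * of_real (1 / pi)"
        by (simp only:)
      have "continuous_on {..<1 + a} (\<lambda>e. wave k (1 + (a - e)) (x - e * v))" by (intro continuous_intros) auto
      then have "isCont (\<lambda>e. wave k (1 + (a - e)) (x - e * v)) 0"
        using a by (subst (asm) continuous_on_eq_continuous_at) auto
      from isCont_tendsto_compose[OF this X(2)]
      show "(\<lambda>n. wave k (1 + (a - X n)) (x - X n * v)) \<longlonglongrightarrow> wave k (1 + a) x" by simp
    qed
    show "AE v in lborel. norm (?f (X n) v) \<le> 2 * C * rho 1 v powr (- (3/2))" for n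
    proof (rule AE_I2)
      fix v
      have e: "X n > 0" "X n \<le> 1" "X n < a" using X(1)[of n] by auto
      have r: "rho 1 v \<ge> 1" using rho_ge(1)[of 1 v] by simp
      define y where "y = X n * rho 1 v"
      have y: "y > 0" "y \<le> rho 1 v" using e r by (auto simp: y_def mult_le_cancel_right1)
      have "y\<^sup>2 * norm (h y) \<le> y\<^sup>2 * (C * (y powr (- 2) + y powr (- (3/2))))"
        by (intro mult_left_mono h_bound y) simp
      also have "\<dots> = C * (y powr 2 * y powr (- 2) + y powr 2 * y powr (- (3/2)))"
        using y by (simp add: algebra_simps)
      also have "\<dots> = C * (1 + y powr (1/2))" unfolding powr_add[symmetric] using y by simp
      also have "\<dots> \<le> C * (rho 1 v powr (1/2) + rho 1 v powr (1/2))"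
        using y r C by (intro mult_left_mono add_mono powr_mono2 ge_one_powr_ge_zero) auto
      finally have 1: "y\<^sup>2 * norm (h y) \<le> 2 * C * rho 1 v powr (1/2)" by simp
      have "norm (?f (X n) v) = rho 1 v powr (- 2) * (y\<^sup>2 * norm (h y)) * norm (wave k (1 + (a - X n)) (x - X n * v))"
        unfolding fe[OF e(1)] y_def[symmetric] by (simp add: norm_mult norm_power)
      also have "\<dots> \<le> rho 1 v powr (- 2) * (2 * C * rho 1 v powr (1/2)) * 1"
        by (rule mult_mono[OF mult_left_mono[OF 1] wave_bounds(1)]) (use e k C in auto)
      also have "\<dots> = 2 * C * (rho 1 v powr (- 2) * rho 1 v powr (1/2))" by simp
      also have "\<dots> = 2 * C * rho 1 v powr (- (3/2))" unfolding powr_add[symmetric] by simp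
      finally show "norm (?f (X n) v) \<le> 2 * C * rho 1 v powr (- (3/2))" .
    qed
  qed
  moreover have "(\<integral>v. complex_of_real (rho 1 v powr (- 2)) * of_real (1 / pi) * wave k (1 + a) x \<partial>lborel) = wave k (1 + a) x"
    unfolding mult.assoc integral_mult_left_zero integral_complex_of_real integral_inverse_rho_square(2) by simp
  ultimately have lim: "(\<lambda>n. \<integral>v. ?f (X n) v \<partial>lborel) \<longlonglongrightarrow> wave k (1 + a) x"
    if "\<And>n. X n \<in> {0<..<min a 1}" "X \<longlonglongrightarrow> 0" for X using that by simp
  have lim0: "((\<lambda>e. \<integral>v. ?f e v \<partial>lborel) \<longlongrightarrow> wave k (1 + a) x) (at 0 within {0<..<min a 1})"
    unfolding tendsto_at_iff_sequentially comp_def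
  proof (intro allI impI)
    fix X assume "\<forall>i. X i \<in> {0<..<min a 1} - {0}" "X \<longlonglongrightarrow> 0"
    then show "(\<lambda>i. \<integral>v. ?f (X i) v \<partial>lborel) \<longlonglongrightarrow> wave k (1 + a) x" by (intro lim) auto
  qed
  then have "((\<lambda>e. \<integral>v. ?f e v \<partial>lborel) \<longlongrightarrow> wave k (1 + a) x) (at_right 0)"
  proof -
    have "at 0 within {0<..<min a 1} = at_right (0::real)"
      using a by (intro at_within_nhd[of _ "{..<min a 1}"]) auto
    with lim0 show ?thesis by (simp only:)
  qed
  then show ?thesis
    by (rule Lim_transform_eventually) (rule eventually_mono[OF eventually_at_right_less], rule sub[symmetric])
qed

text \<open>\<open>N\<close> is constant on \<open>(0, a)\<close>. Its limit at 0 is the potential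
  of the boundary values, and its limit at \<open>a\<close>, where the kernel concentrates at
  \<open>x\<close>, is the wave itself.\<close>

theorem poisson_wave:
  assumes a: "a > 0"
  shows "(\<integral>t. P a (x - t) * wave k 1 t \<partial>lborel) = wave k (1 + a) x"
proof -
  define N where "N s = (\<integral>t. P (a - s) (x - t) * wave k (1 + s) t \<partial>lborel)" for s
  have const: "N s = N (a / 2)" if "0 < s" "s < a" for s
    using poisson_wave_invariant[of s "a / 2" a x] poisson_wave_invariant[of "a / 2" s a x] that
    unfolding N_def by (cases "s \<le> a / 2") auto
  have "(\<lambda>n. N (a / real (n + 2))) \<longlonglongrightarrow> (\<integral>t. P a (x - t) * wave k 1 t \<partial>lborel)"
    unfolding N_def by (rule poisson_wave_boundary_limit[OF a])
  moreover have "N (a / real (n + 2)) = N (a / 2)" for n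
    using a by (intro const) (auto simp: field_simps add_pos_nonneg)
  ultimately have 1: "(\<integral>t. P a (x - t) * wave k 1 t \<partial>lborel) = N (a / 2)"
    by (simp add: LIMSEQ_const_iff)
  have "\<forall>\<^sub>F e in at_right 0. (\<integral>t. P e (x - t) * wave k (1 + (a - e)) t \<partial>lborel) = N (a / 2)"
    unfolding eventually_at_right_field
  proof (intro exI[of _ a] conjI allI impI)
    fix e assume "0 < e" "e < a"
    then show "(\<integral>t. P e (x - t) * wave k (1 + (a - e)) t \<partial>lborel) = N (a / 2)"
      using const[of "a - e"] by (simp add: N_def)
  qed (rule a)
  from Lim_transform_eventually[OF poisson_wave_interior_limit[OF a] this]
  have "((\<lambda>e::real. N (a / 2)) \<longlongrightarrow> wave k (1 + a) x) (at_right 0)" .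
  then have "N (a / 2) = wave k (1 + a) x" by (rule tendsto_unique[OF _ tendsto_const, rotated]) simp
  with 1 show ?thesis by simp
qed

lemma poisson_wave_reflected:
  assumes a: "a > 0"
  shows "(\<integral>t. P a (x - t) * wave k 1 (- t) \<partial>lborel) = wave k (1 + a) (- x)"
proof -
  have "(\<integral>t. P a (x - t) * wave k 1 (- t) \<partial>lborel) = (\<integral>t. P a (x + t) * wave k 1 t \<partial>lborel)"
    using lborel_integral_real_affine[of "- 1" "\<lambda>t. P a (x - t) * wave k 1 (- t)" 0] by simp
  also have "\<dots> = (\<integral>t. P a (- x - t) * wave k 1 t \<partial>lborel)"
  proof -
    have "P a (x + t) = P a (- x - t)" for t using P_minus[of a "x + t"] by simp
    then show ?thesis by (simp only:)
  qed
  finally show ?thesis using poisson_wave[OF a, of "- x"] by simp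
qed

end

section \<open>Potentials of integrable densities\<close>

context radiating_profile
begin

definition potential :: "(real \<Rightarrow> complex) \<Rightarrow> real \<Rightarrow> real \<Rightarrow> complex" where
  "potential f a x = (\<integral>t. P a (x - t) * f t \<partial>lborel)"

definition P_total :: real where
  "P_total = C * (pi + (\<integral>v. rho 1 v powr (- (3/2)) \<partial>lborel))"

lemma P_total_nonneg: "P_total \<ge> 0"
  unfolding P_total_def using C by (intro mult_nonneg_nonneg add_nonneg_nonneg integral_nonneg_AE) auto

text \<open>The singular part \<open>a / rho^2\<close> has an integral independent of
  \<open>a\<close>; the tail \<open>a * rho powr (- (3/2))\<close> scales like
  \<open>sqrt a\<close>. This growth is the reason why more than integrability is asked of the
  density far out.\<close>

lemma integral_norm_P_le:
  assumes a: "a > 0"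
  shows "(\<integral>t. norm (P a (x - t)) \<partial>lborel) \<le> P_total * (1 + sqrt a)"
proof -
  let ?I = "\<integral>v. rho 1 v powr (- (3/2)) \<partial>lborel"
  have "(\<integral>t. norm (P a (x - t)) \<partial>lborel) \<le>
      (\<integral>t. C * a * (rho a (x - t) powr (- 2) + rho a (x - t) powr (- (3/2))) \<partial>lborel)"
    by (intro integral_mono integrable_norm integrable_P a integrable_mult_right
        Bochner_Integration.integrable_add rho_powr_integral P_bound) auto
  also have "\<dots> = C * (a * (a powr (1 - 2) * pi) + a * (a powr (1 - 3/2) * ?I))"
    using rho_powr_integral[OF _ a, of 2 x] rho_powr_integral[OF _ a, of "3/2" x] integral_inverse_rho_square(2)
    by (simp add: distrib_left)
  also have "a * (a powr (1 - 2) * pi) = pi" using a by (simp add: powr_minus_divide)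
  also have "a * (a powr (1 - 3/2) * ?I) = sqrt a * ?I"
  proof -
    have "a powr 1 * a powr (1 - 3/2) = sqrt a" unfolding powr_add[symmetric] using a by (simp add: powr_half_sqrt)
    then show ?thesis using a by simp
  qed
  also have "C * (pi + sqrt a * ?I) \<le> P_total * (1 + sqrt a)"
  proof -
    have "?I \<ge> 0" by (intro integral_nonneg_AE) auto
    then show ?thesis using C a by (simp add: P_total_def algebra_simps)
  qed
  finally show ?thesis .
qed

lemma potential_bounded_density:
  assumes a: "a > 0" and f: "f \<in> borel_measurable lborel" and M: "\<And>t. norm (f t) \<le> M"
  shows "norm (potential f a x) \<le> M * P_total * (1 + sqrt a)"
proof -
  have M0: "M \<ge> 0" using M[of 0] norm_ge_zero order_trans by blast
  have "norm (potential f a x) \<le> (\<integral>t. norm (P a (x - t) * f t) \<partial>lborel)"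
    unfolding potential_def by (rule integral_norm_bound)
  also have "\<dots> \<le> (\<integral>t. M * norm (P a (x - t)) \<partial>lborel)"
    by (intro integral_mono integrable_norm integrable_mult_right integrable_P integrable_P_mult[OF a f M] a)
       (use M in \<open>simp add: norm_mult mult.commute mult_right_mono\<close>)
  also have "\<dots> \<le> M * (P_total * (1 + sqrt a))"
    unfolding integral_mult_right_zero by (intro mult_left_mono integral_norm_P_le a M0)
  finally show ?thesis by (simp add: mult.assoc)
qed

end

text \<open>\<open>\<psi>\<close> stands for the data minus the matched boundary values.
  \<open>q > 1\<close> makes it integrable; the cap 3/2 is the order to which the boundary values of
  the wave follow their leading term.\<close>

locale radiating_density = radiating_profile +
  fixes \<psi> :: "real \<Rightarrow> complex" and q M :: real
  assumes q: "1 < q" "q \<le> 3 / 2" and M: "M > 0"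
    and \<psi>_cont: "continuous_on UNIV \<psi>"
    and \<psi>_bound: "\<And>t. norm (\<psi> t) \<le> M * (1 + \<bar>t\<bar>) powr (- q)"
begin

lemma \<psi>_meas: "\<psi> \<in> borel_measurable lborel"
  using \<psi>_cont by (simp add: borel_measurable_continuous_onI)

lemma \<psi>_integrable: "integrable lborel \<psi>"
  by (rule Bochner_Integration.integrable_bound[OF integrable_mult_right[OF integrable_decay[OF q(1)], of M] \<psi>_meas])
     (use \<psi>_bound M in \<open>auto intro!: AE_I2\<close>)

lemma \<psi>_le: "norm (\<psi> t) \<le> M"
proof -
  have "(1 + \<bar>t\<bar>) powr (- q) \<le> 1 powr (- q)" using q by (intro powr_mono2') auto
  then have "M * (1 + \<bar>t\<bar>) powr (- q) \<le> M" using M by simp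
  then show ?thesis using \<psi>_bound[of t] by linarith
qed

lemma \<psi>_far:
  assumes "\<bar>t\<bar> \<ge> R / 2" "R > 0"
  shows "norm (\<psi> t) \<le> 4 * M * R powr (- q)"
proof -
  have "(1 + \<bar>t\<bar>) powr (- q) \<le> (R / 2) powr (- q)" using q assms by (intro powr_mono2') auto
  also have "\<dots> = 2 powr q * R powr (- q)" using assms by (simp add: powr_divide powr_minus field_simps)
  also have "\<dots> \<le> 2 powr 2 * R powr (- q)" using q by (intro mult_right_mono powr_mono) auto
  finally have "M * (1 + \<bar>t\<bar>) powr (- q) \<le> M * (4 * R powr (- q))" using M by (intro mult_left_mono) auto
  then show ?thesis using \<psi>_bound[of t] by linarith
qed

lemma integrable_P_\<psi>: "a > 0 \<Longrightarrow> integrable lborel (\<lambda>t. P a (x - t) * \<psi> t)"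
  by (rule integrable_P_mult[OF _ \<psi>_meas \<psi>_le])

text \<open>For \<open>|t| <= R / 2\<close> the kernel is at most of order
  \<open>R * R^(-3/2)\<close> and \<open>\<psi>\<close> is integrable. For larger \<open>|t|\<close>
  the density is at most of order \<open>R^(-q)\<close> while the kernel has L1 norm of order
  \<open>R^(1/2)\<close>, and \<open>1/2 - q <= - 1/2\<close>.\<close>

lemma potential_decay_far:
  obtains K where "K > 0" "\<And>a x. a > 0 \<Longrightarrow> rho a x \<ge> 1 \<Longrightarrow> norm (potential \<psi> a x) \<le> K * rho a x powr (- (1/2))"
proof -
  define J where "J = (\<integral>t. norm (\<psi> t) \<partial>lborel)"
  define K where "K = 1 + 8 * C * J + 8 * M * P_total"
  have J: "J \<ge> 0" unfolding J_def by (intro integral_nonneg_AE) auto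
  show ?thesis
  proof
    show "K > 0" using J C M P_total_nonneg by (simp add: K_def add_pos_nonneg)
    fix a x :: real assume a: "a > 0" and R1: "rho a x \<ge> 1"
    define R where "R = rho a x"
    have R: "R \<ge> 1" "a \<le> R" using R1 rho_ge(1)[of a x] a by (auto simp: R_def)
    have near: "norm (P a (x - t)) \<le> 8 * C * R powr (- (1/2))" if t: "\<bar>t\<bar> \<le> R / 2" for t
    proof -
      have r: "rho a (x - t) \<ge> R / 2" using rho_triangle[of a x a "x - t"] t unfolding R_def by simp
      have "norm (P a (x - t)) \<le> C * a * (rho a (x - t) powr (- 2) + rho a (x - t) powr (- (3/2)))"
        by (rule P_bound[OF a])
      also have "\<dots> \<le> C * R * ((R / 2) powr (- 2) + (R / 2) powr (- (3/2)))"
        using C a R r by (intro mult_mono add_mono powr_mono2') auto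
      also have "\<dots> \<le> C * R * (4 * R powr (- (3/2)) + 4 * R powr (- (3/2)))"
      proof (intro mult_left_mono add_mono)
        have "(R / 2) powr (- 2) = 4 * R powr (- 2)" using R by (simp add: powr_divide powr_minus field_simps)
        also have "\<dots> \<le> 4 * R powr (- (3/2))" using R by (intro mult_left_mono powr_mono) auto
        finally show "(R / 2) powr (- 2) \<le> 4 * R powr (- (3/2))" .
        have "(R / 2) powr (- (3/2)) = 2 powr (3/2) * R powr (- (3/2))"
          using R by (simp add: powr_divide powr_minus field_simps)
        also have "\<dots> \<le> 2 powr 2 * R powr (- (3/2))" by (intro mult_right_mono powr_mono) auto
        finally show "(R / 2) powr (- (3/2)) \<le> 4 * R powr (- (3/2))" by simp
      qed (use C R in auto)
      also have "\<dots> = 8 * C * (R powr 1 * R powr (- (3/2)))" using R by simp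
      also have "\<dots> = 8 * C * R powr (- (1/2))" unfolding powr_add[symmetric] by simp
      finally show ?thesis .
    qed
    have pt: "norm (P a (x - t) * \<psi> t) \<le> 8 * C * R powr (- (1/2)) * norm (\<psi> t) + 4 * M * R powr (- q) * norm (P a (x - t))" for t
    proof (cases "\<bar>t\<bar> \<le> R / 2")
      case True
      have "norm (P a (x - t)) * norm (\<psi> t) \<le> 8 * C * R powr (- (1/2)) * norm (\<psi> t)"
        by (intro mult_right_mono near True) simp
      then show ?thesis using M by (simp add: norm_mult add_increasing2)
    next
      case False
      have "norm (P a (x - t)) * norm (\<psi> t) \<le> norm (P a (x - t)) * (4 * M * R powr (- q))"
        using False R by (intro mult_left_mono \<psi>_far) auto
      then show ?thesis using C by (simp add: norm_mult add_increasing mult.commute)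
    qed
    have "norm (potential \<psi> a x) \<le> (\<integral>t. norm (P a (x - t) * \<psi> t) \<partial>lborel)"
      unfolding potential_def by (rule integral_norm_bound)
    also have "\<dots> \<le> (\<integral>t. 8 * C * R powr (- (1/2)) * norm (\<psi> t) + 4 * M * R powr (- q) * norm (P a (x - t)) \<partial>lborel)"
      by (intro integral_mono integrable_norm integrable_P_\<psi> a Bochner_Integration.integrable_add
          integrable_mult_right \<psi>_integrable integrable_P pt)
    also have "\<dots> = 8 * C * R powr (- (1/2)) * J + 4 * M * R powr (- q) * (\<integral>t. norm (P a (x - t)) \<partial>lborel)"
      using \<psi>_integrable integrable_P[OF a, of x] by (simp add: J_def)
    also have "\<dots> \<le> 8 * C * R powr (- (1/2)) * J + 4 * M * R powr (- q) * (P_total * (2 * R powr (1/2)))"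
    proof (intro add_left_mono mult_left_mono)
      have "1 + sqrt a \<le> 2 * R powr (1/2)"
      proof -
        have "sqrt a \<le> sqrt R" "1 \<le> sqrt R" using R by auto
        moreover have "R powr (1/2) = sqrt R" using R by (simp add: powr_half_sqrt)
        ultimately show ?thesis by linarith
      qed
      then show "(\<integral>t. norm (P a (x - t)) \<partial>lborel) \<le> P_total * (2 * R powr (1/2))"
        using integral_norm_P_le[OF a, of x] mult_left_mono[OF _ P_total_nonneg] order_trans by blast
    qed (use M in auto)
    also have "\<dots> = 8 * C * J * R powr (- (1/2)) + 8 * M * P_total * (R powr (- q) * R powr (1/2))"
      by simp
    also have "\<dots> \<le> 8 * C * J * R powr (- (1/2)) + 8 * M * P_total * R powr (- (1/2))"
    proof (intro add_left_mono mult_left_mono)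
      show "R powr (- q) * R powr (1/2) \<le> R powr (- (1/2))"
        unfolding powr_add[symmetric] using R q by (intro powr_mono) auto
    qed (use M P_total_nonneg in auto)
    also have "\<dots> \<le> K * R powr (- (1/2))" by (simp add: K_def algebra_simps)
    finally show "norm (potential \<psi> a x) \<le> K * rho a x powr (- (1/2))" by (simp add: R_def)
  qed
qed

text \<open>The derivative in \<open>r\<close> of \<open>P (r * c) (r * s - t)\<close> along the
  unit direction \<open>(c, s)\<close>. The quotient \<open>(r - t * s) / rho\<close> is the cosine
  of the angle between this ray and the segment from \<open>(0, t)\<close>.\<close>

definition ray_flux :: "real \<Rightarrow> real \<Rightarrow> real \<Rightarrow> real \<Rightarrow> complex" where
  "ray_flux c s r t = of_real c * h (rho (r * c) (r * s - t)) +
     of_real (r * c * ((r - t * s) / rho (r * c) (r * s - t))) * h' (rho (r * c) (r * s - t))"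

text \<open>\<open>r - t * s\<close> is the projection of the vector from \<open>(0, t)\<close> to
  the point onto the ray; the identity with \<open>(t * c)^2\<close> is Pythagoras.\<close>

lemma ray_direction:
  assumes "c\<^sup>2 + s\<^sup>2 = 1"
  shows "\<bar>r - t * s\<bar> \<le> rho (r * c) (r * s - t)"
proof -
  have "(rho (r * c) (r * s - t))\<^sup>2 = (r - t * s)\<^sup>2 + (t * c)\<^sup>2"
  proof -
    have "(r * c) * (r * c) + (r * s - t) * (r * s - t) - ((r - t * s)\<^sup>2 + (t * c)\<^sup>2) = (c\<^sup>2 + s\<^sup>2 - 1) * (r\<^sup>2 - t\<^sup>2)"
      by (simp add: algebra_simps power2_eq_square)
    then show ?thesis unfolding power2_eq_square[of "rho _ _"] rho_square using assms by simp
  qed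
  then have "(r - t * s)\<^sup>2 \<le> (rho (r * c) (r * s - t))\<^sup>2" by simp
  then show ?thesis using abs_le_square_iff[of "r - t * s" "rho (r * c) (r * s - t)"] rho_ge(3)[of "r * c" "r * s - t"] by simp
qed

lemma P_along_ray:
  assumes cs: "c\<^sup>2 + s\<^sup>2 = 1" and c: "c > 0" and r: "r > 0"
  shows "((\<lambda>r. P (r * c) (r * s - t)) has_vector_derivative ray_flux c s r t) (at r)"
proof -
  have rc: "r * c > 0" using c r by simp
  then have p: "rho (r * c) (r * s - t) > 0" by (intro rho_pos) auto
  have d: "((\<lambda>r. r * c) has_real_derivative c) (at r)" "((\<lambda>r. r * s - t) has_real_derivative s) (at r)"
    by (auto intro!: derivative_eq_intros)
  have "r * c * c + (r * s - t) * s = r * (c\<^sup>2 + s\<^sup>2) - t * s" by (simp add: algebra_simps power2_eq_square)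
  then have e: "r * c * c + (r * s - t) * s = r - t * s" using cs by simp
  note dr = rho_curve_deriv[OF d rc, unfolded e]
  have "((\<lambda>r. of_real (r * c) * h (rho (r * c) (r * s - t))) has_vector_derivative
     of_real (r * c) * (of_real ((r - t * s) / rho (r * c) (r * s - t)) * h' (rho (r * c) (r * s - t))) + of_real c * h (rho (r * c) (r * s - t))) (at r)"
    by (rule has_vector_derivative_mult[OF has_vector_derivative_of_real[OF d(1)] h_chain(1)[OF dr p]])
  then show ?thesis
    unfolding P_def ray_flux_def by (rule has_vector_derivative_eq_rhs) (simp add: mult.assoc)
qed

text \<open>For radii within \<open>r / 2\<close> of \<open>r\<close> the height stays above
  \<open>m = r * c / 2\<close>, so \<open>h\<close> and \<open>h'\<close> are bounded there
  uniformly in \<open>t\<close>, and a multiple of \<open>norm (\<psi> t)\<close> dominates.\<close>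

lemma potential_along_ray:
  assumes cs: "c\<^sup>2 + s\<^sup>2 = 1" and c: "c > 0" and r: "r > 0"
  shows "integrable lborel (\<lambda>t. ray_flux c s r t * \<psi> t)"
    and "((\<lambda>r. potential \<psi> (r * c) (r * s)) has_vector_derivative (\<integral>t. ray_flux c s r t * \<psi> t \<partial>lborel)) (at r)"
proof -
  define m where "m = r * c / 2"
  have m: "m > 0" using c r by (simp add: m_def)
  define B where "B = C * (m powr (- 2) + m powr (- (3/2)))"
  define B' where "B' = C * (m powr (- 3) + m powr (- (5/2))) + k * B"
  have c1: "c \<le> 1" using cs c by (smt (verit) power2_le_imp_le zero_le_power2 one_power2)
  have hb: "norm (h y) \<le> B" "norm (h' y) \<le> B'" if y: "y \<ge> m" for y
  proof -
    have p: "y powr (- e) \<le> m powr (- e)" if "e \<ge> 0" for e using y m that by (intro powr_mono2') auto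
    have y0: "y > 0" using y m by simp
    have "C * (y powr (- 2) + y powr (- (3/2))) \<le> B"
      unfolding B_def using C p[of 2] p[of "3/2"] by (intro mult_left_mono add_mono) auto
    then show 1: "norm (h y) \<le> B" using h_bound[OF y0] by linarith
    have 2: "C * (y powr (- 3) + y powr (- (5/2))) \<le> C * (m powr (- 3) + m powr (- (5/2)))"
      using C p[of 3] p[of "5/2"] by (intro mult_left_mono add_mono) auto
    have "norm (h' y) \<le> norm (h' y - \<i> * of_real k * h y) + norm (\<i> * of_real k * h y)"
      by (metis diff_add_cancel norm_triangle_ineq)
    also have "norm (\<i> * of_real k * h y) = k * norm (h y)" using k by (simp add: norm_mult)
    also have "k * norm (h y) \<le> k * B" using 1 k by simp
    finally show "norm (h' y) \<le> B'" using h'_bound[OF y0] 2 unfolding B'_def by linarith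
  qed
  have near: "y > r / 2" "y < 2 * r" "y > 0" if "\<bar>y - r\<bar> < r / 2" for y using that r by (auto simp: abs_if split: if_splits)
  note * = has_vector_derivative_integral_dominated[of "r / 2" r lborel "\<lambda>r t. P (r * c) (r * s - t) * \<psi> t"
      "\<lambda>r t. ray_flux c s r t * \<psi> t" "\<lambda>t. (B + 2 * r * B') * norm (\<psi> t)"]
  have i: "integrable lborel (\<lambda>t. P (y * c) (y * s - t) * \<psi> t)" if "\<bar>y - r\<bar> < r / 2" for y
    using near[OF that] c by (intro integrable_P_\<psi>) simp
  have d: "((\<lambda>y. P (y * c) (y * s - t) * \<psi> t) has_vector_derivative ray_flux c s y t * \<psi> t) (at y)" if "\<bar>y - r\<bar> < r / 2" for y t
    by (rule has_vector_derivative_mult_left[OF P_along_ray[OF cs c near(3)[OF that]]])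
  have b: "norm (ray_flux c s y t * \<psi> t) \<le> (B + 2 * r * B') * norm (\<psi> t)" if y: "\<bar>y - r\<bar> < r / 2" for y t
  proof -
    let ?rho = "rho (y * c) (y * s - t)"
    note ny = near[OF y]
    have "m \<le> y * c" using ny(1) c by (simp add: m_def)
    then have rm: "?rho \<ge> m" using rho_ge(1)[of "y * c" "y * s - t"] by linarith
    have le1: "\<bar>(y - t * s) / ?rho\<bar> \<le> 1"
      using ray_direction[OF cs, of y t] rm m by simp
    have "norm (ray_flux c s y t) \<le> norm (of_real c * h ?rho) + norm (of_real (y * c * ((y - t * s) / ?rho)) * h' ?rho)"
      unfolding ray_flux_def by (rule norm_triangle_ineq)
    also have "\<dots> = c * norm (h ?rho) + (y * c) * \<bar>(y - t * s) / ?rho\<bar> * norm (h' ?rho)"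
      unfolding norm_mult norm_of_real abs_mult using c ny(3) by simp
    also have "\<dots> \<le> 1 * B + (2 * r) * 1 * B'"
    proof (rule add_mono)
      show "c * norm (h ?rho) \<le> 1 * B" using c c1 hb(1)[OF rm] by (intro mult_mono) auto
      have "y * c \<le> 2 * r * 1" using ny c c1 by (intro mult_mono) auto
      then show "(y * c) * \<bar>(y - t * s) / ?rho\<bar> * norm (h' ?rho) \<le> (2 * r) * 1 * B'"
        by (intro mult_mono[OF mult_mono hb(2)[OF rm]] le1) (use r in auto)
    qed
    finally show ?thesis unfolding norm_mult by (intro mult_right_mono) auto
  qed
  have g: "integrable lborel (\<lambda>t. (B + 2 * r * B') * norm (\<psi> t))"
    by (intro integrable_mult_right integrable_norm \<psi>_integrable)
  show "integrable lborel (\<lambda>t. ray_flux c s r t * \<psi> t)"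
    by (rule *(1)) (use r i d b g in auto)
  show "((\<lambda>r. potential \<psi> (r * c) (r * s)) has_vector_derivative (\<integral>t. ray_flux c s r t * \<psi> t \<partial>lborel)) (at r)"
    unfolding potential_def by (rule *(2)) (use r i d b g in auto)
qed

text \<open>For \<open>|t| <= r / 2\<close> the angle between ray and segment is small, and a
  fractional power of \<open>|t| / r\<close> is converted into decay in \<open>r\<close>. For
  \<open>|t| > r / 2\<close> the angle gives nothing, but \<open>\<psi>\<close> is of order
  \<open>r^(-q)\<close> and the kernel contributes at most \<open>r^(1/2)\<close>.\<close>

lemma potential_radiation:
  assumes \<epsilon>: "\<epsilon> > 0"
  obtains K where "K > 0" "\<And>c s r. c\<^sup>2 + s\<^sup>2 = 1 \<Longrightarrow> r * c > \<epsilon> \<Longrightarrow> c > 0 \<Longrightarrow> r \<ge> 1 \<Longrightarrow>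
     norm ((\<integral>t. ray_flux c s r t * \<psi> t \<partial>lborel) - \<i> * of_real k * potential \<psi> (r * c) (r * s)) \<le>
       K * r powr (- (1/2) - (q - 1) / 2)"
proof -
  \<comment> \<open>Half of the surplus \<open>q - 1\<close>: the weight
    \<open>(1 + |t|) powr \<eta>\<close> leaves the density integrable, and
    \<open>1/2 - q <= - 1/2 - \<eta>\<close> takes care of large \<open>|t|\<close>.\<close>
  define \<eta> where "\<eta> = (q - 1) / 2"
  \<comment> \<open>Distances exceed the height, hence \<open>\<epsilon>\<close>. On this range the
    more singular power in each bound for \<open>h\<close> is absorbed into the less singular one at
    the cost of \<open>\<epsilon> powr (- (1/2))\<close>.\<close>
  define Ce where "Ce = C * (\<epsilon> powr (- (1/2)) + 1)"
  define I1 where "I1 = (\<integral>t. (1 + \<bar>t\<bar>) powr (\<eta> - q) \<partial>lborel)"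
  define I2 where "I2 = (\<integral>v. rho 1 v powr (- (3/2)) \<partial>lborel)"
  define C4 where "C4 = Ce * (1 + 1 / \<epsilon> + 2 * k)"
  define K where "K = 1 + Ce * (16 + 32 * k) * M * I1 + 4 * M * C4 * I2"
  have \<eta>: "0 < \<eta>" "\<eta> \<le> 1 / 4" "\<eta> - q < - 1" using q unfolding \<eta>_def by argo+
  have Ce: "Ce > 0" using C by (simp add: Ce_def add_nonneg_pos)
  have C4: "C4 > 0" using Ce k \<epsilon> by (simp add: C4_def add_pos_pos)
  have I: "I1 \<ge> 0" "I2 \<ge> 0" unfolding I1_def I2_def by (auto intro!: integral_nonneg_AE)
  have K: "K > 0" using I Ce C4 k M by (simp add: K_def add_pos_nonneg)
  have hb: "norm (h y) \<le> Ce * y powr (- (3/2))" "norm (h' y - \<i> * of_real k * h y) \<le> Ce * y powr (- (5/2))" if y: "y \<ge> \<epsilon>" for y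
  proof -
    have y0: "y > 0" using y \<epsilon> by simp
    have p: "y powr (- (1/2)) \<le> \<epsilon> powr (- (1/2))" using y \<epsilon> by (intro powr_mono2') auto
    have "y powr (- 2) = y powr (- (1/2)) * y powr (- (3/2))" "y powr (- 3) = y powr (- (1/2)) * y powr (- (5/2))"
      unfolding powr_add[symmetric] by simp_all
    then have "y powr (- 2) \<le> \<epsilon> powr (- (1/2)) * y powr (- (3/2))" "y powr (- 3) \<le> \<epsilon> powr (- (1/2)) * y powr (- (5/2))"
      using p by (simp_all add: mult_right_mono)
    then have "C * (y powr (- 2) + y powr (- (3/2))) \<le> C * (\<epsilon> powr (- (1/2)) * y powr (- (3/2)) + y powr (- (3/2)))"
       "C * (y powr (- 3) + y powr (- (5/2))) \<le> C * (\<epsilon> powr (- (1/2)) * y powr (- (5/2)) + y powr (- (5/2)))"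
      using C by (auto intro!: mult_left_mono)
    then show "norm (h y) \<le> Ce * y powr (- (3/2))" "norm (h' y - \<i> * of_real k * h y) \<le> Ce * y powr (- (5/2))"
      using h_bound[OF y0] h'_bound[OF y0] by (simp_all add: Ce_def algebra_simps)
  qed
  show ?thesis
  proof (rule that[OF K])
    fix c s r :: real assume cs: "c\<^sup>2 + s\<^sup>2 = 1" and a: "r * c > \<epsilon>" and c: "c > 0" and r: "r \<ge> 1"
    have c1: "c \<le> 1" "\<bar>s\<bar> \<le> 1"
      using cs abs_le_square_iff[of c 1] abs_le_square_iff[of s 1] zero_le_power2[of c] zero_le_power2[of s] c by (auto simp: abs_if split: if_splits)
    let ?rho = "\<lambda>t. rho (r * c) (r * s - t)"
    define D where "D t = ray_flux c s r t - \<i> * of_real k * P (r * c) (r * s - t)" for t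
    have a0: "r * c > 0" "r * c \<le> r" using a \<epsilon> r c1 c by (auto simp: mult_left_le)
    have re: "?rho t \<ge> \<epsilon>" "?rho t > 0" for t using rho_ge(1)[of "r * c" "r * s - t"] a \<epsilon> by linarith+
    \<comment> \<open>Three pieces: the derivative of the height factor, the radiation defect of the
      profile, and the deviation of the cosine from 1. Only the last one is critical, since its
      prefactor is as large as the kernel.\<close>
    have Deq: "D t = of_real c * h (?rho t) + of_real (r * c * ((r - t * s) / ?rho t)) * (h' (?rho t) - \<i> * of_real k * h (?rho t))
        + of_real (r * c) * (\<i> * of_real k * h (?rho t)) * of_real ((r - t * s) / ?rho t - 1)" for t
    proof -
      have "of_real c * hh + of_real (r * c * x) * hp - \<i> * of_real k * (of_real (r * c) * hh) =
          of_real c * hh + of_real (r * c * x) * (hp - \<i> * of_real k * hh) + of_real (r * c) * (\<i> * of_real k * hh) * of_real (x - 1)"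
        for x and hh hp :: complex by (simp add: algebra_simps)
      then show ?thesis unfolding D_def ray_flux_def P_def by blast
    qed
    have le1: "\<bar>(r - t * s) / ?rho t\<bar> \<le> 1" for t
      using ray_direction[OF cs, of r t] re(2)[of t] by simp
    have Db: "norm (D t) \<le> c * (Ce * ?rho t powr (- (3/2))) + r * c * (Ce * ?rho t powr (- (5/2)))
        + r * c * (k * (Ce * ?rho t powr (- (3/2)))) * \<bar>(r - t * s) / ?rho t - 1\<bar>" for t
    proof -
      have "norm (D t) \<le> norm (of_real c * h (?rho t)) + norm (of_real (r * c * ((r - t * s) / ?rho t)) * (h' (?rho t) - \<i> * of_real k * h (?rho t)))
         + norm (of_real (r * c) * (\<i> * of_real k * h (?rho t)) * of_real ((r - t * s) / ?rho t - 1))"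
        unfolding Deq by (intro order_trans[OF norm_triangle_ineq] add_right_mono norm_triangle_ineq)
      also have "\<dots> = c * norm (h (?rho t)) + (r * c) * \<bar>(r - t * s) / ?rho t\<bar> * norm (h' (?rho t) - \<i> * of_real k * h (?rho t))
         + (r * c) * (k * norm (h (?rho t))) * \<bar>(r - t * s) / ?rho t - 1\<bar>"
        unfolding norm_mult norm_of_real abs_mult norm_ii mult_1 using c r k by simp
      also have "\<dots> \<le> c * (Ce * ?rho t powr (- (3/2))) + (r * c) * 1 * (Ce * ?rho t powr (- (5/2)))
         + (r * c) * (k * (Ce * ?rho t powr (- (3/2)))) * \<bar>(r - t * s) / ?rho t - 1\<bar>"
        using hb[OF re(1)] le1[of t] c k a0 Ce
        by (intro add_mono mult_mono[OF mult_mono] mult_right_mono mult_left_mono) auto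
      finally show ?thesis by simp
    qed
    have rp: "(r / 2) powr (- e) \<le> 8 * r powr (- e)" if "e \<le> 3" for e
    proof -
      have "(r / 2) powr (- e) = 2 powr e * r powr (- e)" using r by (simp add: powr_divide powr_minus field_simps)
      also have "\<dots> \<le> 2 powr 3 * r powr (- e)" using that by (intro mult_right_mono powr_mono) auto
      finally show ?thesis by simp
    qed
    have near: "norm (D t) \<le> Ce * (16 + 32 * k) * r powr (- (1/2) - \<eta>) * (1 + \<bar>t\<bar>) powr \<eta>" if t: "\<bar>t\<bar> \<le> r / 2" for t
    proof -
      define Z where "Z = r powr (- (1/2) - \<eta>) * (1 + \<bar>t\<bar>) powr \<eta>"
      have "rho (r * c) (r * s) = r" using r by (intro rho_polar cs) simp
      then have tr: "\<bar>?rho t - r\<bar> \<le> \<bar>t\<bar>" using rho_triangle[of "r * c" "r * s - t" "r * c" "r * s"] by simp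
      then have r2: "?rho t \<ge> r / 2" using t by linarith
      have pw: "?rho t powr (- e) \<le> 8 * r powr (- e)" if "0 \<le> e" "e \<le> 3" for e
      proof -
        have "?rho t powr (- e) \<le> (r / 2) powr (- e)" using r2 r that by (intro powr_mono2') auto
        then show ?thesis using rp[OF that(2)] by linarith
      qed
      have Z1: "r powr (- (3/2)) \<le> Z"
      proof -
        have "r powr (- (3/2)) * 1 \<le> r powr (- (1/2) - \<eta>) * (1 + \<bar>t\<bar>) powr \<eta>"
          using r \<eta> by (intro mult_mono powr_mono ge_one_powr_ge_zero) auto
        then show ?thesis by (simp add: Z_def)
      qed
      \<comment> \<open>As \<open>|t| / r <= 1\<close>, lowering its exponent from 1 to
        \<open>\<eta>\<close> enlarges it. A full power of \<open>|t|\<close> could not be afforded,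
        because \<open>|t| * \<psi> t\<close> is not controlled in L1 by the bound on
        \<open>\<psi>\<close>.\<close>
      have Z2: "r powr (- (1/2)) * (\<bar>t\<bar> / r) \<le> Z"
      proof -
        have "\<bar>t\<bar> / r = (\<bar>t\<bar> / r) powr 1" using r by simp
        also have "\<dots> \<le> (\<bar>t\<bar> / r) powr \<eta>" using t r \<eta> by (intro powr_mono') auto
        also have "\<dots> = \<bar>t\<bar> powr \<eta> * r powr (- \<eta>)" using r by (simp add: powr_divide powr_minus_divide)
        also have "\<dots> \<le> (1 + \<bar>t\<bar>) powr \<eta> * r powr (- \<eta>)" using \<eta> by (intro mult_right_mono powr_mono2) auto
        finally have "r powr (- (1/2)) * (\<bar>t\<bar> / r) \<le> r powr (- (1/2)) * ((1 + \<bar>t\<bar>) powr \<eta> * r powr (- \<eta>))"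
          by (intro mult_left_mono) auto
        also have "\<dots> = (r powr (- (1/2)) * r powr (- \<eta>)) * (1 + \<bar>t\<bar>) powr \<eta>" by simp
        also have "\<dots> = Z" unfolding powr_add[symmetric] Z_def by simp
        finally show ?thesis .
      qed
      have "\<bar>(r - t * s) / ?rho t - 1\<bar> \<le> 4 * (\<bar>t\<bar> / r)"
      proof -
        have "\<bar>t * s\<bar> \<le> \<bar>t\<bar>" using c1(2) by (simp add: abs_mult mult_left_le)
        then have "\<bar>(r - t * s) - ?rho t\<bar> \<le> 2 * \<bar>t\<bar>" using tr by linarith
        moreover have "(r - t * s) / ?rho t - 1 = ((r - t * s) - ?rho t) / ?rho t" using re(2)[of t] by (simp add: diff_divide_distrib)
        ultimately have "\<bar>(r - t * s) / ?rho t - 1\<bar> \<le> 2 * \<bar>t\<bar> / (r / 2)"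
          using r2 r re(2)[of t] by (simp only: abs_divide) (intro frac_le, auto)
        then show ?thesis by simp
      qed
      then have "norm (D t) \<le> 1 * (Ce * (8 * r powr (- (3/2)))) + r * (Ce * (8 * r powr (- (5/2))))
          + r * (k * (Ce * (8 * r powr (- (3/2))))) * (4 * (\<bar>t\<bar> / r))"
        using c c1 a0 r Ce k pw[of "3/2"] pw[of "5/2"]
        by (intro order_trans[OF Db] add_mono mult_mono[OF mult_mono] mult_mono mult_left_mono mult_nonneg_nonneg) auto
      also have "\<dots> = Ce * 8 * r powr (- (3/2)) + Ce * 8 * (r powr 1 * r powr (- (5/2)))
          + Ce * 32 * k * ((r powr 1 * r powr (- (3/2))) * (\<bar>t\<bar> / r))"
        using r by (simp add: algebra_simps)
      also have "\<dots> = Ce * 16 * r powr (- (3/2)) + Ce * 32 * k * (r powr (- (1/2)) * (\<bar>t\<bar> / r))"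
        unfolding powr_add[symmetric] by simp
      also have "\<dots> \<le> Ce * 16 * Z + Ce * 32 * k * Z"
        using Z1 Z2 Ce k by (intro add_mono mult_left_mono) auto
      finally show ?thesis by (simp add: Z_def algebra_simps)
    qed
    have far: "norm (D t) \<le> C4 * (r * c) * ?rho t powr (- (3/2))" for t
    proof -
      let ?p = "?rho t powr (- (3/2))"
      have "?rho t powr (- (5/2)) = ?rho t powr (- 1) * ?p" unfolding powr_add[symmetric] by simp
      also have "?rho t powr (- 1) = 1 / ?rho t" using re(2)[of t] by (simp add: powr_minus_divide)
      also have "1 / ?rho t * ?p \<le> 1 / \<epsilon> * ?p"
        using re(1)[of t] \<epsilon> by (intro mult_right_mono divide_left_mono) auto
      finally have 5: "?rho t powr (- (5/2)) \<le> 1 / \<epsilon> * ?p" .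
      have "\<bar>(r - t * s) / ?rho t - 1\<bar> \<le> 2" using le1[of t] by linarith
      then have "norm (D t) \<le> (r * c) * (Ce * ?p) + r * c * (Ce * (1 / \<epsilon> * ?p)) + r * c * (k * (Ce * ?p)) * 2"
        using r c Ce k a0 5 by (intro order_trans[OF Db] add_mono mult_right_mono mult_left_mono mult_nonneg_nonneg) auto
      also have "\<dots> = C4 * (r * c) * ?p" by (simp add: C4_def algebra_simps)
      finally show ?thesis .
    qed
    have pt: "norm (D t * \<psi> t) \<le> Ce * (16 + 32 * k) * r powr (- (1/2) - \<eta>) * M * (1 + \<bar>t\<bar>) powr (\<eta> - q)
        + C4 * (r * c) * (4 * M * r powr (- q)) * ?rho t powr (- (3/2))" (is "_ \<le> ?A t + ?B t") for t
    proof -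
      have nn: "?A t \<ge> 0" "?B t \<ge> 0" using Ce k M C4 a0 by (auto intro!: mult_nonneg_nonneg)
      show ?thesis
      proof (cases "\<bar>t\<bar> \<le> r / 2")
        case True
        have "norm (D t) * norm (\<psi> t) \<le> Ce * (16 + 32 * k) * r powr (- (1/2) - \<eta>) * (1 + \<bar>t\<bar>) powr \<eta> * (M * (1 + \<bar>t\<bar>) powr (- q))"
          using Ce k by (intro mult_mono near True \<psi>_bound) auto
        also have "\<dots> = Ce * (16 + 32 * k) * r powr (- (1/2) - \<eta>) * M * ((1 + \<bar>t\<bar>) powr \<eta> * (1 + \<bar>t\<bar>) powr (- q))"
          by (simp add: mult_ac)
        also have "\<dots> = ?A t" unfolding powr_add[symmetric] by simp
        finally show ?thesis using nn unfolding norm_mult by linarith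
      next
        case False
        have "norm (D t) * norm (\<psi> t) \<le> C4 * (r * c) * ?rho t powr (- (3/2)) * (4 * M * r powr (- q))"
          using C4 a0 False r by (intro mult_mono far \<psi>_far) auto
        also have "\<dots> = ?B t" by (simp add: mult_ac)
        finally show ?thesis using nn unfolding norm_mult by linarith
      qed
    qed
    have iA: "integrable lborel (\<lambda>t. (1 + \<bar>t\<bar>) powr (\<eta> - q))"
      using integrable_decay[of "q - \<eta>"] \<eta> by simp
    have "(3 / 2 :: real) > 1" by simp
    note iB = rho_powr_integral[of "3/2" "r * c" "r * s", OF this a0(1)]
    have i1: "integrable lborel (\<lambda>t. ray_flux c s r t * \<psi> t)" by (rule potential_along_ray(1)[OF cs c]) (use r in simp)
    have i2: "integrable lborel (\<lambda>t. \<i> * of_real k * (P (r * c) (r * s - t) * \<psi> t))"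
      by (intro integrable_mult_right integrable_P_\<psi> a0)
    have Deq': "D t * \<psi> t = ray_flux c s r t * \<psi> t - \<i> * of_real k * (P (r * c) (r * s - t) * \<psi> t)" for t
      by (simp add: D_def algebra_simps)
    have iD: "integrable lborel (\<lambda>t. D t * \<psi> t)" unfolding Deq' by (rule Bochner_Integration.integrable_diff[OF i1 i2])
    have "(\<integral>t. ray_flux c s r t * \<psi> t \<partial>lborel) - \<i> * of_real k * potential \<psi> (r * c) (r * s) = (\<integral>t. D t * \<psi> t \<partial>lborel)"
      unfolding Deq' Bochner_Integration.integral_diff[OF i1 i2] integral_mult_right_zero potential_def ..
    also have "norm \<dots> \<le> (\<integral>t. norm (D t * \<psi> t) \<partial>lborel)" by (rule integral_norm_bound)
    also have "\<dots> \<le> (\<integral>t. Ce * (16 + 32 * k) * r powr (- (1/2) - \<eta>) * M * (1 + \<bar>t\<bar>) powr (\<eta> - q)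
        + C4 * (r * c) * (4 * M * r powr (- q)) * ?rho t powr (- (3/2)) \<partial>lborel)"
      by (intro integral_mono integrable_norm iD Bochner_Integration.integrable_add integrable_mult_right iA iB pt)
    also have "\<dots> = Ce * (16 + 32 * k) * r powr (- (1/2) - \<eta>) * M * I1
        + C4 * (r * c) * (4 * M * r powr (- q)) * ((r * c) powr (1 - 3/2) * I2)"
      by (subst Bochner_Integration.integral_add[OF integrable_mult_right[OF iA] integrable_mult_right[OF iB(1)]])
         (simp only: integral_mult_right_zero iB(2) I1_def I2_def)
    also have "\<dots> \<le> Ce * (16 + 32 * k) * r powr (- (1/2) - \<eta>) * M * I1 + 4 * M * C4 * I2 * r powr (- (1/2) - \<eta>)"
    proof (rule add_left_mono)
      have "C4 * (r * c) * (4 * M * r powr (- q)) * ((r * c) powr (1 - 3/2) * I2) =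
         4 * M * C4 * I2 * (((r * c) powr 1 * (r * c) powr (1 - 3/2)) * r powr (- q))"
        using a0 by (simp add: mult_ac)
      also have "(r * c) powr 1 * (r * c) powr (1 - 3/2) = (r * c) powr (1/2)" unfolding powr_add[symmetric] by simp
      also have "4 * M * C4 * I2 * ((r * c) powr (1/2) * r powr (- q)) \<le> 4 * M * C4 * I2 * (r powr (1/2) * r powr (- q))"
        using a0 M C4 I by (intro mult_left_mono mult_right_mono powr_mono2) auto
      also have "r powr (1/2) * r powr (- q) \<le> r powr (- (1/2) - \<eta>)"
        unfolding powr_add[symmetric] using r q by (intro powr_mono) (auto simp: \<eta>_def field_simps)
      finally show "C4 * (r * c) * (4 * M * r powr (- q)) * ((r * c) powr (1 - 3/2) * I2) \<le> 4 * M * C4 * I2 * r powr (- (1/2) - \<eta>)"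
        using M C4 I by (simp add: mult_left_mono)
    qed
    also have "\<dots> \<le> K * r powr (- (1/2) - \<eta>)"
      by (simp add: K_def algebra_simps)
    finally show "norm ((\<integral>t. ray_flux c s r t * \<psi> t \<partial>lborel) - \<i> * of_real k * potential \<psi> (r * c) (r * s)) \<le>
       K * r powr (- (1/2) - (q - 1) / 2)" by (simp only: \<eta>_def)
  qed
qed

end

section \<open>Splitting the boundary data\<close>

lemma norm_cis_diff_le: "norm (cis x - cis y) \<le> \<bar>x - y\<bar>"
  using vector_derivative_bound[of UNIV cis "\<lambda>z. \<i> * cis z" 1 x y] has_vector_derivative_cis
  by (simp add: norm_mult has_vector_derivative_at_within)

text \<open>\<open>w1\<close> and \<open>w2\<close> are square roots of \<open>1 + i t\<close> and
  \<open>i t\<close>, so \<open>(w1 - w2) (w1 + w2) = 1\<close> makes their difference of order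
  \<open>|t|^(-1/2)\<close> and that of their reciprocals of order \<open>|t|^(-3/2)\<close>. The
  phases differ by at most \<open>k / |t|\<close>, since
  \<open>rho 1 t - |t| <= 1 / |t|\<close>.\<close>

lemma wave_asymptotics:
  assumes t: "t \<noteq> 0" and k: "k > 0" and \<sigma>: "\<sigma> = sgn t"
  shows "norm (wave k 1 t - cis (- \<sigma> * (pi / 4)) * (cis (k * \<bar>t\<bar>) * of_real (\<bar>t\<bar> powr (- (1/2)))))
     \<le> (2 + k) * \<bar>t\<bar> powr (- (3/2))"
proof -
  define w1 where "w1 = csqrt (Complex 1 t)"
  define w2 where "w2 = of_real (sqrt \<bar>t\<bar>) * cis (\<sigma> * (pi / 4))"
  have t0: "\<bar>t\<bar> > 0" using t by simp
  have \<sigma>': "\<sigma> = 1 \<or> \<sigma> = - 1" "\<sigma> * \<bar>t\<bar> = t" using t \<sigma> by (auto simp: sgn_real_def)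
  have s1: "w1 * w1 = Complex 1 t" unfolding w1_def using power2_csqrt[of "Complex 1 t"] by (simp only: power2_eq_square)
  have s2: "w2 * w2 = Complex 0 t"
  proof -
    have "w2 * w2 = of_real (sqrt \<bar>t\<bar> * sqrt \<bar>t\<bar>) * cis (\<sigma> * (pi / 4) + \<sigma> * (pi / 4))"
      by (simp only: w2_def cis_mult[symmetric] of_real_mult mult_ac)
    also have "\<sigma> * (pi / 4) + \<sigma> * (pi / 4) = \<sigma> * (pi / 2)" by simp
    also have "of_real (sqrt \<bar>t\<bar> * sqrt \<bar>t\<bar>) * cis (\<sigma> * (pi / 2)) = Complex 0 t"
      using \<sigma>' by (auto simp: complex_eq_iff)
    finally show ?thesis .
  qed
  have n2: "norm w2 = sqrt \<bar>t\<bar>" by (simp add: w2_def norm_mult)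
  have n1: "norm w1 \<ge> sqrt \<bar>t\<bar>"
  proof -
    have "norm w1 = sqrt (norm (Complex 1 t))" by (simp only: w1_def norm_csqrt)
    also have "\<dots> \<ge> sqrt \<bar>t\<bar>" using abs_Im_le_cmod[of "Complex 1 t"] by simp
    finally show ?thesis .
  qed
  have nz: "w1 \<noteq> 0" "w2 \<noteq> 0" using n1 n2 t by auto
  \<comment> \<open>Both roots lie in the closed right half plane, so the sum cannot be small by
    cancellation; this is where the matching choice of branches enters.\<close>
  have re: "Re (w1 + w2) \<ge> sqrt \<bar>t\<bar> / 2"
  proof -
    have "Re w1 \<ge> 0" unfolding w1_def using csqrt_principal[of "Complex 1 t"] by linarith
    moreover have "Re w2 = sqrt \<bar>t\<bar> * (sqrt 2 / 2)" using \<sigma>'(1) by (auto simp: w2_def cos_45)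
    moreover have "sqrt \<bar>t\<bar> * (1 / 2) \<le> sqrt \<bar>t\<bar> * (sqrt 2 / 2)" by (intro mult_left_mono) auto
    ultimately show ?thesis by simp
  qed
  then have sum: "norm (w1 + w2) \<ge> sqrt \<bar>t\<bar> / 2" using complex_Re_le_cmod[of "w1 + w2"] by linarith
  have "(w1 - w2) * (w1 + w2) = 1"
    using s1 s2 by (simp add: algebra_simps complex_eq_iff)
  then have "norm (w1 - w2) * norm (w1 + w2) = 1" by (metis norm_mult norm_one)
  then have d: "norm (w1 - w2) \<le> 2 / sqrt \<bar>t\<bar>"
    using mult_left_mono[OF sum, of "norm (w1 - w2)"] t0 by (simp add: field_simps)
  have id: "norm (inverse w1 - inverse w2) \<le> 2 * \<bar>t\<bar> powr (- (3/2))"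
  proof -
    have "inverse w1 - inverse w2 = - (inverse w1 * (w1 - w2) * inverse w2)"
      using nz by (rule inverse_diff_inverse)
    then have "norm (inverse w1 - inverse w2) = norm (w1 - w2) / (norm w1 * norm w2)"
      by (simp add: norm_mult norm_inverse divide_inverse_commute mult_ac)
    also have "\<dots> \<le> (2 / sqrt \<bar>t\<bar>) / (sqrt \<bar>t\<bar> * sqrt \<bar>t\<bar>)"
      using d n1 n2 t0 by (intro frac_le mult_mono mult_pos_pos) auto
    also have "\<dots> = 2 * \<bar>t\<bar> powr (- (3/2))"
    proof -
      have "\<bar>t\<bar> powr (3/2) = \<bar>t\<bar> powr (1/2) * \<bar>t\<bar> powr 1" unfolding powr_add[symmetric] by simp
      then have "\<bar>t\<bar> powr (3/2) = sqrt \<bar>t\<bar> * \<bar>t\<bar>" using t0 by (simp add: powr_half_sqrt)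
      then show ?thesis using t0 by (simp add: powr_minus_divide)
    qed
    finally show ?thesis .
  qed
  have e2: "inverse w2 = cis (- \<sigma> * (pi / 4)) * of_real (\<bar>t\<bar> powr (- (1/2)))"
  proof -
    have "\<bar>t\<bar> powr (- (1/2)) = inverse (sqrt \<bar>t\<bar>)" using t0 by (simp add: powr_minus powr_half_sqrt)
    then show ?thesis by (simp add: w2_def cis_inverse)
  qed
  have "\<bar>k * rho 1 t - k * \<bar>t\<bar>\<bar> \<le> k / \<bar>t\<bar>"
  proof -
    have "(rho 1 t - \<bar>t\<bar>) * (rho 1 t + \<bar>t\<bar>) = 1" using rho_square[of 1 t] by (simp add: algebra_simps)
    then have "(rho 1 t - \<bar>t\<bar>) * \<bar>t\<bar> \<le> 1"
      using rho_ge(2)[of t 1] t0 mult_left_mono[of "\<bar>t\<bar>" "rho 1 t + \<bar>t\<bar>" "rho 1 t - \<bar>t\<bar>"] by linarith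
    then have "rho 1 t - \<bar>t\<bar> \<le> 1 / \<bar>t\<bar>" using t0 by (simp add: field_simps)
    then have "k * (rho 1 t - \<bar>t\<bar>) \<le> k * (1 / \<bar>t\<bar>)" using k by (intro mult_left_mono) auto
    moreover have "\<bar>k * rho 1 t - k * \<bar>t\<bar>\<bar> = k * (rho 1 t - \<bar>t\<bar>)"
      using k rho_ge(2)[of t 1] by (simp add: right_diff_distrib)
    ultimately show ?thesis by simp
  qed
  then have c: "norm (cis (k * rho 1 t) - cis (k * \<bar>t\<bar>)) \<le> k / \<bar>t\<bar>"
    using norm_cis_diff_le order_trans by blast
  have "wave k 1 t - cis (- \<sigma> * (pi / 4)) * (cis (k * \<bar>t\<bar>) * of_real (\<bar>t\<bar> powr (- (1/2)))) =
     cis (k * rho 1 t) * (inverse w1 - inverse w2) + (cis (k * rho 1 t) - cis (k * \<bar>t\<bar>)) * inverse w2"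
    unfolding e2 wave_def w1_def[symmetric] by (simp add: algebra_simps)
  also have "norm \<dots> \<le> norm (inverse w1 - inverse w2) + norm (cis (k * rho 1 t) - cis (k * \<bar>t\<bar>)) * norm (inverse w2)"
    by (rule order_trans[OF norm_triangle_ineq]) (simp add: norm_mult)
  also have "norm (inverse w2) = \<bar>t\<bar> powr (- (1/2))" unfolding e2 by (simp add: norm_mult)
  also have "norm (inverse w1 - inverse w2) + norm (cis (k * rho 1 t) - cis (k * \<bar>t\<bar>)) * \<bar>t\<bar> powr (- (1/2)) \<le>
     2 * \<bar>t\<bar> powr (- (3/2)) + (k / \<bar>t\<bar>) * \<bar>t\<bar> powr (- (1/2))"
    by (intro add_mono id mult_right_mono c) auto
  also have "(k / \<bar>t\<bar>) * \<bar>t\<bar> powr (- (1/2)) = k * (\<bar>t\<bar> powr (- 1) * \<bar>t\<bar> powr (- (1/2)))"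
    using t0 by (simp add: powr_minus_divide)
  also have "\<bar>t\<bar> powr (- 1) * \<bar>t\<bar> powr (- (1/2)) = \<bar>t\<bar> powr (- (3/2))"
    unfolding powr_add[symmetric] by simp
  finally show ?thesis by (simp add: algebra_simps)
qed

lemma wave_decay:
  assumes a: "a > 0"
  shows "norm (wave k (1 + a) x) \<le> 2 * (1 + rho a x) powr (- (1/2))"
proof -
  \<comment> \<open>The constant 4 is taken for its rational square root.\<close>
  have "1 + rho a x \<le> 4 * rho (1 + a) x"
    using rho_triangle[of a x "1 + a" x] rho_ge(1)[of "1 + a" x] a by linarith
  then have "rho (1 + a) x powr (- (1/2)) \<le> ((1 + rho a x) / 4) powr (- (1/2))"
    using rho_ge(3)[of a x] by (intro powr_mono2') auto
  also have "\<dots> = 4 powr (1/2) * (1 + rho a x) powr (- (1/2))"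
    using rho_ge(3)[of a x] by (simp add: powr_divide powr_minus field_simps)
  also have "4 powr (1/2) = (2::real)" by (simp add: powr_half_sqrt)
  finally show ?thesis using a by (simp add: norm_wave)
qed

text \<open>The wave is outgoing about (-1,0), while the ray starts at the origin. Shifting the
  centre by 1 changes distances by at most 1 and the cosine factor by order \<open>1 / r\<close>;
  the square root contributes another \<open>1 / r\<close>.\<close>

lemma wave_along_ray:
  assumes cs: "c\<^sup>2 + s\<^sup>2 = 1" and c: "c > 0" and r: "r > 0" and k: "k > 0"
  obtains D where "((\<lambda>r. wave k (1 + r * c) (r * s)) has_vector_derivative D) (at r)"
    "norm (D - \<i> * of_real k * wave k (1 + r * c) (r * s)) \<le> (2 * k + 1) * r powr (- (3/2))"
proof -
  let ?z = "Complex (1 + r * c) (r * s)" and ?rho = "rho (1 + r * c) (r * s)"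
  have b: "1 + r * c > 0" using c r by (simp add: add_pos_pos)
  then have p: "?rho > 0" by (intro rho_pos) auto
  have z: "?z \<notin> \<real>\<^sub>\<le>\<^sub>0" using b by (simp add: complex_nonpos_Reals_iff)
  have d: "((\<lambda>r. 1 + r * c) has_real_derivative c) (at r)" "((\<lambda>r. r * s) has_real_derivative s) (at r)"
    by (auto intro!: derivative_eq_intros)
  have "(1 + r * c) * c + r * s * s = r * (c\<^sup>2 + s\<^sup>2) + c" by (simp add: algebra_simps power2_eq_square)
  then have e: "(1 + r * c) * c + r * s * s = r + c" using cs by simp
  note dr = rho_curve_deriv[OF d b, unfolded e]
  have cis: "((\<lambda>r. cis (k * rho (1 + r * c) (r * s))) has_vector_derivative \<i> * of_real (k * ((r + c) / ?rho)) * cis (k * ?rho)) (at r)"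
    using vector_diff_chain_at[OF DERIV_cmult[OF dr, of k, unfolded has_real_derivative_iff_has_vector_derivative] has_vector_derivative_cis]
    by (simp add: o_def scaleR_conv_of_real mult_ac)
  note isq = DERIV_inverse_csqrt[OF z]
  have cC: "((\<lambda>r. Complex (1 + r * c) (r * s)) has_vector_derivative Complex c s) (at r)"
    unfolding Complex_eq
    by (intro has_vector_derivative_add has_vector_derivative_mult_right has_vector_derivative_of_real d)
  let ?X = "Complex c s * inverse (2 * ?z)"
  let ?D = "(\<i> * of_real (k * ((r + c) / ?rho)) - ?X) * wave k (1 + r * c) (r * s)"
  have D: "((\<lambda>r. wave k (1 + r * c) (r * s)) has_vector_derivative ?D) (at r)"
    unfolding wave_def
    by (rule has_vector_derivative_eq_rhs[OF has_vector_derivative_mult[OF cis field_vector_diff_chain_at[OF cC isq, unfolded o_def]]])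
       (simp add: algebra_simps)
  have rr: "rho (r * c) (r * s) = r" using r by (intro rho_polar cs) simp
  have c1: "c \<le> 1" using cs abs_le_square_iff[of c 1] zero_le_power2[of s] c by (auto simp: abs_if split: if_splits)
  have rge: "?rho \<ge> r" "\<bar>?rho - r\<bar> \<le> 1"
  proof -
    show "\<bar>?rho - r\<bar> \<le> 1" using rho_triangle[of "1 + r * c" "r * s" "r * c" "r * s"] rr by simp
    have "rho (r * c) (r * s) \<le> ?rho" unfolding rho_def using c r by (intro real_sqrt_le_mono add_right_mono power_mono) auto
    then show "?rho \<ge> r" using rr by simp
  qed
  have "?D - \<i> * of_real k * wave k (1 + r * c) (r * s) = (\<i> * of_real (k * ((r + c) / ?rho - 1)) - ?X) * wave k (1 + r * c) (r * s)"
    by (simp add: algebra_simps)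
  also have "norm \<dots> \<le> ((2 * k + 1) / r) * r powr (- (1/2))"
    unfolding norm_mult[of _ "wave k (1 + r * c) (r * s)"]
  proof (rule mult_mono)
    have "\<bar>(r + c) / ?rho - 1\<bar> \<le> 2 / r"
    proof -
      have "(r + c) / ?rho - 1 = (r + c - ?rho) / ?rho" using p by (simp add: diff_divide_distrib)
      moreover have "\<bar>r + c - ?rho\<bar> \<le> 2" using rge c c1 by linarith
      ultimately show ?thesis using rge(1) r p by (simp only: abs_divide) (intro frac_le, auto)
    qed
    then have "k * \<bar>(r + c) / ?rho - 1\<bar> \<le> k * (2 / r)" using k by (intro mult_left_mono) auto
    moreover have "norm (\<i> * of_real (k * ((r + c) / ?rho - 1))) = k * \<bar>(r + c) / ?rho - 1\<bar>"
      unfolding norm_mult norm_of_real abs_mult using k by simp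
    moreover have "norm ?X \<le> 1 / r"
    proof -
      have "norm (Complex c s) = 1" using cs by (simp add: cmod_def)
      then have "norm ?X = 1 / (2 * ?rho)" unfolding norm_mult norm_inverse norm_Complex_rho by (simp add: inverse_eq_divide)
      also have "\<dots> \<le> 1 / r" using rge(1) r by (intro divide_left_mono) auto
      finally show ?thesis .
    qed
    ultimately show "norm (\<i> * of_real (k * ((r + c) / ?rho - 1)) - ?X) \<le> (2 * k + 1) / r"
      using norm_triangle_ineq4[of "\<i> * of_real (k * ((r + c) / ?rho - 1))" ?X] by (simp add: add_divide_distrib)
    show "norm (wave k (1 + r * c) (r * s)) \<le> r powr (- (1/2))"
      using rge(1) r b by (simp add: norm_wave powr_mono2')
  qed (use k r in auto)
  also have "\<dots> = (2 * k + 1) * (r powr (- 1) * r powr (- (1/2)))" using r by (simp add: powr_minus_divide)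
  also have "\<dots> = (2 * k + 1) * r powr (- (3/2))" unfolding powr_add[symmetric] by simp
  finally show ?thesis using D that by blast
qed

text \<open>The boundary values of the wave carry the phase \<open>u\<close> at the right end and
  \<open>u'\<close> at the left end, the reflected ones the other way round. Matching
  \<open>c_plus\<close> and \<open>c_minus\<close> is therefore a linear system with determinant
  \<open>u^2 - u'^2 = - 2 i\<close>.\<close>

lemma density_decomposition:
  fixes \<phi> :: "real \<Rightarrow> complex"
  assumes k: "k > 0" and p: "p > 1" and cont: "continuous_on UNIV \<phi>"
    and ap: "(\<lambda>t. \<phi> t - c_plus * exp (\<i> * of_real (k * \<bar>t\<bar>)) * of_real (\<bar>t\<bar> powr (-1/2))) \<in> O[at_top](\<lambda>t. of_real (\<bar>t\<bar> powr (-p)))"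
    and am: "(\<lambda>t. \<phi> t - c_minus * exp (\<i> * of_real (k * \<bar>t\<bar>)) * of_real (\<bar>t\<bar> powr (-1/2))) \<in> O[at_bot](\<lambda>t. of_real (\<bar>t\<bar> powr (-p)))"
  obtains \<alpha> \<beta> M where "M > 0"
    "\<And>t. norm (\<phi> t - \<alpha> * wave k 1 t - \<beta> * wave k 1 (- t)) \<le> M * (1 + \<bar>t\<bar>) powr (- min p (3/2))"
proof -
  define q where "q = min p (3/2)"
  define u where "u = cis (- (pi / 4))"
  define u' where "u' = cis (pi / 4)"
  \<comment> \<open>Cramer's rule for \<open>\<alpha> u + \<beta> u' = c_plus\<close> and
    \<open>\<alpha> u' + \<beta> u = c_minus\<close>.\<close>
  define \<alpha> where "\<alpha> = (u * c_plus - u' * c_minus) / (u * u - u' * u')"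
  define \<beta> where "\<beta> = (u * c_minus - u' * c_plus) / (u * u - u' * u')"
  have uu: "u * u = - \<i>" "u' * u' = \<i>" "u * u' = 1" by (simp_all add: u_def u'_def cis_mult)
  have det: "u * u - u' * u' \<noteq> 0" unfolding uu by simp
  have cp: "\<alpha> * u + \<beta> * u' = c_plus" "\<alpha> * u' + \<beta> * u = c_minus"
  proof -
    have "\<alpha> * u + \<beta> * u' = ((u * c_plus - u' * c_minus) * u + (u * c_minus - u' * c_plus) * u') / (u * u - u' * u')"
      by (simp add: \<alpha>_def \<beta>_def add_divide_distrib)
    also have "(u * c_plus - u' * c_minus) * u + (u * c_minus - u' * c_plus) * u' = c_plus * (u * u - u' * u')"
      by (simp add: algebra_simps)
    finally show "\<alpha> * u + \<beta> * u' = c_plus" using det by simp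
    have "\<alpha> * u' + \<beta> * u = ((u * c_plus - u' * c_minus) * u' + (u * c_minus - u' * c_plus) * u) / (u * u - u' * u')"
      by (simp add: \<alpha>_def \<beta>_def add_divide_distrib)
    also have "(u * c_plus - u' * c_minus) * u' + (u * c_minus - u' * c_plus) * u = c_minus * (u * u - u' * u')"
      by (simp add: algebra_simps)
    finally show "\<alpha> * u' + \<beta> * u = c_minus" using det by simp
  qed
  define E where "E t = exp (\<i> * of_real (k * \<bar>t\<bar>)) * of_real (\<bar>t\<bar> powr (-1/2))" for t
  have E: "E t = cis (k * \<bar>t\<bar>) * of_real (\<bar>t\<bar> powr (- (1/2)))" for t by (simp add: E_def cis_conv_exp)
  define \<psi> where "\<psi> t = \<phi> t - \<alpha> * wave k 1 t - \<beta> * wave k 1 (- t)" for t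
  have "\<exists>A. \<forall>\<^sub>F t in at_top. norm (\<phi> t - c_plus * exp (\<i> * of_real (k * \<bar>t\<bar>)) * of_real (\<bar>t\<bar> powr (-1/2))) \<le> A * \<bar>t\<bar> powr (- p)"
    using ap by (auto simp: bigo_def)
  then obtain A where A: "\<forall>\<^sub>F t in at_top. norm (\<phi> t - c_plus * E t) \<le> A * \<bar>t\<bar> powr (- p)"
    unfolding E_def mult.assoc[symmetric] by blast
  have "\<exists>A. \<forall>\<^sub>F t in at_bot. norm (\<phi> t - c_minus * exp (\<i> * of_real (k * \<bar>t\<bar>)) * of_real (\<bar>t\<bar> powr (-1/2))) \<le> A * \<bar>t\<bar> powr (- p)"
    using am by (auto simp: bigo_def)
  then obtain B where B: "\<forall>\<^sub>F t in at_bot. norm (\<phi> t - c_minus * E t) \<le> B * \<bar>t\<bar> powr (- p)"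
    unfolding E_def mult.assoc[symmetric] by blast
  from A obtain T1 where T1: "\<And>t. t \<ge> T1 \<Longrightarrow> norm (\<phi> t - c_plus * E t) \<le> A * \<bar>t\<bar> powr (- p)"
    by (auto simp: eventually_at_top_linorder)
  from B obtain T2 where T2: "\<And>t. t \<le> T2 \<Longrightarrow> norm (\<phi> t - c_minus * E t) \<le> B * \<bar>t\<bar> powr (- p)"
    by (auto simp: eventually_at_bot_linorder)
  define T where "T = max 1 (max \<bar>T1\<bar> \<bar>T2\<bar>)"
  define L where "L = max \<bar>A\<bar> \<bar>B\<bar> + (norm \<alpha> + norm \<beta>) * (2 + k)"
  have far: "norm (\<psi> t) \<le> L * \<bar>t\<bar> powr (- q)" if t: "\<bar>t\<bar> \<ge> T" for t
  proof -
    have t1: "\<bar>t\<bar> \<ge> 1" "t \<noteq> 0" using t by (auto simp: T_def)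
    define \<sigma> where "\<sigma> = sgn t"
    define c where "c = (if t > 0 then c_plus else c_minus)"
    define v where "v = cis (- \<sigma> * (pi / 4))"
    define v' where "v' = cis (\<sigma> * (pi / 4))"
    have vc: "\<alpha> * v + \<beta> * v' = c"
      using cp t1 by (auto simp: v_def v'_def c_def \<sigma>_def u_def u'_def sgn_real_def)
    have w1: "norm (wave k 1 t - v * E t) \<le> (2 + k) * \<bar>t\<bar> powr (- (3/2))"
      using wave_asymptotics[OF t1(2) k \<sigma>_def] by (simp only: E v_def)
    have w2: "norm (wave k 1 (- t) - v' * E t) \<le> (2 + k) * \<bar>t\<bar> powr (- (3/2))"
      using wave_asymptotics[of "- t" k "- \<sigma>"] t1 k by (simp add: E v'_def \<sigma>_def)
    have f: "norm (\<phi> t - c * E t) \<le> max \<bar>A\<bar> \<bar>B\<bar> * \<bar>t\<bar> powr (- p)"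
    proof (cases "t > 0")
      case True
      then have "norm (\<phi> t - c * E t) \<le> A * \<bar>t\<bar> powr (- p)" using T1[of t] t by (auto simp: c_def T_def)
      also have "\<dots> \<le> max \<bar>A\<bar> \<bar>B\<bar> * \<bar>t\<bar> powr (- p)" by (intro mult_right_mono) auto
      finally show ?thesis .
    next
      case False
      then have "norm (\<phi> t - c * E t) \<le> B * \<bar>t\<bar> powr (- p)" using T2[of t] t by (auto simp: c_def T_def)
      also have "\<dots> \<le> max \<bar>A\<bar> \<bar>B\<bar> * \<bar>t\<bar> powr (- p)" by (intro mult_right_mono) auto
      finally show ?thesis .
    qed
    have pq: "\<bar>t\<bar> powr (- p) \<le> \<bar>t\<bar> powr (- q)" "\<bar>t\<bar> powr (- (3/2)) \<le> \<bar>t\<bar> powr (- q)"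
      using t1 by (auto simp: q_def intro!: powr_mono)
    have "\<psi> t = (\<phi> t - c * E t) - \<alpha> * (wave k 1 t - v * E t) - \<beta> * (wave k 1 (- t) - v' * E t)"
      by (simp add: \<psi>_def vc[symmetric] algebra_simps)
    then have "norm (\<psi> t) \<le> norm (\<phi> t - c * E t) + norm \<alpha> * norm (wave k 1 t - v * E t) + norm \<beta> * norm (wave k 1 (- t) - v' * E t)"
      using norm_triangle_ineq4[of "(\<phi> t - c * E t) - \<alpha> * (wave k 1 t - v * E t)" "\<beta> * (wave k 1 (- t) - v' * E t)"]
        norm_triangle_ineq4[of "\<phi> t - c * E t" "\<alpha> * (wave k 1 t - v * E t)"]
      by (simp only: norm_mult)
    also have "\<dots> \<le> max \<bar>A\<bar> \<bar>B\<bar> * \<bar>t\<bar> powr (- q) + norm \<alpha> * ((2 + k) * \<bar>t\<bar> powr (- q)) + norm \<beta> * ((2 + k) * \<bar>t\<bar> powr (- q))"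
    proof (intro add_mono mult_left_mono)
      show "norm (\<phi> t - c * E t) \<le> max \<bar>A\<bar> \<bar>B\<bar> * \<bar>t\<bar> powr (- q)"
        using f mult_left_mono[OF pq(1), of "max \<bar>A\<bar> \<bar>B\<bar>"] by linarith
      show "norm (wave k 1 t - v * E t) \<le> (2 + k) * \<bar>t\<bar> powr (- q)" "norm (wave k 1 (- t) - v' * E t) \<le> (2 + k) * \<bar>t\<bar> powr (- q)"
        using w1 w2 mult_left_mono[OF pq(2), of "2 + k"] k by linarith+
    qed auto
    finally show ?thesis by (simp add: L_def algebra_simps)
  qed
  have "continuous_on {-T..T} \<psi>"
    unfolding \<psi>_def by (intro continuous_intros continuous_on_subset[OF cont]) auto
  from compact_imp_bounded[OF compact_continuous_image[OF this compact_Icc]]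
  obtain M0 where M0: "M0 > 0" "\<And>t. \<bar>t\<bar> \<le> T \<Longrightarrow> norm (\<psi> t) \<le> M0"
    unfolding bounded_pos by (auto simp: abs_le_iff)
  have q0: "q > 0" using p by (simp add: q_def)
  have L: "L \<ge> 0" using k by (simp add: L_def)
  \<comment> \<open>For \<open>|t| <= T\<close> the factor \<open>(1 + T) powr q\<close> compensates
    the weight; beyond \<open>T >= 1\<close> the estimate \<open>|t| >= (1 + |t|) / 2\<close> costs
    \<open>2 powr q\<close>.\<close>
  define M where "M = M0 * (1 + T) powr q + L * 2 powr q"
  have T0: "T \<ge> 1" by (simp add: T_def)
  have "M > 0" using M0 L T0 by (simp add: M_def add_pos_nonneg)
  moreover have "norm (\<psi> t) \<le> M * (1 + \<bar>t\<bar>) powr (- q)" for t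
  proof (cases "\<bar>t\<bar> \<le> T")
    case True
    have "1 = (1 + \<bar>t\<bar>) powr q * (1 + \<bar>t\<bar>) powr (- q)" unfolding powr_add[symmetric] by simp
    also have "\<dots> \<le> (1 + T) powr q * (1 + \<bar>t\<bar>) powr (- q)" using True q0 by (intro mult_right_mono powr_mono2) auto
    finally have "M0 * 1 \<le> M0 * ((1 + T) powr q * (1 + \<bar>t\<bar>) powr (- q))" using M0 by (intro mult_left_mono) auto
    moreover have "0 \<le> L * 2 powr q * (1 + \<bar>t\<bar>) powr (- q)" using L by simp
    ultimately show ?thesis using M0(2)[OF True] unfolding M_def distrib_right mult.assoc by linarith
  next
    case False
    have "\<bar>t\<bar> powr (- q) \<le> ((1 + \<bar>t\<bar>) / 2) powr (- q)" using False T0 q0 by (intro powr_mono2') auto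
    also have "\<dots> = 2 powr q * (1 + \<bar>t\<bar>) powr (- q)" by (simp add: powr_divide powr_minus field_simps)
    finally have "L * \<bar>t\<bar> powr (- q) \<le> L * (2 powr q * (1 + \<bar>t\<bar>) powr (- q))" using L by (intro mult_left_mono) auto
    moreover have "0 \<le> M0 * ((1 + T) powr q * (1 + \<bar>t\<bar>) powr (- q))" using M0 by simp
    ultimately show ?thesis using far[of t] False unfolding M_def distrib_right mult.assoc by linarith
  qed
  ultimately show ?thesis using that[of M \<alpha> \<beta>] unfolding \<psi>_def q_def by blast
qed

section \<open>Rescaling the Hankel profile to the kernel\<close>

lemma hankel_profile_zero:
  "((\<lambda>z. of_real (z\<^sup>2) * hankel_profile z) \<longlongrightarrow> 1) (at_right 0)"
proof -
  have l1: "((\<lambda>z::real. z\<^sup>2) \<longlongrightarrow> 0) (at_right 0)" and l2: "((\<lambda>z::real. 1 - z\<^sup>2 * (ln z / 2)) \<longlongrightarrow> 1) (at_right 0)"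
    by real_asymp+
  have "((\<lambda>z. of_real (z\<^sup>2) * (hankel_profile z - 1 / (of_real z)\<^sup>2 + of_real (ln z / 2)) + of_real (1 - z\<^sup>2 * (ln z / 2))) \<longlongrightarrow>
     of_real 0 * (of_real (1 / 4 + ln 2 / 2 - euler_mascheroni / 2) + \<i> * of_real (pi / 4)) + of_real 1) (at_right 0)"
    by (intro tendsto_add tendsto_mult tendsto_of_real l1 l2 hankel_profile_limit)
  then have lim: "((\<lambda>z. of_real (z\<^sup>2) * (hankel_profile z - 1 / (of_real z)\<^sup>2 + of_real (ln z / 2)) + of_real (1 - z\<^sup>2 * (ln z / 2))) \<longlongrightarrow> 1) (at_right 0)"
    by simp
  show ?thesis
  proof (rule Lim_transform_eventually[OF lim], rule eventually_mono[OF eventually_at_right_less])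
    fix z :: real assume z: "0 < z"
    have "w\<^sup>2 * (p - 1 / w\<^sup>2 + l) + (1 - w\<^sup>2 * l) = w\<^sup>2 * p" if "w \<noteq> 0" for w p l :: complex
      using that by (simp add: algebra_simps)
    from this[of "of_real z" "hankel_profile z" "of_real (ln z / 2)"] z
    show "of_real (z\<^sup>2) * (hankel_profile z - 1 / (of_real z)\<^sup>2 + of_real (ln z / 2)) + of_real (1 - z\<^sup>2 * (ln z / 2)) = of_real (z\<^sup>2) * hankel_profile z"
      by (simp only: of_real_power of_real_diff of_real_mult of_real_1 of_real_eq_0_iff less_imp_neq[symmetric] not_False_eq_True)
  qed
qed

text \<open>The profile in the variable \<open>z\<close> is \<open>i pi / 2 * H_1(z) / z\<close>;
  with \<open>z = k r\<close>, the factor \<open>k^2 / pi\<close> turns it into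
  \<open>(i k / 2) H_1(k r) / r\<close>, the kernel without its factor \<open>x1\<close>. The
  derivative picks up one more \<open>k\<close>.\<close>

definition kernel_profile :: "real \<Rightarrow> real \<Rightarrow> complex" where
  "kernel_profile k r = of_real (k\<^sup>2 / pi) * hankel_profile (k * r)"

definition kernel_profile' :: "real \<Rightarrow> real \<Rightarrow> complex" where
  "kernel_profile' k r = of_real (k ^ 3 / pi) * hankel_profile' (k * r)"

lemma radiating_kernel_profile:
  assumes k: "k > 0"
  obtains C where "radiating_profile k (kernel_profile k) (kernel_profile' k) C"
proof -
  obtain C0 where C0: "C0 > 0"
    "\<And>z. z > 0 \<Longrightarrow> norm (hankel_profile z) \<le> C0 * (z powr (- 2) + z powr (- (3/2)))"
    "\<And>z. z > 0 \<Longrightarrow> norm (hankel_profile' z - \<i> * hankel_profile z) \<le> C0 * (z powr (- 3) + z powr (- (5/2)))"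
    by (rule hankel_profile_bounds) blast
  define C1 where "C1 = k\<^sup>2 / pi * C0 * (k powr (- 2) + k powr (- (3/2)))"
  define C2 where "C2 = k ^ 3 / pi * C0 * (k powr (- 3) + k powr (- (5/2)))"
  define C where "C = C1 + C2"
  have Cp: "C1 > 0" "C2 > 0" using k C0(1) by (simp_all add: C1_def C2_def add_pos_pos)
  have sc: "(k * r) powr a + (k * r) powr b \<le> (k powr a + k powr b) * (r powr a + r powr b)" if "r > 0" for r a b
    using k that by (simp add: powr_mult algebra_simps add_increasing)
  have "radiating_profile k (kernel_profile k) (kernel_profile' k) C"
  proof
    show "k > 0" "C > 0" using k Cp by (auto simp: C_def)
    fix r :: real assume r: "r > 0"
    have kr: "k * r > 0" using k r by simp
    have d: "((\<lambda>r. k * r) has_vector_derivative k) (at r)"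
      by (auto intro!: derivative_eq_intros simp flip: has_real_derivative_iff_has_vector_derivative)
    note c = vector_diff_chain_at[OF d hankel_profile_ODE(1)[OF kr], unfolded o_def]
    note c' = vector_diff_chain_at[OF d hankel_profile_ODE(2)[OF kr], unfolded o_def]
    show "(kernel_profile k has_vector_derivative kernel_profile' k r) (at r)"
      unfolding kernel_profile_def[abs_def] kernel_profile'_def
      by (rule has_vector_derivative_eq_rhs[OF has_vector_derivative_mult_right[OF c]])
         (simp add: scaleR_conv_of_real power2_eq_square power3_eq_cube)
    show "(kernel_profile' k has_vector_derivative - (3 / of_real r) * kernel_profile' k r - of_real (k\<^sup>2) * kernel_profile k r) (at r)"
      unfolding kernel_profile'_def[abs_def] kernel_profile_def
      by (rule has_vector_derivative_eq_rhs[OF has_vector_derivative_mult_right[OF c']])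
         (use k r in \<open>simp add: scaleR_conv_of_real power2_eq_square power3_eq_cube field_simps\<close>)
    have "norm (kernel_profile k r) = k\<^sup>2 / pi * norm (hankel_profile (k * r))"
      unfolding kernel_profile_def norm_mult norm_of_real by simp
    also have "\<dots> \<le> k\<^sup>2 / pi * (C0 * ((k powr (- 2) + k powr (- (3/2))) * (r powr (- 2) + r powr (- (3/2)))))"
      using order_trans[OF C0(2)[OF kr] mult_left_mono[OF sc[OF r]]] C0(1) by (intro mult_left_mono) auto
    also have "\<dots> = C1 * (r powr (- 2) + r powr (- (3/2)))" by (simp add: C1_def)
    also have "\<dots> \<le> C * (r powr (- 2) + r powr (- (3/2)))" using Cp by (intro mult_right_mono) (auto simp: C_def)
    finally show "norm (kernel_profile k r) \<le> C * (r powr (- 2) + r powr (- (3/2)))" .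
    have "kernel_profile' k r - \<i> * of_real k * kernel_profile k r = of_real (k ^ 3 / pi) * (hankel_profile' (k * r) - \<i> * hankel_profile (k * r))"
      by (simp add: kernel_profile_def kernel_profile'_def power2_eq_square power3_eq_cube right_diff_distrib)
    then have "norm (kernel_profile' k r - \<i> * of_real k * kernel_profile k r) = k ^ 3 / pi * norm (hankel_profile' (k * r) - \<i> * hankel_profile (k * r))"
      using k by (simp only: norm_mult norm_of_real) simp
    also have "\<dots> \<le> k ^ 3 / pi * (C0 * ((k powr (- 3) + k powr (- (5/2))) * (r powr (- 3) + r powr (- (5/2)))))"
      using order_trans[OF C0(3)[OF kr] mult_left_mono[OF sc[OF r]]] C0(1) k by (intro mult_left_mono) auto
    also have "\<dots> = C2 * (r powr (- 3) + r powr (- (5/2)))" by (simp add: C2_def)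
    also have "\<dots> \<le> C * (r powr (- 3) + r powr (- (5/2)))" using Cp by (intro mult_right_mono) (auto simp: C_def)
    finally show "norm (kernel_profile' k r - \<i> * of_real k * kernel_profile k r) \<le> C * (r powr (- 3) + r powr (- (5/2)))" .
  next
    have "filterlim (\<lambda>r. k * r) (at_right 0) (at_right 0)" using k by real_asymp
    from tendsto_mult[OF tendsto_const[of "of_real (1 / pi)"] filterlim_compose[OF hankel_profile_zero this]]
    have "((\<lambda>r. of_real (1 / pi) * (of_real ((k * r)\<^sup>2) * hankel_profile (k * r))) \<longlongrightarrow> of_real (1 / pi)) (at_right 0)"
      by simp
    moreover have "of_real (1 / pi) * (of_real ((k * r)\<^sup>2) * hankel_profile (k * r)) = of_real (r\<^sup>2) * kernel_profile k r" for r
      by (simp add: kernel_profile_def power_mult_distrib)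
    ultimately show "((\<lambda>r. of_real (r\<^sup>2) * kernel_profile k r) \<longlongrightarrow> of_real (1 / pi)) (at_right 0)"
      by (simp only:)
  qed
  then show ?thesis by (rule that)
qed

lemma hp_kernel_eq_profile:
  assumes k: "k > 0" and a: "a > 0"
  shows "hp_kernel k a y = of_real a * kernel_profile k (rho a y)"
proof -
  have r: "rho a y > 0" using a by (intro rho_pos) auto
  have n: "norm (a, y) = rho a y" by (simp add: norm_Pair rho_def)
  have "kernel_profile k (rho a y) = of_real (k\<^sup>2 / pi) * (\<i> * of_real (pi / 2) * hankel1 1 (k * rho a y) / of_real (k * rho a y))"
    using hankel1_eq_profile[of "k * rho a y"] k r by (simp add: kernel_profile_def)
  also have "\<dots> = \<i> * of_real k / 2 * (hankel1 1 (k * rho a y) / of_real (rho a y))"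
    using k r by (simp add: power2_eq_square)
  finally show ?thesis unfolding hp_kernel_def n by simp
qed

context radiating_density
begin

text \<open>Within distance 1 of the origin the estimate for bounded densities is enough: there
  \<open>sqrt a <= 1\<close>, and the weight is at least 1/2.\<close>

lemma potential_decay:
  obtains K where "K > 0" "\<And>a x. a > 0 \<Longrightarrow> norm (potential \<psi> a x) \<le> K * (1 + rho a x) powr (- (1/2))"
proof -
  obtain K1 where K1: "K1 > 0" "\<And>a x. a > 0 \<Longrightarrow> rho a x \<ge> 1 \<Longrightarrow> norm (potential \<psi> a x) \<le> K1 * rho a x powr (- (1/2))"
    by (rule potential_decay_far) blast
  define K where "K = 2 * K1 + 4 * M * P_total"
  have K: "K > 0" using K1 M P_total_nonneg by (simp add: K_def add_pos_nonneg)
  show ?thesis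
  proof (rule that[OF K])
    fix a x :: real assume a: "a > 0"
    let ?R = "rho a x"
    have half: "(c::real) powr (- (1/2)) = 1 / sqrt c" if "c > 0" for c
      using that by (simp add: powr_minus_divide powr_half_sqrt)
    show "norm (potential \<psi> a x) \<le> K * (1 + ?R) powr (- (1/2))"
    proof (cases "?R \<ge> 1")
      case True
      have "?R powr (- (1/2)) \<le> ((1 + ?R) / 4) powr (- (1/2))" using True by (intro powr_mono2') auto
      also have "\<dots> = 2 * (1 + ?R) powr (- (1/2))"
        using True by (simp add: half real_sqrt_divide)
      finally have "K1 * ?R powr (- (1/2)) \<le> K1 * (2 * (1 + ?R) powr (- (1/2)))" using K1 by (intro mult_left_mono) auto
      moreover have "0 \<le> 4 * M * P_total * (1 + ?R) powr (- (1/2))" using M P_total_nonneg by simp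
      ultimately show ?thesis using K1(2)[OF a True] unfolding K_def distrib_right mult.assoc by linarith
    next
      case False
      have "1 / 2 \<le> (1 + ?R) powr (- (1/2))"
      proof -
        have "sqrt (1 + ?R) \<le> 2" by (rule real_le_lsqrt) (use False in auto)
        then have "1 / 2 \<le> 1 / sqrt (1 + ?R)" using rho_ge(3)[of a x] by (intro divide_left_mono) auto
        then show ?thesis using rho_ge(3)[of a x] by (simp add: half)
      qed
      then have "4 * M * P_total * (1 / 2) \<le> 4 * M * P_total * (1 + ?R) powr (- (1/2))"
        using M P_total_nonneg by (intro mult_left_mono) auto
      moreover have "norm (potential \<psi> a x) \<le> M * P_total * 2"
      proof -
        have "sqrt a \<le> 1" using rho_ge(1)[of a x] a False by simp
        then have "M * P_total * (1 + sqrt a) \<le> M * P_total * 2" using M P_total_nonneg by (intro mult_left_mono) auto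
        then show ?thesis using potential_bounded_density[OF a \<psi>_meas \<psi>_le, of x] by linarith
      qed
      moreover have "0 \<le> K1 * (2 * (1 + ?R) powr (- (1/2)))" using K1 by simp
      ultimately show ?thesis unfolding K_def distrib_right mult.assoc by linarith
    qed
  qed
qed

end

lemma ray_coordinates:
  fixes x :: "real \<times> real"
  assumes "fst x > 0"
  defines "c \<equiv> fst x / norm x" and "s \<equiv> snd x / norm x"
  shows "c\<^sup>2 + s\<^sup>2 = 1" "c > 0" "norm x > 0" "norm x * c = fst x" "norm x * s = snd x"
    and "along_ray u x = (\<lambda>r. u (r * c, r * s))" and "norm x = rho (fst x) (snd x)"
proof -
  show n: "norm x = rho (fst x) (snd x)" by (cases x) (simp add: norm_Pair rho_def)
  show p: "norm x > 0" unfolding n using assms(1) by (intro rho_pos) auto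
  show "norm x * c = fst x" "norm x * s = snd x" "c > 0" using p assms(1) by (auto simp: c_def s_def)
  have "(norm x)\<^sup>2 = (fst x)\<^sup>2 + (snd x)\<^sup>2" unfolding n by (simp add: rho_def)
  moreover have "c\<^sup>2 + s\<^sup>2 = ((fst x)\<^sup>2 + (snd x)\<^sup>2) / (norm x)\<^sup>2"
    by (simp add: c_def s_def power_divide add_divide_distrib)
  ultimately show "c\<^sup>2 + s\<^sup>2 = 1" using p by (metis divide_self less_irrefl power_not_zero)
  show "along_ray u x = (\<lambda>r. u (r * c, r * s))"
    by (cases x) (simp add: along_ray_def[abs_def] c_def s_def divide_inverse mult_ac)
qed

theorem lemma3p3:
  fixes k p :: real and c_plus c_minus :: complex
    and \<phi> :: "real \<Rightarrow> complex" and u :: "real \<times> real \<Rightarrow> complex"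
  assumes k: "k > 0"
    and p: "p > 1"
    and cont: "continuous_on UNIV \<phi>"
    and asymp_plus:
      "(\<lambda>t. \<phi> t - c_plus * exp (\<i> * of_real (k * \<bar>t\<bar>)) * of_real (\<bar>t\<bar> powr (-1/2)))
         \<in> O[at_top](\<lambda>t. of_real (\<bar>t\<bar> powr (-p)))"
    and asymp_minus:
      "(\<lambda>t. \<phi> t - c_minus * exp (\<i> * of_real (k * \<bar>t\<bar>)) * of_real (\<bar>t\<bar> powr (-1/2)))
         \<in> O[at_bot](\<lambda>t. of_real (\<bar>t\<bar> powr (-p)))"
    and u: "u = hp_potential k \<phi>"
  shows
    \<comment> \<open>the integral defining \<open>u\<close> and the radial derivative of \<open>u\<close> exist\<close>
    "(\<forall>x\<in>half_plane.
        integrable lborel (\<lambda>t. hp_kernel k (fst x) (snd x - t) * \<phi> t) \<and>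
        along_ray u x differentiable (at (norm x))) \<and>
     (\<exists>C>0. \<forall>x\<in>half_plane. norm (u x) \<le> C * (1 + norm x) powr (-1/2)) \<and>
     (\<forall>\<epsilon>>0. ((\<lambda>R. ennreal (R powr (1/2)) *
                 (SUP x\<in>{x. fst x > \<epsilon> \<and> norm x = R}.
                    ennreal (norm (radial_deriv u x - \<i> * of_real k * u x))))
               \<longlongrightarrow> 0) at_top)"
proof -
  obtain C where "radiating_profile k (kernel_profile k) (kernel_profile' k) C"
    by (rule radiating_kernel_profile[OF k])
  then interpret K: radiating_profile k "kernel_profile k" "kernel_profile' k" C .
  obtain \<alpha> \<beta> M where M: "M > 0"
    "\<And>t. norm (\<phi> t - \<alpha> * wave k 1 t - \<beta> * wave k 1 (- t)) \<le> M * (1 + \<bar>t\<bar>) powr (- min p (3/2))"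
    by (rule density_decomposition[OF k p cont asymp_plus asymp_minus]) blast
  define \<psi> where "\<psi> t = \<phi> t - \<alpha> * wave k 1 t - \<beta> * wave k 1 (- t)" for t
  have cw: "continuous_on UNIV (\<lambda>t. wave k 1 t)" "continuous_on UNIV (\<lambda>t. wave k 1 (- t))"
    by (intro continuous_intros; simp)+
  interpret D: radiating_density k "kernel_profile k" "kernel_profile' k" C \<psi> "min p (3/2)" M
  proof
    show "continuous_on UNIV \<psi>" unfolding \<psi>_def by (intro continuous_intros cont cw)
  qed (use p M in \<open>auto simp: \<psi>_def\<close>)
  have mw: "(\<lambda>t. wave k 1 t) \<in> borel_measurable lborel" "(\<lambda>t. wave k 1 (- t)) \<in> borel_measurable lborel"
    using cw by (simp_all add: borel_measurable_continuous_onI)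
  have w1: "norm (wave k 1 t) \<le> 1" for t by (rule wave_bounds(1)) (use k in auto)
  have kernel: "hp_kernel k a y = K.P a y" if "a > 0" for a y
    using hp_kernel_eq_profile[OF k that] by (simp add: K.P_def)
  have split: "K.P a (y - t) * \<phi> t = \<alpha> * (K.P a (y - t) * wave k 1 t) + \<beta> * (K.P a (y - t) * wave k 1 (- t)) + K.P a (y - t) * \<psi> t" for a y t
    by (simp add: \<psi>_def algebra_simps)
  have int: "integrable lborel (\<lambda>t. \<alpha> * (K.P a (y - t) * wave k 1 t))"
      "integrable lborel (\<lambda>t. \<beta> * (K.P a (y - t) * wave k 1 (- t)))" if "a > 0" for a y
    by (rule integrable_mult_right[OF K.integrable_P_mult[OF that mw(1) w1]]
        integrable_mult_right[OF K.integrable_P_mult[OF that mw(2) w1]])+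
  \<comment> \<open>By the Poisson formulas the matched part of the data contributes the wave and
    its reflection in closed form; only the potential of \<open>\<psi>\<close> remains an
    integral.\<close>
  have ueq: "u (a, y) = \<alpha> * wave k (1 + a) y + \<beta> * wave k (1 + a) (- y) + K.potential \<psi> a y" if a: "a > 0" for a y
  proof -
    have "u (a, y) = (\<integral>t. K.P a (y - t) * \<phi> t \<partial>lborel)"
      using a by (simp add: u hp_potential_def kernel)
    also have "\<dots> = \<alpha> * (\<integral>t. K.P a (y - t) * wave k 1 t \<partial>lborel) + \<beta> * (\<integral>t. K.P a (y - t) * wave k 1 (- t) \<partial>lborel)
        + (\<integral>t. K.P a (y - t) * \<psi> t \<partial>lborel)"
      unfolding split
      by (simp only: Bochner_Integration.integral_add[OF Bochner_Integration.integrable_add[OF int[OF a]] D.integrable_P_\<psi>[OF a]]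
          Bochner_Integration.integral_add[OF int[OF a]] integral_mult_right_zero)
    finally show ?thesis
      by (simp only: K.poisson_wave[OF a] K.poisson_wave_reflected[OF a] K.potential_def)
  qed
  \<comment> \<open>Existence of the radial derivative and the bound for its defect are proved
    together, so that the former gives differentiability and the latter the radiation
    condition.\<close>
  have ray: "\<exists>D. ((\<lambda>r. u (r * c, r * s)) has_vector_derivative D) (at r) \<and>
      norm (D - \<i> * of_real k * u (r * c, r * s)) \<le> (norm \<alpha> + norm \<beta>) * (2 * k + 1) * r powr (- (3/2)) +
        norm ((\<integral>t. D.ray_flux c s r t * \<psi> t \<partial>lborel) - \<i> * of_real k * K.potential \<psi> (r * c) (r * s))"
    if cs: "c\<^sup>2 + s\<^sup>2 = 1" and c: "c > 0" and r: "r > 0" for c s r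
  proof -
    obtain D1 where D1: "((\<lambda>r. wave k (1 + r * c) (r * s)) has_vector_derivative D1) (at r)"
      "norm (D1 - \<i> * of_real k * wave k (1 + r * c) (r * s)) \<le> (2 * k + 1) * r powr (- (3/2))"
      by (rule wave_along_ray[OF cs c r k])
    have "c\<^sup>2 + (- s)\<^sup>2 = 1" using cs by simp
    then obtain D2 where D2: "((\<lambda>r. wave k (1 + r * c) (r * - s)) has_vector_derivative D2) (at r)"
      "norm (D2 - \<i> * of_real k * wave k (1 + r * c) (r * - s)) \<le> (2 * k + 1) * r powr (- (3/2))"
      by (rule wave_along_ray[OF _ c r k])
    define D3 where "D3 = (\<integral>t. D.ray_flux c s r t * \<psi> t \<partial>lborel)"
    have "((\<lambda>r. \<alpha> * wave k (1 + r * c) (r * s) + \<beta> * wave k (1 + r * c) (r * - s) + K.potential \<psi> (r * c) (r * s))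
        has_vector_derivative \<alpha> * D1 + \<beta> * D2 + D3) (at r)"
      unfolding D3_def
      by (intro has_vector_derivative_add has_vector_derivative_mult_right D1(1) D2(1) D.potential_along_ray(2)[OF cs c r])
    then have "((\<lambda>r. u (r * c, r * s)) has_vector_derivative \<alpha> * D1 + \<beta> * D2 + D3) (at r)"
      by (rule has_vector_derivative_transform_within_open[of _ _ _ "{0<..}"]) (use c r in \<open>auto simp: ueq\<close>)
    moreover have "norm (\<alpha> * D1 + \<beta> * D2 + D3 - \<i> * of_real k * u (r * c, r * s)) \<le>
       (norm \<alpha> + norm \<beta>) * (2 * k + 1) * r powr (- (3/2)) + norm (D3 - \<i> * of_real k * K.potential \<psi> (r * c) (r * s))"
    proof -
      let ?w1 = "wave k (1 + r * c) (r * s)" and ?w2 = "wave k (1 + r * c) (r * - s)"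
      let ?p = "K.potential \<psi> (r * c) (r * s)"
      have "u (r * c, r * s) = \<alpha> * ?w1 + \<beta> * ?w2 + ?p" using c r by (simp add: ueq)
      then have "\<alpha> * D1 + \<beta> * D2 + D3 - \<i> * of_real k * u (r * c, r * s) =
          \<alpha> * (D1 - \<i> * of_real k * ?w1) + \<beta> * (D2 - \<i> * of_real k * ?w2) + (D3 - \<i> * of_real k * ?p)"
        by (simp add: algebra_simps)
      also have "norm \<dots> \<le> norm \<alpha> * norm (D1 - \<i> * of_real k * ?w1) + norm \<beta> * norm (D2 - \<i> * of_real k * ?w2) + norm (D3 - \<i> * of_real k * ?p)"
        unfolding norm_mult[symmetric] by (intro order_trans[OF norm_triangle_ineq] add_right_mono norm_triangle_ineq)
      also have "\<dots> \<le> norm \<alpha> * ((2 * k + 1) * r powr (- (3/2))) + norm \<beta> * ((2 * k + 1) * r powr (- (3/2))) + norm (D3 - \<i> * of_real k * ?p)"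
        by (intro add_right_mono add_mono mult_left_mono D1(2) D2(2)) auto
      finally show ?thesis by (simp add: algebra_simps)
    qed
    ultimately show ?thesis unfolding D3_def by blast
  qed
  have exists: "integrable lborel (\<lambda>t. hp_kernel k (fst x) (snd x - t) * \<phi> t) \<and> along_ray u x differentiable (at (norm x))"
    if "x \<in> half_plane" for x
  proof
    have a: "fst x > 0" using that by (simp add: half_plane_def)
    show "integrable lborel (\<lambda>t. hp_kernel k (fst x) (snd x - t) * \<phi> t)"
      unfolding kernel[OF a] split
      by (intro Bochner_Integration.integrable_add int[OF a] D.integrable_P_\<psi>[OF a])
    show "along_ray u x differentiable (at (norm x))"
      using ray[OF ray_coordinates(1-3)[OF a]] unfolding ray_coordinates(6)[OF a]
      by (auto intro: differentiableI_vector)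
  qed
  have bounded: "\<exists>C>0. \<forall>x\<in>half_plane. norm (u x) \<le> C * (1 + norm x) powr (- 1 / 2)"
  proof -
    obtain K where K: "K > 0" "\<And>a x. a > 0 \<Longrightarrow> norm (K.potential \<psi> a x) \<le> K * (1 + rho a x) powr (- (1/2))"
      by (rule D.potential_decay) blast
    show ?thesis
    proof (intro exI[of _ "2 * norm \<alpha> + 2 * norm \<beta> + K"] conjI ballI)
      show "2 * norm \<alpha> + 2 * norm \<beta> + K > 0" using K(1) by (simp add: add_nonneg_pos)
      fix x :: "real \<times> real" assume "x \<in> half_plane"
      then have a: "fst x > 0" by (simp add: half_plane_def)
      define a' y where "a' = fst x" and "y = snd x"
      have x: "x = (a', y)" "a' > 0" using a by (simp_all add: a'_def y_def)
      have n: "norm x = rho a' y" using ray_coordinates(7)[OF a] by (simp add: a'_def y_def)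
      let ?d = "(1 + rho a' y) powr (- (1/2))"
      have "norm (u x) \<le> norm \<alpha> * norm (wave k (1 + a') y) + norm \<beta> * norm (wave k (1 + a') (- y)) + norm (K.potential \<psi> a' y)"
        unfolding x(1) ueq[OF x(2)] norm_mult[symmetric]
        by (intro order_trans[OF norm_triangle_ineq] add_right_mono norm_triangle_ineq)
      also have "\<dots> \<le> norm \<alpha> * (2 * ?d) + norm \<beta> * (2 * ?d) + K * ?d"
        using wave_decay[OF x(2), of k y] wave_decay[OF x(2), of k "- y"] K(2)[OF x(2), of y]
        by (intro add_mono mult_left_mono) auto
      finally show "norm (u x) \<le> (2 * norm \<alpha> + 2 * norm \<beta> + K) * (1 + norm x) powr (- 1 / 2)"
        unfolding n by (simp add: algebra_simps)
    qed
  qed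
  have radiating: "((\<lambda>R. ennreal (R powr (1/2)) * (SUP x\<in>{x. fst x > \<epsilon> \<and> norm x = R}.
      ennreal (norm (radial_deriv u x - \<i> * of_real k * u x)))) \<longlongrightarrow> 0) at_top" if \<epsilon>: "\<epsilon> > 0" for \<epsilon>
  proof -
    define \<eta> where "\<eta> = (min p (3/2) - 1) / 2"
    have \<eta>: "\<eta> > 0" using p by (simp add: \<eta>_def)
    obtain K where K: "K > 0" "\<And>c s r. c\<^sup>2 + s\<^sup>2 = 1 \<Longrightarrow> r * c > \<epsilon> \<Longrightarrow> c > 0 \<Longrightarrow> r \<ge> 1 \<Longrightarrow>
       norm ((\<integral>t. D.ray_flux c s r t * \<psi> t \<partial>lborel) - \<i> * of_real k * K.potential \<psi> (r * c) (r * s)) \<le> K * r powr (- (1/2) - \<eta>)"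
      by (rule D.potential_radiation[OF \<epsilon>]) (auto simp: \<eta>_def)
    define L where "L = (norm \<alpha> + norm \<beta>) * (2 * k + 1)"
    have L: "L \<ge> 0" using k by (simp add: L_def)
    have le: "norm (radial_deriv u x - \<i> * of_real k * u x) \<le> L * R powr (- (3/2)) + K * R powr (- (1/2) - \<eta>)"
      if x: "fst x > \<epsilon>" "norm x = R" and R: "R \<ge> 1" for x R
    proof -
      have a: "fst x > 0" using x \<epsilon> by simp
      note rc = ray_coordinates[OF a]
      let ?c = "fst x / norm x" and ?s = "snd x / norm x"
      obtain D where D: "((\<lambda>r. u (r * ?c, r * ?s)) has_vector_derivative D) (at (norm x))"
        "norm (D - \<i> * of_real k * u (norm x * ?c, norm x * ?s)) \<le> L * norm x powr (- (3/2)) +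
          norm ((\<integral>t. D.ray_flux ?c ?s (norm x) t * \<psi> t \<partial>lborel) - \<i> * of_real k * K.potential \<psi> (norm x * ?c) (norm x * ?s))"
        using ray[OF rc(1-3)] unfolding L_def by blast
      have rd: "radial_deriv u x = D"
        unfolding radial_deriv_def rc(6) by (rule vector_derivative_at[OF D(1)])
      have ux: "u (norm x * ?c, norm x * ?s) = u x" unfolding rc(4,5) by simp
      have "norm ((\<integral>t. D.ray_flux ?c ?s (norm x) t * \<psi> t \<partial>lborel) - \<i> * of_real k * K.potential \<psi> (norm x * ?c) (norm x * ?s))
          \<le> K * norm x powr (- (1/2) - \<eta>)"
        by (rule K(2)[OF rc(1) _ rc(2)]) (use x R rc(4) in auto)
      then show ?thesis using D(2)[unfolded ux] unfolding rd x(2) by linarith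
    qed
    \<comment> \<open>The factor \<open>R powr (1/2)\<close> has been multiplied in: the waves
      contribute \<open>R^(-3/2)\<close> to the defect and the potential of \<open>\<psi>\<close>
      contributes \<open>R^(-1/2 - \<eta>)\<close>.\<close>
    let ?f = "\<lambda>R::real. L * R powr (- 1) + K * R powr (- \<eta>)"
    have lim: "((\<lambda>R. ennreal (?f R)) \<longlongrightarrow> ennreal 0) at_top"
    proof (rule tendsto_ennrealI)
      have "((\<lambda>R::real. R powr (- 1)) \<longlongrightarrow> 0) at_top" by real_asymp
      moreover have "((\<lambda>R::real. R powr (- \<eta>)) \<longlongrightarrow> 0) at_top" using \<eta> by real_asymp
      ultimately have "((\<lambda>R. ?f R) \<longlongrightarrow> L * 0 + K * 0) at_top" by (intro tendsto_intros)
      then show "((\<lambda>R. ?f R) \<longlongrightarrow> 0) at_top" by simp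
    qed
    have le': "\<forall>\<^sub>F R in at_top. ennreal (R powr (1/2)) * (SUP x\<in>{x. fst x > \<epsilon> \<and> norm x = R}.
      ennreal (norm (radial_deriv u x - \<i> * of_real k * u x))) \<le> ennreal (?f R)"
    proof (rule eventually_mono[OF eventually_ge_at_top[of 1]])
      fix R :: real assume R: "R \<ge> 1"
      let ?g = "L * R powr (- (3/2)) + K * R powr (- (1/2) - \<eta>)"
      \<comment> \<open>For \<open>R <= \<epsilon>\<close> the index set is empty and the supremum
        in \<open>ennreal\<close> is 0; in every case a bound uniform over the points
        suffices.\<close>
      have "(SUP x\<in>{x. fst x > \<epsilon> \<and> norm x = R}. ennreal (norm (radial_deriv u x - \<i> * of_real k * u x))) \<le> ennreal ?g"
        by (rule SUP_least) (use le R in \<open>auto intro!: ennreal_leI\<close>)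
      then have "ennreal (R powr (1/2)) * (SUP x\<in>{x. fst x > \<epsilon> \<and> norm x = R}.
          ennreal (norm (radial_deriv u x - \<i> * of_real k * u x))) \<le> ennreal (R powr (1/2)) * ennreal ?g"
        by (rule mult_left_mono) simp
      also have "\<dots> = ennreal (R powr (1/2) * ?g)"
        by (rule ennreal_mult[symmetric]) (use L K R in auto)
      also have "R powr (1/2) * ?g = L * (R powr (1/2) * R powr (- (3/2))) + K * (R powr (1/2) * R powr (- (1/2) - \<eta>))"
        by (simp add: algebra_simps)
      also have "\<dots> = ?f R" unfolding powr_add[symmetric] by simp
      finally show "ennreal (R powr (1/2)) * (SUP x\<in>{x. fst x > \<epsilon> \<and> norm x = R}.
          ennreal (norm (radial_deriv u x - \<i> * of_real k * u x))) \<le> ennreal (?f R)" .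
    qed
    show ?thesis
      by (rule tendsto_sandwich[OF always_eventually[OF allI[OF zero_le]] le' tendsto_const lim[unfolded ennreal_0]])
  qed
  from exists bounded radiating show ?thesis by blast
qed

end
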